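(* Let $\beta\in(0,3)$ and let $(q,\lambda)$ be a smooth localization pair on $\Omega=(0,1)$ (as defined in the context). Let $f\in L^2(\Omega)$ be such that the solution $u_0$ of $-u_0''=f$ in $\Omega$, $u_0(0)=u_0(1)=0$, belongs to $H^4(\Omega)\cap H_0^1(\Omega)$. For $\delta\in(0,\delta_* )$ and $h=1/N$ ($N\ge1$ an integer), let $u_{\delta,h}\in V_h$ be the solution of $\mathcal B_\delta(u_{\delta,h},v_h)=(f,v_h)$ for all $v_h\in V_h$. Then for every pair of sequences $\delta_n\in(0,\delta_* )$ and $h_n\in\{1/N:N\in\mathbb N,\ N\ge1\}$ with $\delta_n\to0$ and $h_n\to0$, $$\|u_{\delta_n,h_n}-u_0\|_{L^2(0,1)}\longrightarrow0 .$$
   Context: Let $\Omega=(0,1)$, $d(x)=\operatorname{dist}(x,\partial\Omega)$, $\beta\in(0,3)$, and $(\cdot,\cdot)$ the $L^2(\Omega)$ inner product. Localization pair: functions $q:[0,\infty)\to[0,\infty)$ and $\lambda:\overline\Omega\to[0,\infty)$, together with constants $C_q\ge1$, $\kappa_0\ge1$, $\kappa_1,\kappa_2>0$, such that: (1) $q\in C^3([0,\infty))$, $q(0)=q'(0)=0$, $q''(0)>0$; $0<q(r)\le r$ for $r>0$; $0\le q'(r)\le1$ and $0\le q''(r)\le1$ for $r\ge0$; $q''\in C_b^1([0,\infty))$ (bounded with bounded continuous derivative); $q(2r)\le C_q q(r)$ for $r>0$. (2) $\lambda\in C^0(\overline\Omega)\cap C^2(\Omega)$; $\kappa_0^{-1}d(x)\le\lambda(x)\le\kappa_0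 d(x)$ on $\overline\Omega$; $|\lambda(x)-\lambda(y)|\le\kappa_1|x-y|$ for $x,y\in\Omega$; $|\lambda^{(j)}(x)|\le\kappa_j d(x)^{1-j}$ for $x\in\Omega$, $j=0,1,2$; $\lambda'(0^+)=1$, $\lambda'(1^-)=-1$. Smooth localization pair: in addition $\lambda\in C^3(\Omega)$ and $|\lambda'''(x)|\le\kappa_3 d(x)^{-2}$ on $\Omega$ for some constant $\kappa_3>0$. Range of $\delta$: $\delta_*:=\min\{\delta_0,\bar\delta_0\}$, where $\delta_0=\bigl(3\max\{1,\kappa_1,C_q\kappa_0^{\log_2 C_q}\}\bigr)^{-1}$ and $\bar\delta_0$ is the smallest positive root of $\frac{\delta(1+\kappa_1\delta)}{(1-\kappa_1\delta)^2}=\frac13$. Put $\eta(x)=q(\lambda(x))$, $\eta_\delta(x)=\delta\eta(x)$, $C_\beta=\frac{3-\beta}{2}$, $w_\delta(x)=C_\beta\,\eta_\delta(x)^{-(3-\beta)}$, and $$\mathcal B_\delta(u,v)=\int_0^1\int_0^1 w_\delta(x)\mathbf 1_{\{|y-x|<\eta_\delta(x)\}}\frac{(u(x)-u(y))(v(x)-v(y))}{|x-y|^\beta}\,dy\,dx.$$ Finite element space: for an integer $N\ge1$, $h=1/N$, $x_i=ih$, $V_h$ is the space of $v_h\in C^0([0,1])$ that are affine on each $(x_{i-1},x_i]$, $i=1,\dots,N$, with $v_h(0)=v_h(1)=0$. The discrete problem has a unique solution. *)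

theory Defs
  imports "HOL-Analysis.Analysis"
begin

abbreviation Omega :: "real set" ("\<Omega>") where
  "\<Omega> \<equiv> {0<..<1}"

definition bdist :: "real \<Rightarrow> real" where
  "bdist x = infdist x (frontier \<Omega>)"


section \<open>Classical derivatives relative to a set\<close>

text \<open>Derivatives are taken within the domain \<open>S\<close>, hence are one-sided at a boundary point that
  belongs to \<open>S\<close>; only values of the function on \<open>S\<close> matter.\<close>

definition nderiv_on :: "nat \<Rightarrow> real set \<Rightarrow> (real \<Rightarrow> real) \<Rightarrow> real \<Rightarrow> real" where
  "nderiv_on k S f = ((\<lambda>g x. vector_derivative g (at x within S)) ^^ k) f"

definition Ck_on :: "nat \<Rightarrow> real set \<Rightarrow> (real \<Rightarrow> real) \<Rightarrow> bool" where
  "Ck_on k S f \<longleftrightarrow>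
     (\<forall>j<k. nderiv_on j S f differentiable_on S) \<and> continuous_on S (nderiv_on k S f)"


section \<open>Localization pairs\<close>

locale localization_pair =
  fixes q lam :: "real \<Rightarrow> real" and Cq :: real and \<kappa> :: "nat \<Rightarrow> real"
  assumes Cq: "1 \<le> Cq"
    and kappa: "1 \<le> \<kappa> 0" "0 < \<kappa> 1" "0 < \<kappa> 2"
    and q_nonneg: "\<And>r. 0 \<le> r \<Longrightarrow> 0 \<le> q r"
    and q_C3: "Ck_on 3 {0..} q"
    and q_zero: "q 0 = 0" "nderiv_on 1 {0..} q 0 = 0" "0 < nderiv_on 2 {0..} q 0"
    and q_pos: "\<And>r. 0 < r \<Longrightarrow> 0 < q r"
    and q_le: "\<And>r. 0 < r \<Longrightarrow> q r \<le> r"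
    and q_deriv1: "\<And>r. 0 \<le> r \<Longrightarrow> nderiv_on 1 {0..} q r \<in> {0..1}"
    and q_deriv2: "\<And>r. 0 \<le> r \<Longrightarrow> nderiv_on 2 {0..} q r \<in> {0..1}"
    and q_deriv2_C1: "Ck_on 1 {0..} (nderiv_on 2 {0..} q)"
    and q_deriv2_bounded: "bounded (nderiv_on 2 {0..} q ` {0..})"
    and q_deriv3_bounded: "bounded (nderiv_on 3 {0..} q ` {0..})"
    and q_doubling: "\<And>r. 0 < r \<Longrightarrow> q (2 * r) \<le> Cq * q r"
    and lam_nonneg: "\<And>x. x \<in> {0..1} \<Longrightarrow> 0 \<le> lam x"
    and lam_cont: "continuous_on {0..1} lam"
    and lam_C2: "Ck_on 2 \<Omega> lam"
    and lam_lower: "\<And>x. x \<in> {0..1} \<Longrightarrow> inverse (\<kappa> 0) * bdist x \<le> lam x"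
    and lam_upper: "\<And>x. x \<in> {0..1} \<Longrightarrow> lam x \<le> \<kappa> 0 * bdist x"
    and lam_lipschitz: "\<And>x y. x \<in> \<Omega> \<Longrightarrow> y \<in> \<Omega> \<Longrightarrow> \<bar>lam x - lam y\<bar> \<le> \<kappa> 1 * \<bar>x - y\<bar>"
    and lam_derivs: "\<And>x j. x \<in> \<Omega> \<Longrightarrow> j \<le> 2 \<Longrightarrow>
          \<bar>nderiv_on j \<Omega> lam x\<bar> \<le> \<kappa> j * bdist x powi (1 - int j)"
    and lam_deriv_left_end: "(nderiv_on 1 \<Omega> lam \<longlongrightarrow> 1) (at_right 0)"
    and lam_deriv_right_end: "(nderiv_on 1 \<Omega> lam \<longlongrightarrow> -1) (at_left 1)"

locale smooth_localization_pair = localization_pair +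
  assumes lam_C3: "Ck_on 3 \<Omega> lam"
    and lam_deriv3: "\<exists>\<kappa>\<^sub>3>0. \<forall>x\<in>\<Omega>. \<bar>nderiv_on 3 \<Omega> lam x\<bar> \<le> \<kappa>\<^sub>3 * bdist x powi (-2)"

definition delta_zero :: "real \<Rightarrow> (nat \<Rightarrow> real) \<Rightarrow> real" where
  "delta_zero Cq \<kappa> = inverse (3 * Max {1, \<kappa> 1, Cq * \<kappa> 0 powr (log 2 Cq)})"

text \<open>The junk value of the quotient at \<open>\<delta> = 1 / \<kappa> 1\<close> is \<open>0\<close>, so no spurious root arises.\<close>

definition delta_bar_zero :: "(nat \<Rightarrow> real) \<Rightarrow> real" where
  "delta_bar_zero \<kappa> = (LEAST \<delta>. 0 < \<delta> \<and> \<delta> * (1 + \<kappa> 1 * \<delta>) / (1 - \<kappa> 1 * \<delta>)\<^sup>2 = 1 / 3)"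

definition delta_star :: "real \<Rightarrow> (nat \<Rightarrow> real) \<Rightarrow> real" where
  "delta_star Cq \<kappa> = min (delta_zero Cq \<kappa>) (delta_bar_zero \<kappa>)"


section \<open>Lebesgue and Sobolev spaces on the unit interval\<close>

text \<open>Elements are representatives, i.e. functions on the real line whose values outside \<open>\<Omega>\<close> (and on
  null sets) are irrelevant. The functions \<open>L2_inner\<close> and \<open>L2_norm\<close> are meaningful on \<open>L2\<close> only.\<close>

definition L2 :: "(real \<Rightarrow> real) set" where
  "L2 = {u \<in> borel_measurable (lebesgue_on \<Omega>). integrable (lebesgue_on \<Omega>) (\<lambda>x. (u x)\<^sup>2)}"

definition L2_inner :: "(real \<Rightarrow> real) \<Rightarrow> (real \<Rightarrow> real) \<Rightarrow> real" where
  "L2_inner u v = (\<integral>x. u x * v x \<partial>lebesgue_on \<Omega>)"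

definition L2_norm :: "(real \<Rightarrow> real) \<Rightarrow> real" where
  "L2_norm u = sqrt (L2_inner u u)"

definition test_functions :: "(real \<Rightarrow> real) set" where
  "test_functions = {\<phi>. (\<forall>k. Ck_on k \<Omega> \<phi>) \<and>
     (\<exists>K. compact K \<and> K \<subseteq> \<Omega> \<and> (\<forall>x\<in>\<Omega> - K. \<phi> x = 0))}"

definition has_weak_deriv :: "nat \<Rightarrow> (real \<Rightarrow> real) \<Rightarrow> (real \<Rightarrow> real) \<Rightarrow> bool" where
  "has_weak_deriv j u g \<longleftrightarrow> u \<in> L2 \<and> g \<in> L2 \<and>
     (\<forall>\<phi>\<in>test_functions. L2_inner u (nderiv_on j \<Omega> \<phi>) = (-1) ^ j * L2_inner g \<phi>)"

definition Sobolev_H :: "nat \<Rightarrow> (real \<Rightarrow> real) set" where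
  "Sobolev_H k = {u \<in> L2. \<forall>j\<le>k. \<exists>g. has_weak_deriv j u g}"

text \<open>\<open>H\<^sub>0\<^sup>1(\<Omega>)\<close> is the closure of the test functions in \<open>H\<^sup>1(\<Omega>)\<close>; membership expresses the
  homogeneous Dirichlet boundary conditions.\<close>

definition Sobolev_H10 :: "(real \<Rightarrow> real) set" where
  "Sobolev_H10 = {u. \<exists>g \<phi>. has_weak_deriv 1 u g \<and> (\<forall>n::nat. \<phi> n \<in> test_functions) \<and>
     (\<lambda>n. L2_norm (\<lambda>x. \<phi> n x - u x)) \<longlonglongrightarrow> 0 \<and>
     (\<lambda>n. L2_norm (\<lambda>x. nderiv_on 1 \<Omega> (\<phi> n) x - g x)) \<longlonglongrightarrow> 0}"

text \<open>\<open>- u'' = f\<close> in \<open>\<Omega>\<close>, \<open>u(0) = u(1) = 0\<close>.\<close>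

definition dirichlet_solution :: "(real \<Rightarrow> real) \<Rightarrow> (real \<Rightarrow> real) \<Rightarrow> bool" where
  "dirichlet_solution f u \<longleftrightarrow> u \<in> Sobolev_H10 \<and> has_weak_deriv 2 u (\<lambda>x. - f x)"


section \<open>The nonlocal form and its finite element discretization\<close>

definition eta :: "(real \<Rightarrow> real) \<Rightarrow> (real \<Rightarrow> real) \<Rightarrow> real \<Rightarrow> real \<Rightarrow> real" where
  "eta q lam \<delta> x = \<delta> * q (lam x)"

definition weight :: "(real \<Rightarrow> real) \<Rightarrow> (real \<Rightarrow> real) \<Rightarrow> real \<Rightarrow> real \<Rightarrow> real \<Rightarrow> real" where
  "weight q lam \<beta> \<delta> x = (3 - \<beta>) / 2 * eta q lam \<delta> x powr (- (3 - \<beta>))"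

definition nonlocal_form ::
    "(real \<Rightarrow> real) \<Rightarrow> (real \<Rightarrow> real) \<Rightarrow> real \<Rightarrow> real \<Rightarrow> (real \<Rightarrow> real) \<Rightarrow> (real \<Rightarrow> real) \<Rightarrow> real" where
  "nonlocal_form q lam \<beta> \<delta> u v =
     (\<integral>x. (\<integral>y. weight q lam \<beta> \<delta> x * indicator {y. \<bar>y - x\<bar> < eta q lam \<delta> x} y *
             ((u x - u y) * (v x - v y) / \<bar>x - y\<bar> powr \<beta>) \<partial>lebesgue_on \<Omega>) \<partial>lebesgue_on \<Omega>)"

text \<open>The space \<open>V\<^sub>h\<close> for \<open>h = 1 / N\<close>; only values on \<open>[0,1]\<close> are constrained.\<close>

definition fe_space :: "nat \<Rightarrow> (real \<Rightarrow> real) set" where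
  "fe_space N = {v. continuous_on {0..1} v \<and> v 0 = 0 \<and> v 1 = 0 \<and>
     (\<forall>i\<in>{1..N}. \<exists>a b. \<forall>x\<in>{(real i - 1) * (1 / real N)<..real i * (1 / real N)}. v x = a + b * x)}"

definition galerkin_solution ::
    "(real \<Rightarrow> real) \<Rightarrow> (real \<Rightarrow> real) \<Rightarrow> real \<Rightarrow> (real \<Rightarrow> real) \<Rightarrow> real \<Rightarrow> nat \<Rightarrow> (real \<Rightarrow> real) \<Rightarrow> bool" where
  "galerkin_solution q lam \<beta> f \<delta> N u \<longleftrightarrow>
     u \<in> fe_space N \<and> (\<forall>v\<in>fe_space N. nonlocal_form q lam \<beta> \<delta> u v = L2_inner f v)"

end

theory Submission
  imports Defs "HOL-Computational_Algebra.Polynomial"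
begin

text \<open>
  The substitution \<open>y = x + t \<eta>(x)\<close> turns the nonlocal form into an average, over the probability
  measure \<open>(3 - \<beta>) / 2 * \<bar>t\<bar> powr (2 - \<beta>) dt\<close> on \<open>(-1, 1)\<close>, of the forms \<open>\<integral> R u * R v\<close> with
  \<open>R v x = (v (x + \<zeta> x) - v x) / \<zeta> x\<close> and \<open>\<zeta> = t \<eta>\<close>. Since \<open>\<zeta>\<close>, \<open>\<zeta>'\<close> and \<open>\<zeta>''\<close> are all \<open>O(\<delta>)\<close>, each slice
  satisfies a uniform Poincare inequality \<open>\<parallel>w\<parallel> \<le> C \<parallel>R w\<parallel>\<close>, and, moving derivatives from \<open>w\<close> to the
  solution, \<open>\<integral> u\<^sub>0' * R w + \<integral> u\<^sub>0'' * w\<close> is bounded by \<open>o(1) \<parallel>w\<parallel>\<close> without any inverse estimate. Hence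
  the consistency error is \<open>o(1)\<close> in the dual of the energy norm. The interpolation error of \<open>u\<^sub>0\<close> has
  Lipschitz constant \<open>O(h)\<close>, and \<open>R\<close> preserves Lipschitz bounds, so the interpolation error is \<open>O(h)\<close>
  in the energy norm irrespective of \<open>\<delta>\<close>. A Strang-type argument then gives a bound that tends to
  zero as \<open>\<delta>\<close> and \<open>h\<close> do, without coupling them.
\<close>

section \<open>Displacements of the unit interval\<close>

text \<open>The delicate bound is the one on the second derivative of \<zeta>. It contains q'(lam)
  lam'', and lam'' may blow up like the inverse distance to the boundary; q'(r) \<le> r together
  with lam \<le> \<open>\<kappa> 0\<close> times that distance cancels the singularity. The price of
  this degeneracy is that \<zeta> vanishes quadratically at both ends, so that 1/\<zeta> is not
  integrable and can only be multiplied by quantities that vanish there. The uniform Poincare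
  inequality is a shifted form of the multiplier identity "integral of (x w^2)' = 0". The multiplier
  x becomes x/\<zeta>, and the vanishing of the integral becomes its invariance under the shift,
  which is a bijection of the interval fixing both ends; hence no boundary terms arise. The
  consistency bound involves the modulus of continuity of f instead of a derivative. A continuous
  representative of f is extracted from the third weak derivative of the solution, so all later
  steps work with classical derivatives.\<close>

lemma abs_diff_le_off_finite:
  fixes f :: "real \<Rightarrow> real"
  assumes "finite S" "a \<le> b" "continuous_on {a..b} f"
    and der: "\<And>x. x \<in> {a<..<b} - S \<Longrightarrow> (f has_real_derivative f' x) (at x)"
    and bd: "\<And>x. x \<in> {a<..<b} - S \<Longrightarrow> \<bar>f' x\<bar> \<le> B"
    and "0 \<le> B"
  shows "\<bar>f b - f a\<bar> \<le> B * (b - a)"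
proof -
  \<comment> \<open>Resetting the derivative to 0 on the exceptional set makes the bound hold
    everywhere. The fundamental theorem for the gauge integral asks for no integrability of
    \<open>f'\<close>, so kinks of piecewise affine functions are harmless.\<close>
  define g where "g x = (if x \<in> {a<..<b} - S then f' x else 0)" for x
  have "(g has_integral (f b - f a)) {a..b}"
  proof (rule fundamental_theorem_of_calculus_interior_strong[OF \<open>finite S\<close> \<open>a \<le> b\<close> _ assms(3)])
    fix x assume "x \<in> {a<..<b} - S"
    then show "(f has_vector_derivative g x) (at x)"
      using der[of x] by (simp add: g_def has_real_derivative_iff_has_vector_derivative)
  qed
  then have "norm (f b - f a) \<le> B * Henstock_Kurzweil_Integration.content (cbox a b)"
    by (intro has_integral_bound[OF \<open>0 \<le> B\<close>, of g]) (use bd \<open>0 \<le> B\<close> in \<open>auto simp: g_def\<close>)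
  with \<open>a \<le> b\<close> show ?thesis by simp
qed

lemma lipschitz_on_unit_off_finite:
  fixes f :: "real \<Rightarrow> real"
  assumes "finite S" "continuous_on {0..1} f"
    and der: "\<And>x. x \<in> \<Omega> - S \<Longrightarrow> (f has_real_derivative f' x) (at x)"
    and bd: "\<And>x. x \<in> \<Omega> - S \<Longrightarrow> \<bar>f' x\<bar> \<le> B"
    and "0 \<le> B" and xy: "x \<in> {0..1}" "y \<in> {0..1}"
  shows "\<bar>f x - f y\<bar> \<le> B * \<bar>x - y\<bar>"
proof -
  have *: "\<bar>f b - f a\<bar> \<le> B * (b - a)" if "0 \<le> a" "a \<le> b" "b \<le> 1" for a b
    using that
    by (intro abs_diff_le_off_finite[OF assms(1), where f' = f'] continuous_on_subset[OF assms(2)])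
      (auto intro!: der bd assms)
  show ?thesis
  proof (cases "x \<le> y")
    case True
    then show ?thesis using *[of x y] xy by (auto simp: abs_minus_commute)
  next
    case False
    then show ?thesis using *[of y x] xy by auto
  qed
qed

lemma mvt_between:
  fixes f :: "real \<Rightarrow> real"
  assumes "x \<in> \<Omega>" "y \<in> \<Omega>" "x \<noteq> y" and d: "\<And>x. x \<in> \<Omega> \<Longrightarrow> (f has_real_derivative f' x) (at x)"
  obtains z where "z \<in> \<Omega>" "\<bar>z - x\<bar> \<le> \<bar>y - x\<bar>" "f y - f x = (y - x) * f' z"
proof (cases "x < y")
  case True
  then have "\<exists>z>x. z < y \<and> f y - f x = (y - x) * f' z"
    by (intro MVT2) (use assms in auto)
  then obtain z where "z > x" "z < y" "f y - f x = (y - x) * f' z" by blast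
  then show ?thesis using assms by (intro that[of z]) auto
next
  case False
  then have "\<exists>z>y. z < x \<and> f x - f y = (x - y) * f' z"
    by (intro MVT2) (use assms in auto)
  then obtain z where "z > y" "z < x" "f x - f y = (x - y) * f' z" by blast
  then show ?thesis using assms by (intro that[of z]) (auto simp: algebra_simps)
qed

section \<open>Integration over the open unit interval\<close>

lemma lmeasurable_Omega: "\<Omega> \<in> lmeasurable"
  using lmeasurable_box[of "0::real" 1] by (simp add: box_real)

interpretation Om: finite_measure "lebesgue_on \<Omega>"
  by (rule finite_measure_lebesgue_on[OF lmeasurable_Omega])

lemma sets_lebesgue_Omega [simp]: "\<Omega> \<in> sets lebesgue"
  using lmeasurable_Omega by blast

lemma integrable_Omega_continuous_bounded:
  fixes f :: "real \<Rightarrow> real"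
  assumes "continuous_on \<Omega> f" "\<And>x. x \<in> \<Omega> \<Longrightarrow> \<bar>f x\<bar> \<le> B"
  shows "integrable (lebesgue_on \<Omega>) f"
  by (rule Om.integrable_const_bound[where B = B])
    (use assms in \<open>auto simp: continuous_imp_measurable_on_sets_lebesgue\<close>)

lemma continuous_bounded_unit:
  fixes f :: "real \<Rightarrow> real"
  assumes "continuous_on {0..1} f"
  obtains B where "\<forall>x\<in>{0..1}. \<bar>f x\<bar> \<le> B"
proof -
  have "compact (f ` {0..1})" by (intro compact_continuous_image assms) auto
  then show ?thesis using that by (auto dest!: compact_imp_bounded simp: bounded_iff)
qed

lemma integrable_Omega_continuous:
  fixes f :: "real \<Rightarrow> real"
  assumes "continuous_on {0..1} f"
  shows "integrable (lebesgue_on \<Omega>) f"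
proof -
  obtain B where "\<forall>x\<in>{0..1}. \<bar>f x\<bar> \<le> B"
    using continuous_bounded_unit[OF assms] .
  then show ?thesis
    by (intro integrable_Omega_continuous_bounded[where B = B] continuous_on_subset[OF assms]) auto
qed

lemma integral_Omega_eq:
  fixes f :: "real \<Rightarrow> real"
  assumes "integrable (lebesgue_on \<Omega>) f"
  shows "(\<integral>x. f x \<partial>lebesgue_on \<Omega>) = integral {0..1} f"
  using lebesgue_integral_eq_integral[OF assms] integral_open_interval_real[of 0 1 f] by simp

lemma measure_Omega: "measure (lebesgue_on \<Omega>) \<Omega> = 1"
  by (simp add: measure_restrict_space)

lemma borel_measurable_lebesgue_on:
  "f \<in> borel_measurable borel \<Longrightarrow> f \<in> borel_measurable (lebesgue_on A)"
  by (intro measurable_restrict_space1 measurable_completion) simp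

lemma integrable_Omega_borel_bounded:
  fixes f :: "real \<Rightarrow> real"
  assumes "f \<in> borel_measurable borel" "\<And>x. x \<in> \<Omega> \<Longrightarrow> \<bar>f x\<bar> \<le> B"
  shows "integrable (lebesgue_on \<Omega>) f"
  by (rule Om.integrable_const_bound[where B = B]) (use assms in \<open>auto intro: borel_measurable_lebesgue_on\<close>)

lemma lipschitz_imp_continuous:
  fixes v :: "real \<Rightarrow> real"
  assumes "\<And>x y. x \<in> {0..1} \<Longrightarrow> y \<in> {0..1} \<Longrightarrow> \<bar>v x - v y\<bar> \<le> L * \<bar>x - y\<bar>"
  shows "continuous_on {0..1} v"
proof -
  have "0 \<le> L" using assms[of 0 1] by simp
  then have "L-lipschitz_on {0..1} v"
    using assms by (auto intro!: lipschitz_onI simp: dist_real_def)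
  then show ?thesis by (rule lipschitz_on_continuous_on)
qed

text \<open>The last assumption makes \<open>(w x)\<^sup>2 / \<zeta> x\<close> bounded for Lipschitz \<open>w\<close> vanishing at both ends; \<open>c\<close>
  does not enter any estimate. The sign of \<open>\<zeta>\<close> is not prescribed.\<close>

locale displacement =
  fixes \<zeta> \<zeta>1 \<zeta>2 :: "real \<Rightarrow> real" and \<epsilon> c :: real
  assumes cont: "continuous_on {0..1} \<zeta>"
    and ends: "\<zeta> 0 = 0" "\<zeta> 1 = 0"
    and deriv1: "\<And>x. x \<in> \<Omega> \<Longrightarrow> (\<zeta> has_real_derivative \<zeta>1 x) (at x)"
    and deriv2: "\<And>x. x \<in> \<Omega> \<Longrightarrow> (\<zeta>1 has_real_derivative \<zeta>2 x) (at x)"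
    and cont2: "continuous_on \<Omega> \<zeta>2"
    and small: "\<epsilon> \<le> 1 / 4"
    and bound0: "\<And>x. x \<in> \<Omega> \<Longrightarrow> \<bar>\<zeta> x\<bar> \<le> \<epsilon>"
    and bound1: "\<And>x. x \<in> \<Omega> \<Longrightarrow> \<bar>\<zeta>1 x\<bar> \<le> \<epsilon>"
    and bound2: "\<And>x. x \<in> \<Omega> \<Longrightarrow> \<bar>\<zeta>2 x\<bar> \<le> \<epsilon>"
    and c_pos: "0 < c"
    and lower: "\<And>x. x \<in> \<Omega> \<Longrightarrow> c * (x\<^sup>2 * (1 - x)\<^sup>2) \<le> \<bar>\<zeta> x\<bar>"
begin

lemma eps_nonneg: "0 \<le> \<epsilon>"
  using bound0[of "1/2"] by simp

lemma nonzero: "x \<in> \<Omega> \<Longrightarrow> \<zeta> x \<noteq> 0"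
  using lower[of x] mult_pos_pos[OF c_pos, of "x\<^sup>2 * (1 - x)\<^sup>2"] by force

lemma lipschitz: "x \<in> {0..1} \<Longrightarrow> y \<in> {0..1} \<Longrightarrow> \<bar>\<zeta> x - \<zeta> y\<bar> \<le> \<epsilon> * \<bar>x - y\<bar>"
  by (rule lipschitz_on_unit_off_finite[where S = "{}" and f' = \<zeta>1])
    (use cont deriv1 bound1 eps_nonneg in auto)

lemma cont1: "continuous_on \<Omega> \<zeta>1"
  using deriv2 by (meson DERIV_isCont continuous_at_imp_continuous_on)

text \<open>The parameter \<open>s\<close> joins the identity (\<open>s = 0\<close>) to the full
  displacement (\<open>s = 1\<close>); integrating along this path expresses a difference quotient
  through a derivative.\<close>

definition shift :: "real \<Rightarrow> real \<Rightarrow> real" where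
  "shift s x = x + s * \<zeta> x"

lemma shift_deriv: "x \<in> \<Omega> \<Longrightarrow> (shift s has_real_derivative 1 + s * \<zeta>1 x) (at x)"
  unfolding shift_def by (auto intro!: derivative_eq_intros deriv1)

lemma shift_cont: "continuous_on {0..1} (shift s)"
  unfolding shift_def by (intro continuous_intros cont)

lemma abs_mult_le: "\<bar>s\<bar> \<le> 1 \<Longrightarrow> \<bar>y\<bar> \<le> \<epsilon> \<Longrightarrow> \<bar>s * y\<bar> \<le> (\<epsilon>::real)"
  using mult_mono[of "\<bar>s\<bar>" 1 "\<bar>y\<bar>" \<epsilon>] by (simp add: abs_mult)

text \<open>The perturbation \<open>s * \<zeta>\<close> has Lipschitz constant at most 1/4, too
  small to reverse the order. As both ends are fixed, the shift is then a bijection of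
  \<Omega>.\<close>

lemma shift_strict_mono:
  assumes "\<bar>s\<bar> \<le> 1" "x \<in> {0..1}" "y \<in> {0..1}" "x < y"
  shows "shift s x < shift s y"
proof -
  have "\<bar>\<zeta> x - \<zeta> y\<bar> \<le> \<epsilon> * (y - x)"
    using lipschitz[of x y] assms by simp
  also have "\<dots> \<le> 1/4 * (y - x)" using small assms by (intro mult_right_mono) auto
  finally have "\<bar>s * (\<zeta> x - \<zeta> y)\<bar> \<le> 1/4 * (y - x)"
    using mult_mono[of "\<bar>s\<bar>" 1 "\<bar>\<zeta> x - \<zeta> y\<bar>" "1/4 * (y - x)"] assms by (simp add: abs_mult)
  then have "s * \<zeta> x - s * \<zeta> y \<le> 1/4 * (y - x)"
    unfolding right_diff_distrib by linarith
  moreover have "1/4 * (y - x) < y - x" using assms(4) by simp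
  ultimately show ?thesis unfolding shift_def by linarith
qed

lemma shift_in: assumes "\<bar>s\<bar> \<le> 1" "x \<in> \<Omega>" shows "shift s x \<in> \<Omega>"
  using shift_strict_mono[OF assms(1), of 0 x] shift_strict_mono[OF assms(1), of x 1] assms(2)
  by (simp add: shift_def ends)

lemma shift_in': assumes "\<bar>s\<bar> \<le> 1" "x \<in> {0..1}" shows "shift s x \<in> {0..1}"
proof (cases "x \<in> \<Omega>")
  case True then show ?thesis using shift_in[of s x] assms by auto
next
  case False
  then have "x = 0 \<or> x = 1" using assms by auto
  then show ?thesis by (auto simp: shift_def ends)
qed

lemma shift_image: assumes "\<bar>s\<bar> \<le> 1" shows "shift s ` \<Omega> = \<Omega>"
proof
  show "shift s ` \<Omega> \<subseteq> \<Omega>" using shift_in assms by blast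
  show "\<Omega> \<subseteq> shift s ` \<Omega>"
  proof
    fix y :: real assume y: "y \<in> \<Omega>"
    have "\<exists>x\<ge>0. x \<le> 1 \<and> shift s x = y"
      by (rule IVT') (use y shift_cont in \<open>auto simp: shift_def ends\<close>)
    then obtain x where x: "0 \<le> x" "x \<le> 1" "shift s x = y" by blast
    then have "x \<noteq> 0" "x \<noteq> 1" using y by (auto simp: shift_def ends)
    with x show "y \<in> shift s ` \<Omega>" by force
  qed
qed

lemma shift_inj: assumes "\<bar>s\<bar> \<le> 1" shows "inj_on (shift s) \<Omega>"
proof (rule inj_onI)
  fix x y assume "x \<in> \<Omega>" "y \<in> \<Omega>" "shift s x = shift s y"
  then show "x = y"
    using shift_strict_mono[OF assms, of x y] shift_strict_mono[OF assms, of y x]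
    by (cases x y rule: linorder_cases) auto
qed

lemma jacobian: assumes "\<bar>s\<bar> \<le> 1" "x \<in> \<Omega>" shows "\<bar>s * \<zeta>1 x\<bar> \<le> \<epsilon>" "3/4 \<le> 1 + s * \<zeta>1 x" "1 + s * \<zeta>1 x \<le> 5/4"
  using abs_mult_le[OF assms(1) bound1[OF assms(2)]] small by auto

lemma change_of_variables:
  fixes F :: "real \<Rightarrow> real"
  assumes s: "\<bar>s\<bar> \<le> 1" and F: "integrable (lebesgue_on \<Omega>) F"
  shows "integrable (lebesgue_on \<Omega>) (\<lambda>x. (1 + s * \<zeta>1 x) * F (shift s x))"
    and "(\<integral>x. (1 + s * \<zeta>1 x) * F (shift s x) \<partial>lebesgue_on \<Omega>) = (\<integral>x. F x \<partial>lebesgue_on \<Omega>)"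
proof -
  have F': "F absolutely_integrable_on \<Omega>"
    using F by (simp add: integrable_restrict_space set_integrable_def)
  have *: "(\<lambda>x. \<bar>1 + s * \<zeta>1 x\<bar> * F (shift s x)) absolutely_integrable_on \<Omega> \<and>
      integral \<Omega> (\<lambda>x. \<bar>1 + s * \<zeta>1 x\<bar> * F (shift s x)) = integral \<Omega> F"
    using has_absolute_integral_change_of_variables_1'[OF sets_lebesgue_Omega
        has_field_derivative_at_within[OF shift_deriv] shift_inj[OF s], of F "integral \<Omega> F"]
      F' shift_image[OF s] by simp
  then have int: "integrable (lebesgue_on \<Omega>) (\<lambda>x. \<bar>1 + s * \<zeta>1 x\<bar> * F (shift s x))"
    by (intro absolutely_integrable_imp_integrable) auto
  have eq: "\<bar>1 + s * \<zeta>1 x\<bar> = 1 + s * \<zeta>1 x" if "x \<in> \<Omega>" for x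
    using jacobian(2)[OF s that] by simp
  show i2: "integrable (lebesgue_on \<Omega>) (\<lambda>x. (1 + s * \<zeta>1 x) * F (shift s x))"
    using int by (rule Bochner_Integration.integrable_cong[THEN iffD1, rotated 2]) (auto simp: eq)
  have "(\<integral>x. (1 + s * \<zeta>1 x) * F (shift s x) \<partial>lebesgue_on \<Omega>)
      = (\<integral>x. \<bar>1 + s * \<zeta>1 x\<bar> * F (shift s x) \<partial>lebesgue_on \<Omega>)"
    by (rule Bochner_Integration.integral_cong) (auto simp: eq)
  also have "\<dots> = integral \<Omega> F"
    using lebesgue_integral_eq_integral[OF int] * by simp
  finally show "(\<integral>x. (1 + s * \<zeta>1 x) * F (shift s x) \<partial>lebesgue_on \<Omega>) = (\<integral>x. F x \<partial>lebesgue_on \<Omega>)"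
    using lebesgue_integral_eq_integral[OF F] by simp
qed

definition quot :: "(real \<Rightarrow> real) \<Rightarrow> real \<Rightarrow> real" where
  "quot v x = (v (shift 1 x) - v x) / \<zeta> x"

lemma quot_bound:
  assumes "\<And>x y. x \<in> {0..1} \<Longrightarrow> y \<in> {0..1} \<Longrightarrow> \<bar>v x - v y\<bar> \<le> L * \<bar>x - y\<bar>" "x \<in> \<Omega>"
  shows "\<bar>quot v x\<bar> \<le> L"
proof -
  have "\<bar>v (shift 1 x) - v x\<bar> \<le> L * \<bar>shift 1 x - x\<bar>"
    using assms shift_in[of 1 x] by (intro assms(1)) auto
  then show ?thesis
    using nonzero[OF assms(2)] by (simp add: quot_def shift_def field_simps)
qed

lemma continuous_shift:
  assumes "continuous_on {0..1} v" "\<bar>s\<bar> \<le> 1"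
  shows "continuous_on {0..1} (\<lambda>x. v (shift s x))"
  by (rule continuous_on_compose2[OF assms(1) shift_cont]) (use shift_in' assms in auto)

lemma quot_continuous:
  assumes "continuous_on {0..1} v"
  shows "continuous_on \<Omega> (quot v)"
proof -
  have "continuous_on {0..1} (\<lambda>x. v (shift 1 x) - v x)"
    by (intro continuous_intros continuous_shift assms) auto
  then have "continuous_on \<Omega> (\<lambda>x. v (shift 1 x) - v x)"
    by (rule continuous_on_subset) auto
  moreover have "continuous_on \<Omega> \<zeta>" using cont by (rule continuous_on_subset) auto
  ultimately show ?thesis unfolding quot_def by (intro continuous_on_divide) (use nonzero in auto)
qed

text \<open>The factor 4/3 is the reciprocal of the lower bound 3/4 of the Jacobian.\<close>

lemma integral_shift_le:
  fixes w :: "real \<Rightarrow> real"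
  assumes "\<bar>s\<bar> \<le> 1" "continuous_on {0..1} w" "\<And>x. x \<in> {0..1} \<Longrightarrow> 0 \<le> w x"
  shows "(\<integral>x. w (shift s x) \<partial>lebesgue_on \<Omega>) \<le> 4/3 * (\<integral>x. w x \<partial>lebesgue_on \<Omega>)"
proof -
  note cv = change_of_variables[OF assms(1) integrable_Omega_continuous[OF assms(2)]]
  have "(\<integral>x. w (shift s x) \<partial>lebesgue_on \<Omega>) \<le> (\<integral>x. 4/3 * ((1 + s * \<zeta>1 x) * w (shift s x)) \<partial>lebesgue_on \<Omega>)"
  proof (rule integral_mono[OF integrable_Omega_continuous[OF continuous_shift[OF assms(2,1)]]])
    show "integrable (lebesgue_on \<Omega>) (\<lambda>x. 4/3 * ((1 + s * \<zeta>1 x) * w (shift s x)))"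
      by (intro integrable_mult_right cv)
    fix x assume "x \<in> space (lebesgue_on \<Omega>)"
    then have x: "x \<in> \<Omega>" by simp
    have "1 * w (shift s x) \<le> (4/3 * (1 + s * \<zeta>1 x)) * w (shift s x)"
      using jacobian[OF assms(1) x] shift_in[OF assms(1) x] by (intro mult_right_mono assms) auto
    then show "w (shift s x) \<le> 4/3 * ((1 + s * \<zeta>1 x) * w (shift s x))"
      by (simp only: mult.assoc mult_1_left)
  qed
  then show ?thesis using cv(2) by simp
qed

text \<open>The weight \<open>x / \<zeta> x\<close> grows along the orbits of the shift, up to its Jacobian, at a rate
  that is bounded below independently of \<open>\<zeta>\<close>.\<close>

lemma jacobian_ratio:
  assumes x: "x \<in> \<Omega>"
  shows "\<bar>(1 + \<zeta>1 x) / \<zeta> (shift 1 x) - 1 / \<zeta> x\<bar> \<le> 4/3 * \<epsilon>"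
proof -
  let ?y = "shift 1 x"
  have y: "?y \<in> \<Omega>" using shift_in[of 1 x] x by simp
  have ne: "?y \<noteq> x" using nonzero[OF x] by (simp add: shift_def)
  obtain z where "z \<in> \<Omega>" "\<bar>z - x\<bar> \<le> \<bar>?y - x\<bar>" "\<zeta> ?y - \<zeta> x = (?y - x) * \<zeta>1 z"
    using mvt_between[OF x y ne[symmetric] deriv1] .
  then have z: "z \<in> \<Omega>" "\<bar>z - x\<bar> \<le> \<bar>\<zeta> x\<bar>" "\<zeta> ?y = \<zeta> x * (1 + \<zeta>1 z)"
    by (auto simp: shift_def algebra_simps)
  have pos: "3/4 \<le> 1 + \<zeta>1 z" using bound1[OF z(1)] small by auto
  have "\<bar>\<zeta>1 x - \<zeta>1 z\<bar> \<le> \<epsilon> * \<bar>x - z\<bar>"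
  proof -
    have "norm (\<zeta>1 x - \<zeta>1 z) \<le> \<epsilon> * norm (x - z)"
      by (rule field_differentiable_bound[where S = \<Omega> and f' = \<zeta>2])
        (use deriv2 bound2 x z in \<open>auto intro: has_field_derivative_at_within\<close>)
    then show ?thesis by simp
  qed
  also have "\<dots> \<le> \<epsilon> * \<bar>\<zeta> x\<bar>" using z eps_nonneg by (intro mult_left_mono) auto
  finally have d: "\<bar>\<zeta>1 x - \<zeta>1 z\<bar> \<le> \<epsilon> * \<bar>\<zeta> x\<bar>" .
  \<comment> \<open>By the mean value theorem \<zeta>(y) = \<zeta>(x) (1 +
    \<open>\<zeta>1 z\<close>), so the two singular terms differ by a quotient whose numerator is at
    most \<epsilon> |\<zeta>(x)| by the bound on the second derivative. The factor \<zeta>(x) in the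
    denominator cancels.\<close>
  have "(1 + \<zeta>1 x) / \<zeta> ?y - 1 / \<zeta> x = (\<zeta>1 x - \<zeta>1 z) / (\<zeta> x * (1 + \<zeta>1 z))"
  proof -
    have e: "1 / \<zeta> x = (1 + \<zeta>1 z) / (\<zeta> x * (1 + \<zeta>1 z))" using pos by auto
    show ?thesis unfolding z(3)
      by (subst e) (simp only: diff_divide_distrib[symmetric], simp)
  qed
  then have "\<bar>(1 + \<zeta>1 x) / \<zeta> ?y - 1 / \<zeta> x\<bar> = \<bar>\<zeta>1 x - \<zeta>1 z\<bar> / (\<bar>\<zeta> x\<bar> * (1 + \<zeta>1 z))"
    using pos by (simp add: abs_mult)
  also have "\<dots> \<le> (\<epsilon> * \<bar>\<zeta> x\<bar>) / (\<bar>\<zeta> x\<bar> * (3/4))"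
    using d pos nonzero[OF x] eps_nonneg by (intro frac_le mult_left_mono) auto
  also have "\<dots> = 4/3 * \<epsilon>" using nonzero[OF x] by simp
  finally show ?thesis .
qed

text \<open>For \<open>F = x / \<zeta> * w\<^sup>2\<close> the integral of
  \<open>(1 + \<zeta>1 x) * F (shift 1 x) - F x\<close> is zero by the change of variables.
  Pointwise this difference contains \<open>(w x)\<^sup>2\<close> with a coefficient of at least
  2/3, plus a term controlled by \<open>quot w x\<close>. The Lipschitz constant serves
  integrability and does not reach the conclusion.\<close>

lemma poincare:
  assumes lip: "\<And>x y. x \<in> {0..1} \<Longrightarrow> y \<in> {0..1} \<Longrightarrow> \<bar>w x - w y\<bar> \<le> L * \<bar>x - y\<bar>"
    and w0: "w 0 = 0" "w 1 = 0"
  shows "(\<integral>x. (w x)\<^sup>2 \<partial>lebesgue_on \<Omega>) \<le> 42 * (\<integral>x. (quot w x)\<^sup>2 \<partial>lebesgue_on \<Omega>)"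
proof -
  have cw: "continuous_on {0..1} w" using lip by (rule lipschitz_imp_continuous)
  have L: "0 \<le> L" using lip[of 0 1] by simp
  define F where "F x = x / \<zeta> x * (w x)\<^sup>2" for x
  have F: "integrable (lebesgue_on \<Omega>) F"
  proof (rule integrable_Omega_continuous_bounded[where B = "4 * L\<^sup>2 / c"])
    show "continuous_on \<Omega> F" unfolding F_def
      by (intro continuous_intros continuous_on_subset[OF cont] continuous_on_subset[OF cw])
        (use nonzero in auto)
    fix x assume x: "x \<in> \<Omega>"
    have "\<bar>w x\<bar> \<le> L * x" "\<bar>w x\<bar> \<le> L * (1 - x)"
      using lip[of x 0] lip[of x 1] x w0 by auto
    then have "\<bar>w x\<bar> \<le> L * min x (1 - x)" by (simp add: min_def)
    \<comment> \<open>The product x (1 - x) is the smaller times the larger factor, and the larger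
      one is at least 1/2.\<close>
    also have "\<dots> \<le> L * (2 * (x * (1 - x)))"
    proof (intro mult_left_mono L)
      have "min x (1 - x) = min x (1 - x) * 1" by simp
      also have "\<dots> \<le> min x (1 - x) * (2 * max x (1 - x))" using x by (intro mult_left_mono) (auto simp: max_def)
      finally show "min x (1 - x) \<le> 2 * (x * (1 - x))" by (auto simp: min_def max_def algebra_simps split: if_splits)
    qed
    finally have "\<bar>w x\<bar>\<^sup>2 \<le> (L * (2 * (x * (1 - x))))\<^sup>2" by (intro power_mono) auto
    then have "(w x)\<^sup>2 \<le> 4 * L\<^sup>2 / c * (c * (x\<^sup>2 * (1 - x)\<^sup>2))"
      using c_pos by (simp add: power_mult_distrib)
    also have "\<dots> \<le> 4 * L\<^sup>2 / c * \<bar>\<zeta> x\<bar>" using lower[OF x] c_pos by (intro mult_left_mono) auto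
    finally have *: "(w x)\<^sup>2 / \<bar>\<zeta> x\<bar> \<le> 4 * L\<^sup>2 / c" using nonzero[OF x] by (simp add: pos_divide_le_eq)
    have "\<bar>F x\<bar> = x * ((w x)\<^sup>2 / \<bar>\<zeta> x\<bar>)" using x by (simp add: F_def abs_mult)
    also have "\<dots> \<le> 1 * (4 * L\<^sup>2 / c)" using x * by (intro mult_mono) auto
    finally show "\<bar>F x\<bar> \<le> 4 * L\<^sup>2 / c" by simp
  qed
  note cv = change_of_variables[of 1, OF _ F, simplified]
  have iw: "integrable (lebesgue_on \<Omega>) (\<lambda>x. (w x)\<^sup>2)"
    by (intro integrable_Omega_continuous continuous_intros cw)
  have iws: "integrable (lebesgue_on \<Omega>) (\<lambda>x. (w (shift 1 x))\<^sup>2)"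
    by (intro integrable_Omega_continuous continuous_intros continuous_shift cw) auto
  have iq: "integrable (lebesgue_on \<Omega>) (\<lambda>x. (quot w x)\<^sup>2)"
  proof (rule integrable_Omega_continuous_bounded[where B = "L\<^sup>2"])
    show "continuous_on \<Omega> (\<lambda>x. (quot w x)\<^sup>2)" by (intro continuous_intros quot_continuous cw)
    show "\<bar>(quot w x)\<^sup>2\<bar> \<le> L\<^sup>2" if "x \<in> \<Omega>" for x
      using power_mono[OF quot_bound[OF lip that], of 2] by simp
  qed
  \<comment> \<open>The 2/3 is 1 minus the error 4/3 \<epsilon> \<le> 1/3 of
    \<open>jacobian_ratio\<close>. The Young weights 14 and 1/7 are chosen for the end: the shifted
    square costs a factor 4/3, so 1/7 (4/3 + 1) = 1/3 is absorbed into 2/3, leaving 1/3 against 14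
    and hence the constant 42.\<close>
  have pw: "2/3 * (w x)\<^sup>2 - (14 * (quot w x)\<^sup>2 + 1/7 * ((w (shift 1 x))\<^sup>2 + (w x)\<^sup>2))
      \<le> (1 + \<zeta>1 x) * F (shift 1 x) - F x" if x: "x \<in> \<Omega>" for x
  proof -
    define r where "r = (1 + \<zeta>1 x) / \<zeta> (shift 1 x)"
    define y where "y = shift 1 x"
    have y: "y \<in> \<Omega>" "y = x + \<zeta> x" using shift_in[of 1 x] x by (auto simp: y_def shift_def)
    have e: "\<bar>r - 1 / \<zeta> x\<bar> \<le> 1/3" using jacobian_ratio[OF x] small by (simp add: r_def)
    have nz: "\<zeta> x \<noteq> 0" and z: "\<bar>\<zeta> x\<bar> \<le> 1/4" using nonzero[OF x] bound0[OF x] small by auto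
    have "\<bar>y * (r - 1 / \<zeta> x)\<bar> \<le> 1 * (1/3)" unfolding abs_mult using y e by (intro mult_mono) auto
    then have "2/3 \<le> 1 + y * (r - 1 / \<zeta> x)" by linarith
    \<comment> \<open>The 1 is y/\<zeta>(x) - x/\<zeta>(x), because y - x = \<zeta>(x).\<close>
    also have "\<dots> = y * r - x / \<zeta> x" using y nz by (simp add: field_simps)
    finally have g: "2/3 \<le> y * r - x / \<zeta> x" .
    have "\<bar>r\<bar> \<le> \<bar>1 / \<zeta> x\<bar> + 1/3" using e by linarith
    also have "\<dots> \<le> 2 / \<bar>\<zeta> x\<bar>"
    proof -
      have "1/3 \<le> 1 / \<bar>\<zeta> x\<bar>" using nz z by (subst pos_le_divide_eq) auto
      then show ?thesis by simp
    qed
    finally have "\<bar>y\<bar> * \<bar>r\<bar> \<le> 1 * (2 / \<bar>\<zeta> x\<bar>)" using y by (intro mult_mono) auto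
    then have yr: "\<bar>y * r\<bar> \<le> 2 / \<bar>\<zeta> x\<bar>" by (simp add: abs_mult)
    have q: "w y - w x = \<zeta> x * quot w x" using nz by (simp add: quot_def y_def)
    have "\<bar>y * r * ((w y)\<^sup>2 - (w x)\<^sup>2)\<bar> = \<bar>y * r\<bar> * (\<bar>\<zeta> x\<bar> * (\<bar>quot w x\<bar> * \<bar>w y + w x\<bar>))"
      using q by (simp add: power2_eq_square square_diff_square_factored abs_mult)
    also have "\<dots> \<le> 2 / \<bar>\<zeta> x\<bar> * (\<bar>\<zeta> x\<bar> * (\<bar>quot w x\<bar> * \<bar>w y + w x\<bar>))"
      using yr by (intro mult_right_mono) auto
    also have "\<dots> = 2 * \<bar>quot w x\<bar> * \<bar>w y + w x\<bar>" using nz by simp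
    also have "\<dots> \<le> 14 * (quot w x)\<^sup>2 + 1/14 * (w y + w x)\<^sup>2"
      using zero_le_power2[of "14 * \<bar>quot w x\<bar> - \<bar>w y + w x\<bar>"]
      by (simp add: power2_diff power_mult_distrib)
    also have "\<dots> \<le> 14 * (quot w x)\<^sup>2 + 1/7 * ((w y)\<^sup>2 + (w x)\<^sup>2)"
      using sum_squares_bound[of "w y" "w x"] by (simp add: power2_sum)
    finally have h: "- (14 * (quot w x)\<^sup>2 + 1/7 * ((w y)\<^sup>2 + (w x)\<^sup>2)) \<le> y * r * ((w y)\<^sup>2 - (w x)\<^sup>2)"
      by linarith
    have "2/3 * (w x)\<^sup>2 \<le> (y * r - x / \<zeta> x) * (w x)\<^sup>2" using g by (intro mult_right_mono) auto
    moreover have "(1 + \<zeta>1 x) * F (shift 1 x) - F x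
       = (y * r - x / \<zeta> x) * (w x)\<^sup>2 + y * r * ((w y)\<^sup>2 - (w x)\<^sup>2)"
    proof -
      have "(1 + \<zeta>1 x) * F (shift 1 x) = y * r * (w y)\<^sup>2" by (simp add: F_def r_def y_def)
      then show ?thesis by (simp only: F_def[of x]) (simp add: algebra_simps)
    qed
    ultimately show ?thesis using h unfolding y_def by linarith
  qed
  have "(\<integral>x. 2/3 * (w x)\<^sup>2 - (14 * (quot w x)\<^sup>2 + 1/7 * ((w (shift 1 x))\<^sup>2 + (w x)\<^sup>2)) \<partial>lebesgue_on \<Omega>)
      \<le> (\<integral>x. (1 + \<zeta>1 x) * F (shift 1 x) - F x \<partial>lebesgue_on \<Omega>)"
    by (rule integral_mono) (use pw iw iws iq cv F in \<open>auto\<close>)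
  also have "\<dots> = 0" using cv F by simp
  finally have "2/3 * (\<integral>x. (w x)\<^sup>2 \<partial>lebesgue_on \<Omega>) \<le> 14 * (\<integral>x. (quot w x)\<^sup>2 \<partial>lebesgue_on \<Omega>)
     + 1/7 * ((\<integral>x. (w (shift 1 x))\<^sup>2 \<partial>lebesgue_on \<Omega>) + (\<integral>x. (w x)\<^sup>2 \<partial>lebesgue_on \<Omega>))"
    using iw iws iq by simp
  moreover have "(\<integral>x. (w (shift 1 x))\<^sup>2 \<partial>lebesgue_on \<Omega>) \<le> 4/3 * (\<integral>x. (w x)\<^sup>2 \<partial>lebesgue_on \<Omega>)"
    by (rule integral_shift_le) (auto intro!: continuous_intros cw)
  moreover have "a \<le> 42 * q" if "2/3 * a \<le> 14 * q + 1/7 * (b + a)" "b \<le> 4/3 * a" for a b q :: real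
    using that by argo
  ultimately show ?thesis by blast
qed

text \<open>For fixed \<open>x\<close> the path \<open>s \<mapsto> shift s x\<close> is affine with
  speed \<zeta>(x) \<noteq> 0. It therefore meets the kinks of \<open>w\<close> for finitely many
  \<open>s\<close> only, and the factor \<zeta>(x) from the chain rule cancels the denominator of
  the quotient.\<close>

lemma quot_eq_integral:
  assumes w: "continuous_on {0..1} w" and S: "finite S"
    and der: "\<And>x. x \<in> \<Omega> - S \<Longrightarrow> (w has_real_derivative w' x) (at x)"
    and w'[measurable]: "w' \<in> borel_measurable borel" and bd: "\<And>x. \<bar>w' x\<bar> \<le> L" and x: "x \<in> \<Omega>"
  shows "quot w x = (\<integral>s. w' (shift s x) \<partial>lebesgue_on \<Omega>)"
proof -
  have "finite ((\<lambda>y. (y - x) / \<zeta> x) ` S)" using S by simp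
  then have "((\<lambda>s. w' (shift s x) * \<zeta> x) has_integral (w (shift 1 x) - w (shift 0 x))) {0..1}"
  proof (rule fundamental_theorem_of_calculus_interior_strong)
    fix s assume s: "s \<in> {0<..<1} - (\<lambda>y. (y - x) / \<zeta> x) ` S"
    then have "shift s x \<notin> S" using nonzero[OF x] by (force simp: shift_def)
    then have "(w has_real_derivative w' (shift s x)) (at (shift s x))"
      using shift_in[of s x] s x by (intro der) auto
    moreover have "((\<lambda>s. shift s x) has_real_derivative \<zeta> x) (at s)"
      unfolding shift_def by (auto intro!: derivative_eq_intros)
    ultimately have "((\<lambda>s. w (shift s x)) has_real_derivative w' (shift s x) * \<zeta> x) (at s)"
      by (rule DERIV_chain2)
    then show "((\<lambda>s. w (shift s x)) has_vector_derivative w' (shift s x) * \<zeta> x) (at s)"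
      by (simp add: has_real_derivative_iff_has_vector_derivative)
  next
    show "continuous_on {0..1} (\<lambda>s. w (shift s x))"
    proof (rule continuous_on_compose2[OF w])
      show "continuous_on {0..1} (\<lambda>s. shift s x)" unfolding shift_def by (intro continuous_intros)
      show "(\<lambda>s. shift s x) ` {0..1} \<subseteq> {0..1}" using shift_in'[of _ x] x by auto
    qed
  qed auto
  moreover have i: "integrable (lebesgue_on \<Omega>) (\<lambda>s. w' (shift s x))"
    by (rule integrable_Omega_borel_bounded[where B = L]) (auto simp: shift_def bd)
  ultimately have "(\<integral>s. w' (shift s x) * \<zeta> x \<partial>lebesgue_on \<Omega>) = w (shift 1 x) - w (shift 0 x)"
    using integral_Omega_eq[OF integrable_mult_left[OF i]] by (metis integral_unique)
  then show ?thesis using nonzero[OF x] by (simp add: quot_def shift_def field_simps)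
qed

text \<open>Integration by parts for \<open>g / T'\<close> against \<open>x \<mapsto> w (T x)\<close>, with \<open>T = shift s\<close>, moves the derivative
  off \<open>w\<close>; substituting \<open>T\<close> in the other integral leaves a multiple of \<open>w (T x)\<close> under one integral.\<close>

lemma consistency_slice:
  assumes w: "continuous_on {0..1} w" "w 0 = 0" "w 1 = 0" and S: "finite S"
    and der: "\<And>x. x \<in> \<Omega> - S \<Longrightarrow> (w has_real_derivative w' x) (at x)"
    and w'[measurable]: "w' \<in> borel_measurable borel" and bd: "\<And>x. \<bar>w' x\<bar> \<le> L"
    and g: "\<And>x. x \<in> \<Omega> \<Longrightarrow> (g has_real_derivative g' x) (at x)" "continuous_on {0..1} g'"
    and M: "\<And>x. x \<in> \<Omega> \<Longrightarrow> \<bar>g x\<bar> \<le> M" "\<And>x. x \<in> \<Omega> \<Longrightarrow> \<bar>g' x\<bar> \<le> M"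
    and osc: "\<And>x y. x \<in> \<Omega> \<Longrightarrow> y \<in> \<Omega> \<Longrightarrow> \<bar>x - y\<bar> \<le> \<epsilon> \<Longrightarrow> \<bar>g' x - g' y\<bar> \<le> \<omega>"
    and s: "s \<in> \<Omega>"
  shows "\<bar>(\<integral>x. g x * w' (shift s x) \<partial>lebesgue_on \<Omega>) + (\<integral>x. g' x * w x \<partial>lebesgue_on \<Omega>)\<bar>
    \<le> (2 * \<omega> + 7 * M * \<epsilon>) * (\<integral>x. \<bar>w x\<bar> \<partial>lebesgue_on \<Omega>)"
proof -
  have s1: "\<bar>s\<bar> \<le> 1" using s by auto
  have M0: "0 \<le> M" using M(1)[of "1/2"] by simp
  define J where "J x = 1 + s * \<zeta>1 x" for x
  have J: "3/4 \<le> J x" "J x \<le> 5/4" "\<bar>J x - 1\<bar> \<le> \<epsilon>" if "x \<in> \<Omega>" for x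
    using jacobian[OF s1 that] by (auto simp: J_def)
  have J': "(J has_real_derivative s * \<zeta>2 x) (at x)" if "x \<in> \<Omega>" for x
    unfolding J_def using that by (auto intro!: derivative_eq_intros deriv2)
  have cJ: "continuous_on \<Omega> J" unfolding J_def by (intro continuous_intros cont1)
  have cg: "continuous_on \<Omega> g" using g(1) by (meson DERIV_isCont continuous_at_imp_continuous_on)
  have cg': "continuous_on \<Omega> g'" using g(2) by (rule continuous_on_subset) auto
  have cws: "continuous_on {0..1} (\<lambda>x. w (shift s x))" by (intro continuous_shift w s1)
  have cws': "continuous_on \<Omega> (\<lambda>x. w (shift s x))" using cws by (rule continuous_on_subset) auto
  obtain W where W': "\<forall>x\<in>{0..1}. \<bar>w x\<bar> \<le> W"
    using continuous_bounded_unit[OF w(1)] .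
  then have W: "\<bar>w x\<bar> \<le> W" if "x \<in> {0..1}" for x using that by blast
  have W0: "0 \<le> W" using W[of 0] by simp
  \<comment> \<open>Neither \<open>g\<close> nor \<open>J\<close> is controlled at the end points,
    so the product is set to 0 there. It stays continuous since it is dominated by a multiple of
    |w(shift s x)|, which tends to w(0) = 0 or w(1) = 0. In its derivative \<open>A + B\<close> the
    factor \<open>J\<close> of the chain rule cancels the division by \<open>J\<close>.\<close>
  define P where "P x = (if x \<in> \<Omega> then g x / J x * w (shift s x) else 0)" for x
  define A where "A x = (g' x / J x - g x * (s * \<zeta>2 x) / (J x)\<^sup>2) * w (shift s x)" for x
  define B where "B x = g x * w' (shift s x)" for x
  have P_le: "\<bar>P x\<bar> \<le> 4/3 * M * \<bar>w (shift s x)\<bar>" for x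
  proof (cases "x \<in> \<Omega>")
    case True
    have "\<bar>g x / J x\<bar> \<le> M / (3/4)" unfolding abs_divide using J[OF True] M(1)[OF True] M0
      by (intro frac_le) auto
    then have "\<bar>g x / J x\<bar> * \<bar>w (shift s x)\<bar> \<le> 4/3 * M * \<bar>w (shift s x)\<bar>"
      by (intro mult_right_mono) auto
    then show ?thesis unfolding P_def using True by (simp only: abs_mult if_True)
  next
    case False then show ?thesis using M0 by (auto simp: P_def)
  qed
  have cP: "continuous_on {0..1} P"
    unfolding continuous_on_eq_continuous_within
  proof
    fix x :: real assume x: "x \<in> {0..1}"
    show "continuous (at x within {0..1}) P"
    proof (cases "x \<in> \<Omega>")
      case True
      have "continuous_on \<Omega> (\<lambda>x. g x / J x * w (shift s x))"
        by (intro continuous_intros cg cJ cws') (use J in fastforce)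
      then have "continuous_on \<Omega> P" by (rule continuous_on_eq) (simp add: P_def)
      then have "isCont P x" using True by (simp add: continuous_on_eq_continuous_at)
      then show ?thesis by (rule continuous_at_imp_continuous_at_within)
    next
      case False
      then have x01: "x = 0 \<or> x = 1" using x by auto
      have "((\<lambda>y. w (shift s y)) \<longlongrightarrow> w (shift s x)) (at x within {0..1})"
        using cws x by (simp add: continuous_on)
      then have "((\<lambda>y. 4/3 * M * \<bar>w (shift s y)\<bar>) \<longlongrightarrow> 4/3 * M * \<bar>w (shift s x)\<bar>) (at x within {0..1})"
        by (intro tendsto_intros)
      then have "((\<lambda>y. 4/3 * M * \<bar>w (shift s y)\<bar>) \<longlongrightarrow> 0) (at x within {0..1})"
        using x01 w by (auto simp: shift_def ends)
      then have "(P \<longlongrightarrow> 0) (at x within {0..1})"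
        by (rule Lim_null_comparison[rotated]) (use P_le in auto)
      moreover have "P x = 0" using False unfolding P_def by (rule if_not_P)
      ultimately show ?thesis by (simp add: continuous_within)
    qed
  qed
  have "finite (shift s -` S \<inter> \<Omega>)" by (rule finite_vimage_IntI[OF S shift_inj[OF s1]])
  then have "((\<lambda>x. A x + B x) has_integral (P 1 - P 0)) {0..1}"
  proof (rule fundamental_theorem_of_calculus_interior_strong[OF _ _ _ cP])
    fix x assume "x \<in> {0<..<1} - (shift s -` S \<inter> \<Omega>)"
    then have x: "x \<in> \<Omega>" "shift s x \<notin> S" by auto
    have "(w has_real_derivative w' (shift s x)) (at (shift s x))"
      using x shift_in[OF s1] by (intro der) auto
    from DERIV_chain2[OF this shift_deriv[OF x(1)]]
    have 1: "((\<lambda>x. w (shift s x)) has_real_derivative w' (shift s x) * J x) (at x)"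
      by (simp add: J_def)
    have "J x \<noteq> 0" using J(1)[OF x(1)] by auto
    from DERIV_mult[OF DERIV_divide[OF g(1)[OF x(1)] J'[OF x(1)] this] 1]
    have "((\<lambda>x. g x / J x * w (shift s x)) has_real_derivative A x + B x) (at x)"
      by (rule DERIV_cong) (use \<open>J x \<noteq> 0\<close> in \<open>simp add: A_def B_def divide_simps power2_eq_square algebra_simps\<close>)
    then have "(P has_real_derivative A x + B x) (at x)"
      by (rule has_field_derivative_transform_within_open[where S = \<Omega>]) (use x in \<open>auto simp: P_def\<close>)
    then show "(P has_vector_derivative A x + B x) (at x)"
      by (simp add: has_real_derivative_iff_has_vector_derivative)
  qed auto
  then have hi: "((\<lambda>x. A x + B x) has_integral 0) {0..1}" by (simp add: P_def)
  have coef: "\<bar>g x * (s * \<zeta>2 x) / (J x)\<^sup>2\<bar> \<le> 2 * M * \<epsilon>" if x: "x \<in> \<Omega>" for x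
  proof -
    have "\<bar>g x * (s * \<zeta>2 x)\<bar> \<le> M * \<epsilon>" unfolding abs_mult[of "g x"]
      using M(1)[OF x] abs_mult_le[OF s1 bound2[OF x]] M0 by (intro mult_mono) auto
    moreover have "(3/4)\<^sup>2 \<le> (J x)\<^sup>2" using J[OF x] by (intro power_mono) auto
    then have "9/16 \<le> (J x)\<^sup>2" by (simp add: power2_eq_square)
    ultimately have "\<bar>g x * (s * \<zeta>2 x)\<bar> / (J x)\<^sup>2 \<le> M * \<epsilon> / (9/16)"
      by (intro frac_le) auto
    also have "\<dots> \<le> 2 * M * \<epsilon>" using mult_nonneg_nonneg[OF M0 eps_nonneg] by simp
    finally show ?thesis by (simp add: abs_divide)
  qed
  have g'J: "\<bar>g' x / J x\<bar> \<le> 4/3 * M" if x: "x \<in> \<Omega>" for x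
  proof -
    have "\<bar>g' x / J x\<bar> \<le> M / (3/4)" unfolding abs_divide using J[OF x] M(2)[OF x] M0
      by (intro frac_le) auto
    then show ?thesis by simp
  qed
  have iA: "integrable (lebesgue_on \<Omega>) A"
  proof (rule integrable_Omega_continuous_bounded[where B = "(4/3 * M + 2 * M * \<epsilon>) * W"])
    show "continuous_on \<Omega> A" unfolding A_def
      by (intro continuous_intros cg' cJ cg cont2 cws') (use J in fastforce)+
    show "\<bar>A x\<bar> \<le> (4/3 * M + 2 * M * \<epsilon>) * W" if x: "x \<in> \<Omega>" for x
    proof -
      have "\<bar>g' x / J x - g x * (s * \<zeta>2 x) / (J x)\<^sup>2\<bar> \<le> 4/3 * M + 2 * M * \<epsilon>"
        using coef[OF x] g'J[OF x] by linarith
      then show ?thesis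
        unfolding A_def abs_mult[of _ "w (shift s x)"]
        using W[of "shift s x"] shift_in[OF s1 x] M0 eps_nonneg by (intro mult_mono) auto
    qed
  qed
  have mB: "B \<in> borel_measurable (lebesgue_on \<Omega>)"
  proof -
    have "g \<in> borel_measurable (lebesgue_on \<Omega>)"
      by (intro continuous_imp_measurable_on_sets_lebesgue cg) simp
    moreover have "shift s \<in> borel_measurable (lebesgue_on \<Omega>)"
      by (intro continuous_imp_measurable_on_sets_lebesgue continuous_on_subset[OF shift_cont]) auto
    ultimately show ?thesis unfolding B_def
      by (intro borel_measurable_times measurable_compose[OF _ w'])
  qed
  have iB: "integrable (lebesgue_on \<Omega>) B"
  proof (rule Om.integrable_const_bound[where B = "M * L"])
    show "AE x in lebesgue_on \<Omega>. norm (B x) \<le> M * L"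
      using M(1) bd M0 by (intro AE_I2) (auto simp: B_def abs_mult intro!: mult_mono)
  qed (rule mB)
  have ig: "integrable (lebesgue_on \<Omega>) (\<lambda>x. g' x * w x)"
    by (intro integrable_Omega_continuous continuous_intros g w)
  note cv = change_of_variables[OF s1 ig]
  have "(\<integral>x. B x \<partial>lebesgue_on \<Omega>) = - (\<integral>x. A x \<partial>lebesgue_on \<Omega>)"
    using integral_Omega_eq[of "\<lambda>x. A x + B x"] iA iB integral_unique[OF hi] by simp
  then have sum: "(\<integral>x. B x \<partial>lebesgue_on \<Omega>) + (\<integral>x. g' x * w x \<partial>lebesgue_on \<Omega>)
      = (\<integral>x. J x * (g' (shift s x) * w (shift s x)) - A x \<partial>lebesgue_on \<Omega>)"
    using iA cv by (simp add: J_def)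
  have "\<bar>(\<integral>x. B x \<partial>lebesgue_on \<Omega>) + (\<integral>x. g' x * w x \<partial>lebesgue_on \<Omega>)\<bar>
      \<le> (\<integral>x. (5/4 * \<omega> + 5 * M * \<epsilon>) * \<bar>w (shift s x)\<bar> \<partial>lebesgue_on \<Omega>)"
    unfolding sum
  proof (rule order_trans[OF integral_abs_bound integral_mono])
    show "integrable (lebesgue_on \<Omega>) (\<lambda>x. \<bar>J x * (g' (shift s x) * w (shift s x)) - A x\<bar>)"
      using iA cv by (auto simp: J_def)
    show "integrable (lebesgue_on \<Omega>) (\<lambda>x. (5/4 * \<omega> + 5 * M * \<epsilon>) * \<bar>w (shift s x)\<bar>)"
      by (intro integrable_Omega_continuous continuous_intros cws)
    fix x assume "x \<in> space (lebesgue_on \<Omega>)"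
    then have x: "x \<in> \<Omega>" by simp
    \<comment> \<open>\<open>E\<close> separates three small effects: the oscillation of
      \<open>g'\<close> over a distance \<epsilon>, the deviation of the Jacobian from 1 through
      \<open>J - 1 / J = (J - 1) * (J + 1) / J\<close>, and the derivative of the Jacobian.\<close>
    define E where "E = J x * (g' (shift s x) - g' x) + g' x * ((J x - 1) * (J x + 1) / J x)
      + g x * (s * \<zeta>2 x) / (J x)\<^sup>2"
    have J0: "J x \<noteq> 0" using J(1)[OF x] by auto
    have eq: "J x * (g' (shift s x) * w (shift s x)) - A x = E * w (shift s x)"
    proof -
      have k: "(J x - 1) * (J x + 1) / J x = J x - 1 / J x"
        using J0 by (simp add: field_simps)
      have "E = J x * g' (shift s x) - (g' x / J x - g x * (s * \<zeta>2 x) / (J x)\<^sup>2)"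
        unfolding E_def k by (simp add: algebra_simps)
      then show ?thesis by (simp only: A_def left_diff_distrib mult.assoc)
    qed
    have "\<bar>E\<bar> \<le> 5/4 * \<omega> + 5 * M * \<epsilon>"
    proof -
      have "\<bar>shift s x - x\<bar> \<le> \<epsilon>" using abs_mult_le[OF s1 bound0[OF x]] by (simp add: shift_def)
      then have "\<bar>g' (shift s x) - g' x\<bar> \<le> \<omega>" using osc shift_in[OF s1 x] x by blast
      then have 1: "\<bar>J x * (g' (shift s x) - g' x)\<bar> \<le> 5/4 * \<omega>"
        unfolding abs_mult using J[OF x] by (intro mult_mono) auto
      have "\<bar>(J x - 1) * (J x + 1) / J x\<bar> = \<bar>J x - 1\<bar> * (\<bar>J x + 1\<bar> / \<bar>J x\<bar>)"
        by (simp add: abs_mult)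
      also have "\<dots> \<le> \<epsilon> * ((9/4) / (3/4))"
        using J[OF x] eps_nonneg by (intro mult_mono frac_le) auto
      finally have "\<bar>g' x\<bar> * \<bar>(J x - 1) * (J x + 1) / J x\<bar> \<le> M * (3 * \<epsilon>)"
        using M(2)[OF x] M0 by (intro mult_mono) auto
      then have 2: "\<bar>g' x * ((J x - 1) * (J x + 1) / J x)\<bar> \<le> 3 * M * \<epsilon>" by (simp add: abs_mult)
      have tri: "\<bar>a + b + c\<bar> \<le> A + B + C" if "\<bar>a\<bar> \<le> A" "\<bar>b\<bar> \<le> B" "\<bar>c\<bar> \<le> C" for a b c A B C :: real
        using that by linarith
      have "\<bar>E\<bar> \<le> 5/4 * \<omega> + 3 * M * \<epsilon> + 2 * M * \<epsilon>"
        unfolding E_def by (rule tri[OF 1 2 coef[OF x]])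
      also have "\<dots> = 5/4 * \<omega> + 5 * M * \<epsilon>" by (simp add: algebra_simps)
      finally show ?thesis .
    qed
    then show "\<bar>J x * (g' (shift s x) * w (shift s x)) - A x\<bar> \<le> (5/4 * \<omega> + 5 * M * \<epsilon>) * \<bar>w (shift s x)\<bar>"
      unfolding eq abs_mult by (rule mult_right_mono) simp
  qed
  also have "\<dots> \<le> (5/4 * \<omega> + 5 * M * \<epsilon>) * (4/3 * (\<integral>x. \<bar>w x\<bar> \<partial>lebesgue_on \<Omega>))"
  proof -
    have "0 \<le> \<omega>" using osc[of "1/2" "1/2"] eps_nonneg by simp
    moreover have "(\<integral>x. \<bar>w (shift s x)\<bar> \<partial>lebesgue_on \<Omega>) \<le> 4/3 * (\<integral>x. \<bar>w x\<bar> \<partial>lebesgue_on \<Omega>)"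
      by (intro integral_shift_le[OF s1] continuous_intros w) auto
    ultimately show ?thesis unfolding integral_mult_right_zero
      using M0 eps_nonneg by (intro mult_left_mono) auto
  qed
  \<comment> \<open>The products 5/4 * 4/3 = 5/3 and 5 * 4/3 = 20/3 are rounded up to 2 and
    7.\<close>
  also have "\<dots> \<le> (2 * \<omega> + 7 * M * \<epsilon>) * (\<integral>x. \<bar>w x\<bar> \<partial>lebesgue_on \<Omega>)"
  proof -
    have "0 \<le> \<omega>" using osc[of "1/2" "1/2"] eps_nonneg by simp
    then have "(5/4 * \<omega> + 5 * M * \<epsilon>) * (4/3) \<le> 2 * \<omega> + 7 * M * \<epsilon>"
      using mult_nonneg_nonneg[OF M0 eps_nonneg] by (simp add: algebra_simps)
    then have "(5/4 * \<omega> + 5 * M * \<epsilon>) * (4/3) * (\<integral>x. \<bar>w x\<bar> \<partial>lebesgue_on \<Omega>) \<le> (2 * \<omega> + 7 * M * \<epsilon>) * (\<integral>x. \<bar>w x\<bar> \<partial>lebesgue_on \<Omega>)"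
      by (intro mult_right_mono) auto
    then show ?thesis by (simp only: mult.assoc)
  qed
  finally show ?thesis by (simp add: B_def)
qed

text \<open>The quotient is the average of w'(shift s x) over s in (0,1). The integrand is bounded
  on a product of finite measures, so Fubini applies, and the slice bound does not depend on
  \<open>s\<close>; averaging over a measure of total mass 1 preserves it.\<close>

lemma consistency:
  assumes w: "continuous_on {0..1} w" "w 0 = 0" "w 1 = 0" and S: "finite S"
    and der: "\<And>x. x \<in> \<Omega> - S \<Longrightarrow> (w has_real_derivative w' x) (at x)"
    and w'[measurable]: "w' \<in> borel_measurable borel" and bd: "\<And>x. \<bar>w' x\<bar> \<le> L"
    and g: "\<And>x. x \<in> \<Omega> \<Longrightarrow> (g has_real_derivative g' x) (at x)" "continuous_on {0..1} g'"
    and M: "\<And>x. x \<in> \<Omega> \<Longrightarrow> \<bar>g x\<bar> \<le> M" "\<And>x. x \<in> \<Omega> \<Longrightarrow> \<bar>g' x\<bar> \<le> M"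
    and osc: "\<And>x y. x \<in> \<Omega> \<Longrightarrow> y \<in> \<Omega> \<Longrightarrow> \<bar>x - y\<bar> \<le> \<epsilon> \<Longrightarrow> \<bar>g' x - g' y\<bar> \<le> \<omega>"
  shows "\<bar>(\<integral>x. g x * quot w x \<partial>lebesgue_on \<Omega>) + (\<integral>x. g' x * w x \<partial>lebesgue_on \<Omega>)\<bar>
    \<le> (2 * \<omega> + 7 * M * \<epsilon>) * (\<integral>x. \<bar>w x\<bar> \<partial>lebesgue_on \<Omega>)"
proof -
  let ?L = "lebesgue_on \<Omega>"
  interpret P: pair_sigma_finite ?L ?L ..
  interpret PF: finite_measure "?L \<Otimes>\<^sub>M ?L"
    by (intro finite_measure_pair_measure Om.finite_measure_axioms)
  have M0: "0 \<le> M" using M(1)[of "1/2"] by simp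
  have "continuous_on \<Omega> g" using g(1) by (meson DERIV_isCont continuous_at_imp_continuous_on)
  then have [measurable]: "g \<in> borel_measurable ?L"
    by (rule continuous_imp_measurable_on_sets_lebesgue) (rule sets_lebesgue_Omega)
  have [measurable]: "\<zeta> \<in> borel_measurable ?L"
    by (intro continuous_imp_measurable_on_sets_lebesgue continuous_on_subset[OF cont]) auto
  have [measurable]: "(\<lambda>x. x) \<in> borel_measurable ?L" by (rule borel_measurable_lebesgue_on) simp
  let ?H = "\<lambda>(x, s). g x * w' (shift s x)"
  have "?H \<in> borel_measurable (?L \<Otimes>\<^sub>M ?L)"
    unfolding shift_def by measurable
  then have H: "integrable (?L \<Otimes>\<^sub>M ?L) ?H"
    by (rule PF.integrable_const_bound[rotated, where B = "M * L"])
      (use M(1) bd M0 in \<open>auto intro!: AE_I2 mult_mono simp: abs_mult space_pair_measure\<close>)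
  define K where "K = (2 * \<omega> + 7 * M * \<epsilon>) * (\<integral>x. \<bar>w x\<bar> \<partial>?L)"
  define G where "G = (\<integral>x. g' x * w x \<partial>?L)"
  define B where "B s = (\<integral>x. g x * w' (shift s x) \<partial>?L)" for s
  have B: "integrable ?L B" unfolding B_def
    using P.integrable_snd[OF H] by simp
  have "(\<integral>x. g x * quot w x \<partial>?L) = (\<integral>x. (\<integral>s. g x * w' (shift s x) \<partial>?L) \<partial>?L)"
  proof (rule Bochner_Integration.integral_cong[OF refl])
    fix x assume "x \<in> space ?L"
    then have "quot w x = (\<integral>s. w' (shift s x) \<partial>?L)"
      by (intro quot_eq_integral[OF w(1) S der w' bd]) auto
    then show "g x * quot w x = (\<integral>s. g x * w' (shift s x) \<partial>?L)" by simp
  qed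
  also have "\<dots> = (\<integral>s. B s \<partial>?L)"
    using P.Fubini_integral[OF H] by (simp add: B_def)
  finally have sum: "(\<integral>x. g x * quot w x \<partial>?L) + G = (\<integral>s. B s + G \<partial>?L)"
    using B by (simp add: measure_Omega)
  have "\<bar>(\<integral>x. g x * quot w x \<partial>?L) + G\<bar> \<le> (\<integral>s. K \<partial>?L)"
    unfolding sum
  proof (rule order_trans[OF integral_abs_bound integral_mono])
    fix s assume "s \<in> space ?L"
    then have "s \<in> \<Omega>" by simp
    from consistency_slice[OF w S der w' bd g M osc this]
    show "\<bar>B s + G\<bar> \<le> K" by (simp add: B_def G_def K_def)
  qed (use B in auto)
  also have "\<dots> = K" by (simp add: measure_Omega)
  finally show ?thesis by (simp add: G_def K_def)
qed

end

section \<open>Smooth cutoffs\<close>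

text \<open>Asking recursively for some derivative on the whole line lets closure under sums,
  products and affine substitutions be proved by induction, without manipulating
  \<open>nderiv_on\<close>. The transfer to \<open>Ck_on\<close> happens once, in
  \<open>smooth_upto_imp_Ck_on\<close>.\<close>

primrec smooth_upto :: "nat \<Rightarrow> (real \<Rightarrow> real) \<Rightarrow> bool" where
  "smooth_upto 0 f \<longleftrightarrow> continuous_on UNIV f"
| "smooth_upto (Suc k) f \<longleftrightarrow> (\<exists>f'. (\<forall>x. (f has_real_derivative f' x) (at x)) \<and> smooth_upto k f')"

definition smooth :: "(real \<Rightarrow> real) \<Rightarrow> bool" where
  "smooth f \<longleftrightarrow> (\<forall>k. smooth_upto k f)"

lemma smooth_upto_Suc_imp: "smooth_upto (Suc k) f \<Longrightarrow> smooth_upto k f"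
proof (induction k arbitrary: f)
  case 0
  then show ?case by simp (meson DERIV_isCont continuous_at_imp_continuous_on)
next
  case (Suc k)
  then obtain f' where "\<forall>x. (f has_real_derivative f' x) (at x)" "smooth_upto (Suc k) f'"
    by auto
  then show ?case using Suc.IH by auto
qed

lemma smooth_upto_add: "smooth_upto k f \<Longrightarrow> smooth_upto k g \<Longrightarrow> smooth_upto k (\<lambda>x. f x + g x)"
proof (induction k arbitrary: f g)
  case 0
  then show ?case by (auto intro: continuous_intros)
next
  case (Suc k)
  then obtain f' g' where "\<And>x. (f has_real_derivative f' x) (at x)" "smooth_upto k f'"
     "\<And>x. (g has_real_derivative g' x) (at x)" "smooth_upto k g'" by auto
  then show ?case
    using Suc.IH[of f' g'] by (auto intro!: exI[of _ "\<lambda>x. f' x + g' x"] derivative_intros)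
qed

lemma smooth_upto_mult: "smooth_upto k f \<Longrightarrow> smooth_upto k g \<Longrightarrow> smooth_upto k (\<lambda>x. f x * g x)"
proof (induction k arbitrary: f g)
  case 0
  then show ?case by (auto intro: continuous_intros)
next
  case (Suc k)
  then obtain f' g' where *: "\<And>x. (f has_real_derivative f' x) (at x)" "smooth_upto k f'"
     "\<And>x. (g has_real_derivative g' x) (at x)" "smooth_upto k g'" by auto
  have "smooth_upto k f" "smooth_upto k g" using Suc.prems by (blast intro: smooth_upto_Suc_imp)+
  then have "smooth_upto k (\<lambda>x. f' x * g x + f x * g' x)"
    using * by (intro smooth_upto_add Suc.IH)
  then show ?case
    using * by (auto intro!: exI[of _ "\<lambda>x. f' x * g x + f x * g' x"] derivative_eq_intros)
qed

lemma smooth_upto_const: "smooth_upto k (\<lambda>x. c)"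
proof (induction k arbitrary: c)
  case (Suc k)
  then show ?case by (auto intro!: exI[of _ "\<lambda>x. 0"])
qed auto

lemma smooth_upto_affine: "smooth_upto k f \<Longrightarrow> smooth_upto k (\<lambda>x. f (a * x + b))"
proof (induction k arbitrary: f)
  case 0
  then show ?case by (auto intro!: continuous_intros continuous_on_compose2[of UNIV f])
next
  case (Suc k)
  then obtain f' where f': "\<And>x. (f has_real_derivative f' x) (at x)" "smooth_upto k f'" by auto
  have "((\<lambda>x. f (a * x + b)) has_real_derivative f' (a * x + b) * a) (at x)" for x
    by (rule DERIV_chain2[OF f'(1)]) (auto intro!: derivative_eq_intros)
  moreover have "smooth_upto k (\<lambda>x. f' (a * x + b) * a)"
    using Suc.IH[OF f'(2)] smooth_upto_const by (rule smooth_upto_mult)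
  ultimately show ?case unfolding smooth_upto.simps
    by (intro exI[of _ "\<lambda>x. f' (a * x + b) * a"] conjI allI)
qed

lemma smooth_const: "smooth (\<lambda>x. c)"
  and smooth_add: "smooth f \<Longrightarrow> smooth g \<Longrightarrow> smooth (\<lambda>x. f x + g x)"
  and smooth_mult: "smooth f \<Longrightarrow> smooth g \<Longrightarrow> smooth (\<lambda>x. f x * g x)"
  and smooth_affine: "smooth f \<Longrightarrow> smooth (\<lambda>x. f (a * x + b))"
  by (auto simp: smooth_def smooth_upto_const smooth_upto_add smooth_upto_mult smooth_upto_affine)

lemma smooth_continuous: "smooth f \<Longrightarrow> continuous_on A f"
  unfolding smooth_def by (metis continuous_on_subset smooth_upto.simps(1) subset_UNIV)

text \<open>Closed under differentiation, which is what makes \<open>exp (- 1 / x)\<close> smooth at \<open>0\<close>.\<close>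

definition flat :: "real poly \<Rightarrow> real \<Rightarrow> real" where
  "flat p x = (if 0 < x then poly p (1 / x) * exp (- 1 / x) else 0)"

lemma tendsto_poly_mult_exp: "((\<lambda>y::real. poly p y * exp (- y)) \<longlongrightarrow> 0) at_top"
proof -
  have "((\<lambda>y::real. coeff p i * (y ^ i / exp y)) \<longlongrightarrow> coeff p i * 0) at_top" for i
    by (intro tendsto_intros tendsto_power_div_exp_0)
  then have "((\<lambda>y::real. \<Sum>i\<le>degree p. coeff p i * (y ^ i / exp y)) \<longlongrightarrow> (\<Sum>i\<le>degree p. coeff p i * 0)) at_top"
    by (intro tendsto_sum)
  then show ?thesis
    by (simp add: poly_altdef sum_distrib_right exp_minus divide_inverse mult.assoc)
qed

lemma flat_tendsto_0: "(flat p \<longlongrightarrow> 0) (at 0)"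
proof -
  have "((\<lambda>x. poly p (inverse x) * exp (- inverse x)) \<longlongrightarrow> 0) (at_right (0::real))"
    using filterlim_compose[OF tendsto_poly_mult_exp filterlim_inverse_at_top_right] .
  then have "(flat p \<longlongrightarrow> 0) (at_right 0)"
    by (rule Lim_transform_eventually)
      (auto simp: flat_def eventually_at_right_field inverse_eq_divide intro!: exI[of _ 1])
  moreover have "(flat p \<longlongrightarrow> 0) (at_left 0)"
    by (rule tendsto_eventually) (auto simp: flat_def eventually_at_left_field intro!: exI[of _ "-1"])
  ultimately show ?thesis by (simp add: filterlim_at_split)
qed

text \<open>For x > 0 the derivative of p(1/x) exp(-1/x) is (1/x)^2 (p - p')(1/x) exp(-1/x), which
  explains the factor \<open>[:0, 0, 1:]\<close>. At 0 the difference quotient of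
  \<open>flat p\<close> is again of this form, with \<open>p\<close> multiplied by the variable, so
  it tends to 0.\<close>

lemma flat_deriv: "(flat p has_real_derivative flat ([:0, 0, 1:] * (p - pderiv p)) x) (at x)"
proof (cases x "0::real" rule: linorder_cases)
  case less
  then have "((\<lambda>x. 0) has_real_derivative flat ([:0, 0, 1:] * (p - pderiv p)) x) (at x)"
    by (simp add: flat_def)
  then show ?thesis
    by (rule has_field_derivative_transform_within_open[where S = "{..<0}"]) (use less in \<open>auto simp: flat_def\<close>)
next
  case equal
  have "((\<lambda>h. flat ([:0, 1:] * p) h) \<longlongrightarrow> 0) (at 0)" by (rule flat_tendsto_0)
  then have "((\<lambda>h. (flat p (0 + h) - flat p 0) / h) \<longlongrightarrow> 0) (at 0)"
    by (rule Lim_transform_eventually) (auto simp: flat_def eventually_at intro!: exI[of _ 1])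
  then show ?thesis using equal by (simp add: DERIV_def flat_def)
next
  case greater
  have 1: "((\<lambda>x. 1 / x) has_real_derivative - (1 / x\<^sup>2)) (at x)"
    using greater by (auto intro!: derivative_eq_intros simp: power2_eq_square)
  have 2: "((\<lambda>x. - 1 / x) has_real_derivative 1 / x\<^sup>2) (at x)"
    using DERIV_minus[OF 1] by simp
  have "((\<lambda>x. poly p (1 / x) * exp (- 1 / x)) has_real_derivative flat ([:0, 0, 1:] * (p - pderiv p)) x) (at x)"
    by (rule DERIV_cong[OF DERIV_mult[OF DERIV_chain2[OF poly_DERIV 1] DERIV_chain2[OF DERIV_exp 2]]])
      (use greater in \<open>simp add: flat_def power2_eq_square algebra_simps\<close>)
  then show ?thesis
    by (rule has_field_derivative_transform_within_open[where S = "{0<..}"]) (use greater in \<open>auto simp: flat_def\<close>)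
qed

lemma smooth_flat: "smooth (flat p)"
proof -
  have "smooth_upto k (flat p)" for k
  proof (induction k arbitrary: p)
    case 0
    then show ?case
      using flat_deriv by (auto intro!: continuous_at_imp_continuous_on DERIV_isCont)
  next
    case (Suc k)
    then show ?case using flat_deriv by (auto simp del: mult_pCons_left)
  qed
  then show ?thesis by (simp add: smooth_def)
qed

section \<open>Iterated derivatives relative to a set, and bump functions\<close>

lemma nderiv_on_Suc: "nderiv_on (Suc k) S f = (\<lambda>x. vector_derivative (nderiv_on k S f) (at x within S))"
  by (simp add: nderiv_on_def)

lemma nderiv_on_0 [simp]: "nderiv_on 0 S f = f"
  by (simp add: nderiv_on_def)

lemma nderiv_on_add: "nderiv_on (j + k) S f = nderiv_on j S (nderiv_on k S f)"
  by (simp add: nderiv_on_def funpow_add)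

lemma vector_derivative_cong_set:
  assumes "\<And>x. x \<in> S \<Longrightarrow> f x = g x" "x \<in> S"
  shows "vector_derivative f (at x within S) = vector_derivative g (at x within S)"
proof -
  have "(f has_vector_derivative d) (at x within S) \<longleftrightarrow> (g has_vector_derivative d) (at x within S)" for d
    using assms has_vector_derivative_transform[of x S f g d] has_vector_derivative_transform[of x S g f d]
    by auto
  then show ?thesis by (simp add: vector_derivative_def)
qed

lemma nderiv_on_cong:
  assumes "\<And>x. x \<in> S \<Longrightarrow> f x = g x" "x \<in> S"
  shows "nderiv_on k S f x = nderiv_on k S g x"
  using assms(2)
proof (induction k arbitrary: x)
  case (Suc k)
  then show ?case unfolding nderiv_on_Suc by (intro vector_derivative_cong_set)
qed (use assms in simp)

lemma Ck_on_cong: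
  assumes "\<And>x. x \<in> S \<Longrightarrow> f x = g x"
  shows "Ck_on k S f \<longleftrightarrow> Ck_on k S g"
proof -
  have *: "nderiv_on j S f x = nderiv_on j S g x" if "x \<in> S" for j x
    using assms that by (rule nderiv_on_cong)
  have "nderiv_on j S f differentiable_on S \<longleftrightarrow> nderiv_on j S g differentiable_on S" for j
    unfolding differentiable_on_def
    by (metis (no_types, lifting) * differentiable_transform_within zero_less_one)
  moreover have "continuous_on S (nderiv_on k S f) \<longleftrightarrow> continuous_on S (nderiv_on k S g)"
    by (rule continuous_on_cong) (auto simp: *)
  ultimately show ?thesis by (simp add: Ck_on_def)
qed

lemma nderiv_on_1:
  assumes "open S" "x \<in> S" "(f has_real_derivative d) (at x)"
  shows "nderiv_on 1 S f x = d"
  using assms unfolding One_nat_def nderiv_on_Suc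
  by (simp add: at_within_open[of x S] has_real_derivative_iff_has_vector_derivative vector_derivative_at)

lemma Ck_on_Suc:
  assumes S: "open S" and d: "\<And>x. x \<in> S \<Longrightarrow> (f has_real_derivative f' x) (at x)" and "Ck_on k S f'"
  shows "Ck_on (Suc k) S f"
proof -
  have "nderiv_on 1 S f x = f' x" if "x \<in> S" for x
    using nderiv_on_1[OF S that d[OF that]] .
  then have "Ck_on k S (nderiv_on 1 S f)" using assms(3) by (subst Ck_on_cong)
  moreover have "f differentiable_on S"
    unfolding differentiable_on_def real_differentiable_def
    using d has_field_derivative_at_within by blast
  ultimately show ?thesis
    unfolding Ck_on_def nderiv_on_add[symmetric] by (simp add: All_less_Suc2)
qed

lemma smooth_upto_imp_Ck_on: "smooth_upto k f \<Longrightarrow> open S \<Longrightarrow> Ck_on k S f"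
proof (induction k arbitrary: f)
  case 0
  then show ?case by (auto simp: Ck_on_def intro: continuous_on_subset)
next
  case (Suc k)
  then show ?case by (auto intro: Ck_on_Suc)
qed

text \<open>The derivative is carried along because weak identities are tested with both functions.
  Zero values outside a compact subinterval are required on the whole line, stronger than in
  \<open>test_functions\<close>, which looks at \<Omega> only.\<close>

definition bump :: "(real \<Rightarrow> real) \<Rightarrow> (real \<Rightarrow> real) \<Rightarrow> bool" where
  "bump \<phi> \<phi>' \<longleftrightarrow> smooth \<phi>' \<and> (\<forall>x. (\<phi> has_real_derivative \<phi>' x) (at x)) \<and>
     (\<exists>a b. 0 < a \<and> a < b \<and> b < 1 \<and> (\<forall>x. x \<notin> {a..b} \<longrightarrow> \<phi> x = 0))"

lemma smooth_compact_test_function: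
  assumes "smooth \<phi>" "0 < a" "b < 1" "\<And>x. x \<notin> {a..b} \<Longrightarrow> \<phi> x = 0"
  shows "\<phi> \<in> test_functions"
  unfolding test_functions_def
  using assms smooth_upto_imp_Ck_on[of _ \<phi> \<Omega>]
  by (auto simp: smooth_def intro!: exI[of _ "{a..b}"])

lemma bump_props:
  assumes "bump \<phi> \<phi>'"
  shows "smooth \<phi>" "\<phi> \<in> test_functions" "\<phi>' \<in> test_functions"
    "\<And>x. x \<in> \<Omega> \<Longrightarrow> nderiv_on 1 \<Omega> \<phi> x = \<phi>' x" "\<phi> 1 = 0"
proof -
  obtain a b where ab: "0 < a" "a < b" "b < 1" and z: "\<And>x. x \<notin> {a..b} \<Longrightarrow> \<phi> x = 0"
    and s: "smooth \<phi>'" and d: "\<And>x. (\<phi> has_real_derivative \<phi>' x) (at x)"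
    using assms unfolding bump_def by blast
  have "smooth_upto (Suc k) \<phi>" for k using s d by (auto simp: smooth_def)
  then show sm: "smooth \<phi>" using smooth_upto_Suc_imp by (auto simp: smooth_def)
  then show "\<phi> \<in> test_functions" using ab z by (intro smooth_compact_test_function)
  have "\<phi>' x = 0" if "x \<notin> {a..b}" for x
  proof -
    have "((\<lambda>x. 0) has_real_derivative \<phi>' x) (at x)"
      by (rule has_field_derivative_transform_within_open[OF d, where S = "- {a..b}"])
        (use that z in \<open>auto simp: open_Compl\<close>)
    then show ?thesis using DERIV_unique[OF _ DERIV_const] by blast
  qed
  then show "\<phi>' \<in> test_functions" using ab s by (intro smooth_compact_test_function)
  show "nderiv_on 1 \<Omega> \<phi> x = \<phi>' x" if "x \<in> \<Omega>" for x
    using that d by (intro nderiv_on_1) auto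
  show "\<phi> 1 = 0" using z ab by auto
qed

text \<open>On \<open>(a, b)\<close> this is \<open>exp\<close> of a negative quantity of order \<open>1 / n\<close>, so it tends to \<open>1\<close> there while
  the support stays fixed.\<close>

definition cutoff :: "real \<Rightarrow> real \<Rightarrow> nat \<Rightarrow> real \<Rightarrow> real" where
  "cutoff a b n x = flat 1 (real (Suc n) * (x - a)) * flat 1 (real (Suc n) * (b - x))"

lemma smooth_cutoff: "smooth (cutoff a b n)"
proof -
  have "smooth (\<lambda>x. flat 1 (real (Suc n) * x + - (real (Suc n) * a)) * flat 1 (- real (Suc n) * x + real (Suc n) * b))"
    by (intro smooth_mult smooth_affine smooth_flat)
  then show ?thesis unfolding cutoff_def by (simp add: algebra_simps)
qed

lemma cutoff_outside: "x \<notin> {a<..<b} \<Longrightarrow> cutoff a b n x = 0"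
  by (auto simp: cutoff_def flat_def zero_less_mult_iff)

lemma cutoff_bounds: "0 \<le> cutoff a b n x" "cutoff a b n x \<le> 1"
proof -
  have *: "0 \<le> flat 1 y \<and> flat 1 y \<le> 1" for y :: real by (simp add: flat_def)
  show "0 \<le> cutoff a b n x" "cutoff a b n x \<le> 1"
    unfolding cutoff_def using * by (auto intro!: mult_nonneg_nonneg mult_le_one)
qed

lemma cutoff_inside: "x \<in> {a<..<b} \<Longrightarrow> 0 < cutoff a b n x"
  by (simp add: cutoff_def flat_def)

lemma cutoff_tendsto: "(\<lambda>n. cutoff a b n x) \<longlonglongrightarrow> indicator {a<..<b} x"
proof (cases "x \<in> {a<..<b}")
  case True
  have *: "(\<lambda>n. flat 1 (real (Suc n) * y)) \<longlonglongrightarrow> 1" if "0 < y" for y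
  proof -
    have "(\<lambda>n. exp (- (inverse (real (Suc n)) * (1 / y)))) \<longlonglongrightarrow> exp (- (0 * (1 / y)))"
      by (intro tendsto_intros LIMSEQ_inverse_real_of_nat)
    then show ?thesis using that
      by (simp add: flat_def divide_inverse)
  qed
  have "(\<lambda>n. cutoff a b n x) \<longlonglongrightarrow> 1 * 1"
    unfolding cutoff_def using True by (intro tendsto_mult *) auto
  then show ?thesis using True by simp
next
  case False
  then show ?thesis by (simp add: cutoff_outside)
qed

section \<open>Regularity of the weak solution\<close>

lemma integrable_Omega_mult_bounded:
  fixes k h :: "real \<Rightarrow> real"
  assumes k: "integrable (lebesgue_on \<Omega>) k" and h: "continuous_on {0..1} h"
  shows "integrable (lebesgue_on \<Omega>) (\<lambda>x. k x * h x)"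
proof -
  obtain B where B: "\<forall>x\<in>{0..1}. \<bar>h x\<bar> \<le> B" using continuous_bounded_unit[OF h] .
  have "0 \<le> B" using B by force
  have "continuous_on \<Omega> h" using h by (rule continuous_on_subset) auto
  then have [measurable]: "h \<in> borel_measurable (lebesgue_on \<Omega>)"
    by (rule continuous_imp_measurable_on_sets_lebesgue) (rule sets_lebesgue_Omega)
  have [measurable]: "k \<in> borel_measurable (lebesgue_on \<Omega>)" using k by auto
  show ?thesis
  proof (rule Bochner_Integration.integrable_bound[where f = "\<lambda>x. B * \<bar>k x\<bar>"])
    show "AE x in lebesgue_on \<Omega>. norm (k x * h x) \<le> norm (B * \<bar>k x\<bar>)"
      using B \<open>0 \<le> B\<close>
      by (intro AE_I2) (auto simp: abs_mult mult.commute[of "\<bar>k _\<bar>"] intro!: mult_right_mono)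
  qed (use k in auto)
qed

text \<open>A pi-lambda argument. Dominated convergence extends the hypothesis from intervals
  compactly inside \<Omega> to all open intervals, including the total integral needed for
  complements; open intervals are stable under intersection and generate the Borel sets, and a
  Lebesgue set differs from a Borel set by a null set.\<close>

lemma AE_0_if_intervals_0:
  fixes k :: "real \<Rightarrow> real"
  assumes k: "integrable (lebesgue_on \<Omega>) k"
    and z: "\<And>a b. 0 < a \<Longrightarrow> a < b \<Longrightarrow> b < 1 \<Longrightarrow> (\<integral>x. k x * indicator {a<..<b} x \<partial>lebesgue_on \<Omega>) = 0"
  shows "AE x in lebesgue_on \<Omega>. k x = 0"
proof -
  let ?L = "lebesgue_on \<Omega>"
  have mk [measurable]: "k \<in> borel_measurable ?L" using k by (rule borel_measurable_integrable)
  have mi: "A \<in> sets borel \<Longrightarrow> indicat_real A \<in> borel_measurable ?L" for A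
    by (rule borel_measurable_lebesgue_on) simp
  have intA: "A \<in> sets borel \<Longrightarrow> integrable ?L (\<lambda>x. k x * indicator A x)" for A
    by (rule Bochner_Integration.integrable_bound[OF k borel_measurable_times[OF mk mi[of A]]])
      (simp_all add: abs_mult mult_left_le)
  define D where "D A = (\<integral>x. k x * indicator A x \<partial>?L)" for A
  have box: "D {a<..<b} = 0" for a b :: real
  proof -
    have pos: "0 < 1 / real (Suc (Suc n))" for n by simp
    \<comment> \<open>The offset 1/(n+2) is positive for every \<open>n\<close>, so the end points
      lie strictly inside (0,1) as the hypothesis demands. For small \<open>n\<close> the interval
      may be empty, where the integral is trivially 0.\<close>
    define lo where "lo n = max a 0 + 1 / real (Suc (Suc n))" for n
    define hi where "hi n = min b 1 - 1 / real (Suc (Suc n))" for n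
    have "(\<lambda>n. D {lo n<..<hi n}) \<longlonglongrightarrow> D {a<..<b}"
      unfolding D_def
    proof (rule integral_dominated_convergence[where w = "\<lambda>x. \<bar>k x\<bar>"])
      have lo: "lo \<longlonglongrightarrow> max a 0 + 0" and hi: "hi \<longlonglongrightarrow> min b 1 - 0"
        unfolding lo_def hi_def
        by (intro tendsto_intros LIMSEQ_Suc[OF LIMSEQ_Suc[OF lim_1_over_n]])+
      show "AE x in ?L. (\<lambda>n. k x * indicat_real {lo n<..<hi n} x) \<longlonglongrightarrow> k x * indicat_real {a<..<b} x"
      proof (rule AE_I2)
        fix x assume "x \<in> space ?L"
        then have x: "0 < x" "x < 1" by auto
        have "\<forall>\<^sub>F n in sequentially. indicat_real {lo n<..<hi n} x = indicat_real {a<..<b} x"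
        proof (cases "x \<in> {a<..<b}")
          case True
          then have "\<forall>\<^sub>F n in sequentially. lo n < x" "\<forall>\<^sub>F n in sequentially. x < hi n"
            using x by (intro order_tendstoD[OF lo] order_tendstoD[OF hi]; auto)+
          then show ?thesis by eventually_elim (use True in auto)
        next
          case False
          have "a < lo n" "hi n < b" for n
            using pos[of n] max.cobounded1[of a 0] min.cobounded1[of b 1] unfolding lo_def hi_def by linarith+
          then have "x \<notin> {lo n<..<hi n}" for n using False by (force dest: less_trans)
          then show ?thesis using False by (intro always_eventually) (auto simp: indicator_def)
        qed
        then show "(\<lambda>n. k x * indicat_real {lo n<..<hi n} x) \<longlonglongrightarrow> k x * indicat_real {a<..<b} x"
          by (intro tendsto_intros tendsto_eventually)
      qed
    qed (use k in \<open>auto split: split_indicator intro!: borel_measurable_integrable intA\<close>)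
    moreover have "D {lo n<..<hi n} = 0" for n
    proof (cases "lo n < hi n")
      case True
      moreover have "0 < lo n" "hi n < 1"
        using pos[of n] max.cobounded2[of 0 a] min.cobounded2[of b 1] unfolding lo_def hi_def by linarith+
      ultimately show ?thesis unfolding D_def by (intro z)
    qed (simp add: D_def)
    ultimately show ?thesis by (simp add: LIMSEQ_const_iff)
  qed
  have whole: "(\<integral>x. k x \<partial>?L) = 0"
  proof -
    have "(\<integral>x. k x \<partial>?L) = D {0<..<1}"
      unfolding D_def by (rule Bochner_Integration.integral_cong) auto
    then show ?thesis using box by simp
  qed
  have gen: "sets borel = sigma_sets UNIV (range (\<lambda>(a, b). {a<..<b} :: real set))"
    using arg_cong[OF borel_eq_box[where 'a = real], of sets] by (simp add: box_real)
  have borel0: "D A = 0" if "A \<in> sets borel" for A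
  proof -
    have A: "A \<in> sigma_sets UNIV (range (\<lambda>(a, b). {a<..<b} :: real set))"
      using that gen by simp
    have ist: "Int_stable (range (\<lambda>(a, b). {a<..<b} :: real set))"
    proof (rule Int_stableI)
      fix A B :: "real set"
      assume "A \<in> range (\<lambda>(a, b). {a<..<b})" "B \<in> range (\<lambda>(a, b). {a<..<b})"
      then obtain a b c d where "A = {a<..<b}" "B = {c<..<d}" by auto
      then have "A \<inter> B = (case (max a c, min b d) of (x, y) \<Rightarrow> {x<..<y})" by auto
      then show "A \<inter> B \<in> range (\<lambda>(a, b). {a<..<b})" by (rule range_eqI)
    qed
    show ?thesis
      using ist _ A
    proof (rule sigma_sets_induct_disjoint)
      fix A assume "A \<in> range (\<lambda>(a, b). {a<..<b} :: real set)"
      then show "D A = 0" using box by auto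
    next
      show "D {} = 0" by (simp add: D_def)
    next
      fix A assume A: "A \<in> sigma_sets UNIV (range (\<lambda>(a, b). {a<..<b} :: real set))" and 0: "D A = 0"
      have Ab: "A \<in> sets borel" using A gen by simp
      have "D (UNIV - A) = (\<integral>x. k x - k x * indicator A x \<partial>?L)" unfolding D_def
        by (rule Bochner_Integration.integral_cong) (auto simp: indicator_def)
      then show "D (UNIV - A) = 0" using 0 whole k intA[OF Ab] by (simp add: D_def)
    next
      fix A :: "nat \<Rightarrow> real set"
      assume dj: "disjoint_family A"
        and A: "range A \<subseteq> sigma_sets UNIV (range (\<lambda>(a, b). {a<..<b} :: real set))"
        and 0: "\<And>i. D (A i) = 0"
      have Ab: "A i \<in> sets borel" for i using A gen by auto
      have "(\<lambda>n. D (\<Union>i<n. A i)) \<longlonglongrightarrow> D (\<Union>i. A i)"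
        unfolding D_def
      proof (rule integral_dominated_convergence[where w = "\<lambda>x. \<bar>k x\<bar>"])
        show "AE x in ?L. (\<lambda>n. k x * indicat_real (\<Union>i<n. A i) x) \<longlonglongrightarrow> k x * indicat_real (\<Union>i. A i) x"
          by (intro AE_I2 tendsto_intros LIMSEQ_indicator_UN)
      qed (use k Ab in \<open>auto split: split_indicator intro!: borel_measurable_integrable intA\<close>)
      moreover have "D (\<Union>i<n. A i) = 0" for n
      proof (induction n)
        case (Suc n)
        have "A i \<inter> A n = {}" if "i < n" for i
          using dj that unfolding disjoint_family_on_def by (metis UNIV_I less_irrefl)
        then have "(\<Union>i<n. A i) \<inter> A n = {}" by auto
        then have 1: "D (\<Union>i<Suc n. A i) = (\<integral>x. k x * indicator (\<Union>i<n. A i) x + k x * indicator (A n) x \<partial>?L)"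
          unfolding D_def lessThan_Suc
          by (intro Bochner_Integration.integral_cong) (auto simp: indicator_def)
        have "D (\<Union>i<Suc n. A i) = D (\<Union>i<n. A i) + D (A n)" unfolding 1
          unfolding D_def by (intro Bochner_Integration.integral_add intA) (use Ab in auto)
        then show ?case using Suc 0 by simp
      qed (simp add: D_def)
      ultimately show "D (\<Union>i. A i) = 0" by (simp add: LIMSEQ_const_iff)
    qed auto
  qed
  show ?thesis
  proof (rule Om.density_zero[OF k])
    fix A assume "A \<in> sets ?L"
    then have "A \<in> sets lebesgue" using sets_lebesgue_Omega by (simp add: sets_restrict_space_iff)
    \<comment> \<open>The completion splits \<open>A\<close> into a Borel part and a part of a Borel
      null set; the latter does not affect the integral.\<close>
    then obtain S N N' where S: "S \<in> sets lborel" and N: "A = S \<union> N" "N \<subseteq> N'" "N' \<in> null_sets lborel"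
      by (rule sets_completionE)
    have N': "N' \<in> null_sets lebesgue" using N(3) by (rule null_sets_completionI)
    have "AE x in lebesgue. x \<notin> N'" using N' by (rule AE_not_in)
    then have "AE x in ?L. x \<notin> N'"
      using sets_lebesgue_Omega by (subst AE_restrict_space_iff) (auto elim: eventually_mono)
    then have "AE x in ?L. indicator A x *\<^sub>R k x = k x * indicator S x"
      by eventually_elim (use N in \<open>auto simp: indicator_def\<close>)
    then have "set_lebesgue_integral ?L A k = D S"
      unfolding set_lebesgue_integral_def D_def
      using \<open>A \<in> sets ?L\<close> S by (intro integral_cong_AE) (auto intro!: borel_measurable_integrable intA)
    then show "set_lebesgue_integral ?L A k = 0" using borel0 S by simp
  qed
qed

section \<open>Primitives, integration by parts and the du Bois-Reymond lemma\<close>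

lemma integrable_Omega_on_unit:
  fixes g :: "real \<Rightarrow> real"
  assumes "integrable (lebesgue_on \<Omega>) g"
  shows "g integrable_on {0..1}"
  using integrable_on_lebesgue_on[OF assms] integrable_on_open_interval_real[of g 0 1] by simp

lemma continuous_primitive:
  fixes g :: "real \<Rightarrow> real"
  assumes "integrable (lebesgue_on \<Omega>) g"
  shows "continuous_on {0..1} (\<lambda>x. integral {0..x} g)"
  by (rule indefinite_integral_continuous_1[OF integrable_Omega_on_unit[OF assms]])

lemma integral_Omega_if:
  fixes g :: "real \<Rightarrow> real"
  assumes g: "integrable (lebesgue_on \<Omega>) g" and S: "S \<in> sets borel" "S \<subseteq> {0..1}"
  shows "(\<integral>s. (if s \<in> S then g s else 0) \<partial>lebesgue_on \<Omega>) = integral S g"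
proof -
  have "indicat_real S \<in> borel_measurable (lebesgue_on \<Omega>)"
    using S by (intro borel_measurable_lebesgue_on) simp
  from borel_measurable_times[OF borel_measurable_integrable[OF g] this]
  have "integrable (lebesgue_on \<Omega>) (\<lambda>s. g s * indicator S s)"
    by (rule Bochner_Integration.integrable_bound[OF g]) (simp add: abs_mult mult_left_le)
  moreover have eq: "(\<lambda>s. if s \<in> S then g s else 0) = (\<lambda>s. g s * indicator S s)"
    by (auto simp: indicator_def)
  ultimately have "(\<integral>s. (if s \<in> S then g s else 0) \<partial>lebesgue_on \<Omega>)
      = integral {0..1} (\<lambda>s. if s \<in> S then g s else 0)"
    by (simp only: integral_Omega_eq)
  also have "\<dots> = integral S g"
    using S by (simp add: integral_restrict_Int Int_absorb2)
  finally show ?thesis .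
qed

text \<open>As \<open>g\<close> is merely integrable, its primitive need not be differentiable
  everywhere. The identity is instead Fubini on the triangle s \<le> x for
  \<open>g s * \<phi>' x\<close>: integrating over \<open>x\<close> first gives -g \<phi>,
  integrating over \<open>s\<close> first gives the primitive times the derivative.\<close>

lemma integral_by_parts_bump:
  fixes g :: "real \<Rightarrow> real"
  assumes g: "integrable (lebesgue_on \<Omega>) g" and b: "bump \<phi> \<phi>'"
  shows "(\<integral>x. g x * \<phi> x \<partial>lebesgue_on \<Omega>) = - (\<integral>x. integral {0..x} g * \<phi>' x \<partial>lebesgue_on \<Omega>)"
proof -
  let ?L = "lebesgue_on \<Omega>"
  interpret P: pair_sigma_finite ?L ?L ..
  have sm: "smooth \<phi>'" and d: "\<And>x. (\<phi> has_real_derivative \<phi>' x) (at x)"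
    using b by (auto simp: bump_def)
  have c': "continuous_on A \<phi>'" for A by (rule smooth_continuous[OF sm])
  obtain B where B: "\<forall>x\<in>{0..1}. \<bar>\<phi>' x\<bar> \<le> B" using continuous_bounded_unit[OF c'] .
  have B0: "0 \<le> B" using B by force
  have [measurable]: "g \<in> borel_measurable ?L" using g by (rule borel_measurable_integrable)
  have [measurable]: "\<phi>' \<in> borel_measurable ?L"
    by (intro borel_measurable_lebesgue_on borel_measurable_continuous_onI c')
  have [measurable]: "(\<lambda>x. x) \<in> borel_measurable ?L" by (rule borel_measurable_lebesgue_on) simp
  let ?H = "\<lambda>(s, x). (if s \<le> x then g s * \<phi>' x else 0)"
  have mH: "?H \<in> borel_measurable (?L \<Otimes>\<^sub>M ?L)" by measurable
  have "integrable (?L \<Otimes>\<^sub>M ?L) (\<lambda>(s, x). B * \<bar>g s\<bar>)"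
    by (rule P.Fubini_integrable) (use g B0 in \<open>auto simp: measure_Omega abs_mult\<close>)
  then have H: "integrable (?L \<Otimes>\<^sub>M ?L) ?H"
    by (rule Bochner_Integration.integrable_bound[OF _ mH])
      (use B B0 in \<open>auto intro!: AE_I2 simp: space_pair_measure abs_mult mult.commute[of B] intro!: mult_left_mono\<close>)
  have i': "integrable ?L \<phi>'" by (intro integrable_Omega_continuous c')
  have 1: "(\<integral>x. (if s \<le> x then g s * \<phi>' x else 0) \<partial>?L) = - (g s * \<phi> s)" if s: "s \<in> \<Omega>" for s
  proof -
    have "(\<phi>' has_integral (\<phi> 1 - \<phi> s)) {s..1}"
      using s d by (intro fundamental_theorem_of_calculus)
        (auto simp: has_real_derivative_iff_has_vector_derivative[symmetric] intro: has_field_derivative_at_within)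
    then have "integral {s..1} \<phi>' = - \<phi> s" using bump_props(5)[OF b] by (simp add: integral_unique)
    moreover have "(\<integral>x. (if s \<le> x then g s * \<phi>' x else 0) \<partial>?L) = (\<integral>x. g s * (if x \<in> {s..1} then \<phi>' x else 0) \<partial>?L)"
      by (rule Bochner_Integration.integral_cong) auto
    ultimately show ?thesis using integral_Omega_if[OF i', of "{s..1}"] s by simp
  qed
  have 2: "(\<integral>s. (if s \<le> x then g s * \<phi>' x else 0) \<partial>?L) = integral {0..x} g * \<phi>' x" if x: "x \<in> \<Omega>" for x
  proof -
    have "(\<integral>s. (if s \<le> x then g s * \<phi>' x else 0) \<partial>?L) = (\<integral>s. (if s \<in> {0..x} then g s else 0) * \<phi>' x \<partial>?L)"
      by (rule Bochner_Integration.integral_cong) auto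
    then show ?thesis using integral_Omega_if[OF g, of "{0..x}"] x by simp
  qed
  have "(\<integral>s. - (g s * \<phi> s) \<partial>?L) = (\<integral>s. (\<integral>x. (if s \<le> x then g s * \<phi>' x else 0) \<partial>?L) \<partial>?L)"
    by (rule Bochner_Integration.integral_cong[OF refl]) (simp add: 1)
  also have "\<dots> = (\<integral>x. (\<integral>s. (if s \<le> x then g s * \<phi>' x else 0) \<partial>?L) \<partial>?L)"
    using P.Fubini_integral[OF H] by simp
  also have "\<dots> = (\<integral>x. integral {0..x} g * \<phi>' x \<partial>?L)"
    by (rule Bochner_Integration.integral_cong[OF refl]) (simp add: 2)
  finally show ?thesis by simp
qed

text \<open>The zero mean is what makes the primitive vanish again to the right of \<open>b\<close>,
  hence have compact support.\<close>

lemma bump_antiderivative: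
  assumes sm: "smooth h" and ab: "0 < a" "a < b" "b < 1" and z: "\<And>x. x \<notin> {a..b} \<Longrightarrow> h x = 0"
    and i0: "integral {0..1} h = 0"
  obtains \<phi> where "bump \<phi> h"
proof -
  have c: "continuous_on A h" for A by (rule smooth_continuous[OF sm])
  have int: "h integrable_on {x..y}" for x y by (intro integrable_continuous_real c)
  define \<phi> where "\<phi> x = (if x \<in> \<Omega> then integral {0..x} h else 0)" for x
  have "integral {0..x} h = 0" if "x < a" for x
    using that z by (intro integral_unique has_integral_is_0) auto
  moreover have "integral {0..x} h = 0" if "b < x" "x < 1" for x
  proof -
    have "integral {0..x} h + integral {x..1} h = integral {0..1} h"
      using that ab by (intro Henstock_Kurzweil_Integration.integral_combine int) auto
    moreover have "integral {x..1} h = 0"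
      using that z by (intro integral_unique has_integral_is_0) auto
    ultimately show ?thesis using i0 by simp
  qed
  ultimately have \<phi>0: "\<phi> x = 0" if "x \<notin> {a..b}" for x
    using that by (auto simp: \<phi>_def not_le)
  have "(\<phi> has_real_derivative h x) (at x)" for x
  proof (cases "x \<in> \<Omega>")
    case True
    have "((\<lambda>x. integral {0..x} h) has_real_derivative h x) (at x within {0..1})"
      by (rule integral_has_real_derivative) (use True c in auto)
    then have "((\<lambda>x. integral {0..x} h) has_real_derivative h x) (at x)"
      using True by (simp add: at_within_Icc_at)
    then show ?thesis
      by (rule has_field_derivative_transform_within_open[where S = \<Omega>]) (use True in \<open>auto simp: \<phi>_def\<close>)
  next
    case False
    then have x: "x \<notin> {a..b}" using ab by auto
    have "((\<lambda>x. 0) has_real_derivative h x) (at x)" using z[OF x] by simp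
    then show ?thesis
      by (rule has_field_derivative_transform_within_open[where S = "- {a..b}"])
        (use x \<phi>0 in \<open>auto simp: open_Compl\<close>)
  qed
  then have "bump \<phi> h" unfolding bump_def using sm ab \<phi>0 by blast
  then show ?thesis by (rule that)
qed

text \<open>The du Bois-Reymond argument; the hypothesis says f' = -g weakly. The sum of
  \<open>f\<close> and the primitive of \<open>g\<close> is orthogonal to all derivatives of bumps,
  that is, to all smooth compactly supported functions of zero mean. It is therefore orthogonal to
  every cutoff after subtraction of a constant, and cutoffs approximate indicators of
  intervals.\<close>

lemma weak_primitive:
  fixes f g :: "real \<Rightarrow> real"
  assumes f: "integrable (lebesgue_on \<Omega>) f" and g: "integrable (lebesgue_on \<Omega>) g"
    and weak: "\<And>\<phi> \<phi>'. bump \<phi> \<phi>' \<Longrightarrow>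
      (\<integral>x. f x * \<phi>' x \<partial>lebesgue_on \<Omega>) = (\<integral>x. g x * \<phi> x \<partial>lebesgue_on \<Omega>)"
  obtains c where "AE x in lebesgue_on \<Omega>. f x = c - integral {0..x} g"
proof -
  let ?L = "lebesgue_on \<Omega>"
  define k where "k x = f x + integral {0..x} g" for x
  have iG: "integrable ?L (\<lambda>x. integral {0..x} g)"
    by (intro integrable_Omega_continuous continuous_primitive g)
  have ik: "integrable ?L k" unfolding k_def using f iG by simp
  have k0: "(\<integral>x. k x * \<phi>' x \<partial>?L) = 0" if b: "bump \<phi> \<phi>'" for \<phi> \<phi>'
  proof -
    have c: "continuous_on {0..1} \<phi>'" using b by (auto simp: bump_def intro: smooth_continuous)
    show ?thesis
      using weak[OF b] integral_by_parts_bump[OF g b]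
        integrable_Omega_mult_bounded[OF f c] integrable_Omega_mult_bounded[OF iG c]
      by (simp add: k_def distrib_right)
  qed
  \<comment> \<open>Any fixed bump with nonzero integral would do; multiples of it correct the mean
    of the other cutoffs.\<close>
  define \<theta> where "\<theta> = cutoff (1/4) (3/4) 0"
  have sm\<theta>: "smooth \<theta>" unfolding \<theta>_def by (rule smooth_cutoff)
  have c\<theta>: "continuous_on A \<theta>" for A by (rule smooth_continuous[OF sm\<theta>])
  define T where "T = integral {0..1} \<theta>"
  have T: "T \<noteq> 0"
  proof
    assume "T = 0"
    then have "\<theta> (1/2) = 0"
      using integral_eq_0_iff[of 0 1 \<theta>] c\<theta> cutoff_bounds by (auto simp: T_def \<theta>_def)
    then show False using cutoff_inside[of "1/2" "1/4" "3/4" 0] by (simp add: \<theta>_def)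
  qed
  \<comment> \<open>The weighted mean of \<open>k\<close> against \<theta>. Testing with \<psi> -
    (m/T) \<theta>, which has zero mean, shows that the integral of k \<psi> is
    \<open>m * c\<close>, the value for the constant \<open>c\<close>.\<close>
  define c where "c = (\<integral>x. k x * \<theta> x \<partial>?L) / T"
  have kc: "(\<integral>x. (k x - c) * cutoff a b n x \<partial>?L) = 0" if ab: "0 < a" "a < b" "b < 1" for a b n
  proof -
    define \<psi> where "\<psi> = cutoff a b n"
    have sm\<psi>: "smooth \<psi>" unfolding \<psi>_def by (rule smooth_cutoff)
    have c\<psi>: "continuous_on A \<psi>" for A by (rule smooth_continuous[OF sm\<psi>])
    define m where "m = integral {0..1} \<psi>"
    define h where "h x = \<psi> x + (- (m / T)) * \<theta> x" for x
    have sm: "smooth h" unfolding h_def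
      by (intro smooth_add smooth_mult smooth_const sm\<psi> sm\<theta>)
    have z: "h x = 0" if "x \<notin> {min a (1/4)..max b (3/4)}" for x
    proof -
      have "x \<notin> {a<..<b}" "x \<notin> {1/4<..<3/4}" using that by auto
      then show ?thesis by (simp add: h_def \<psi>_def \<theta>_def cutoff_outside)
    qed
    have "integral {0..1} h = m + (- (m / T)) * T"
      unfolding h_def m_def T_def
      by (simp add: Henstock_Kurzweil_Integration.integral_diff integrable_continuous_real c\<psi> c\<theta>
          integrable_on_mult_right)
    then have i0: "integral {0..1} h = 0" using T by simp
    obtain \<phi> where "bump \<phi> h"
      by (rule bump_antiderivative[OF sm _ _ _ z i0]) (use ab in auto)
    then have "(\<integral>x. k x * h x \<partial>?L) = 0" by (rule k0)
    moreover have "(\<integral>x. k x * h x \<partial>?L) = (\<integral>x. k x * \<psi> x - m / T * (k x * \<theta> x) \<partial>?L)"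
      by (rule Bochner_Integration.integral_cong) (auto simp: h_def algebra_simps)
    moreover have "\<dots> = (\<integral>x. k x * \<psi> x \<partial>?L) - m * c"
      using integrable_Omega_mult_bounded[OF ik c\<psi>] integrable_Omega_mult_bounded[OF ik c\<theta>]
      by (simp add: c_def)
    moreover have "(\<integral>x. (k x - c) * \<psi> x \<partial>?L) = (\<integral>x. k x * \<psi> x \<partial>?L) - c * m"
      using integrable_Omega_mult_bounded[OF ik c\<psi>] integrable_Omega_continuous[OF c\<psi>]
      by (simp add: left_diff_distrib m_def integral_Omega_eq)
    ultimately show ?thesis by (simp add: \<psi>_def mult.commute)
  qed
  have "AE x in ?L. k x - c = 0"
  proof (rule AE_0_if_intervals_0)
    show ikc: "integrable ?L (\<lambda>x. k x - c)" using ik by simp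
    fix a b :: real assume ab: "0 < a" "a < b" "b < 1"
    have "(\<lambda>n. \<integral>x. (k x - c) * cutoff a b n x \<partial>?L) \<longlonglongrightarrow> (\<integral>x. (k x - c) * indicator {a<..<b} x \<partial>?L)"
    proof (rule integral_dominated_convergence[where w = "\<lambda>x. \<bar>k x - c\<bar>"])
      show "(\<lambda>x. (k x - c) * indicat_real {a<..<b} x) \<in> borel_measurable ?L"
        by (intro borel_measurable_times borel_measurable_integrable[OF ikc] borel_measurable_lebesgue_on) simp
      show "(\<lambda>x. (k x - c) * cutoff a b n x) \<in> borel_measurable ?L" for n
        by (intro borel_measurable_integrable integrable_Omega_mult_bounded[OF ikc] smooth_continuous smooth_cutoff)
      show "integrable ?L (\<lambda>x. \<bar>k x - c\<bar>)" using ikc by simp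
      show "AE x in ?L. (\<lambda>n. (k x - c) * cutoff a b n x) \<longlonglongrightarrow> (k x - c) * indicat_real {a<..<b} x"
        by (intro AE_I2 tendsto_intros cutoff_tendsto)
      show "AE x in ?L. norm ((k x - c) * cutoff a b n x) \<le> \<bar>k x - c\<bar>" for n
        using cutoff_bounds by (intro AE_I2) (auto simp: abs_mult intro!: mult_left_le)
    qed
    then show "(\<integral>x. (k x - c) * indicator {a<..<b} x \<partial>?L) = 0"
      using kc[OF ab] by (simp add: LIMSEQ_const_iff)
  qed
  then have "AE x in ?L. f x = c - integral {0..x} g"
    by eventually_elim (simp add: k_def)
  then show ?thesis by (rule that)
qed

section \<open>Square-integrable functions and test functions\<close>

lemma L2_integrable:
  assumes "f \<in> L2"
  shows "integrable (lebesgue_on \<Omega>) f" "integrable (lebesgue_on \<Omega>) (\<lambda>x. (f x)\<^sup>2)"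
    "f \<in> borel_measurable (lebesgue_on \<Omega>)"
proof -
  show 1: "integrable (lebesgue_on \<Omega>) (\<lambda>x. (f x)\<^sup>2)" and 2: "f \<in> borel_measurable (lebesgue_on \<Omega>)"
    using assms by (auto simp: L2_def)
  have "integrable (lebesgue_on \<Omega>) (\<lambda>x. 1 + (f x)\<^sup>2)" using 1 by simp
  then show "integrable (lebesgue_on \<Omega>) f"
  proof (rule Bochner_Integration.integrable_bound[OF _ 2])
    have "\<bar>y\<bar> \<le> 1 + y\<^sup>2" for y :: real
      using zero_le_power2[of "\<bar>y\<bar> - 1"] by (simp add: power2_diff)
    then show "AE x in lebesgue_on \<Omega>. norm (f x) \<le> norm (1 + (f x)\<^sup>2)" by simp
  qed
qed

lemma L2_norm_square: "(L2_norm f)\<^sup>2 = (\<integral>x. (f x)\<^sup>2 \<partial>lebesgue_on \<Omega>)"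
  unfolding L2_norm_def L2_inner_def
  by (simp add: power2_eq_square[symmetric])

lemma L2_I: "continuous_on \<Omega> f \<Longrightarrow> (\<And>x. x \<in> \<Omega> \<Longrightarrow> \<bar>f x\<bar> \<le> B) \<Longrightarrow> f \<in> L2"
  unfolding L2_def
  using power_mono[of "\<bar>f _\<bar>" B 2]
  by (auto intro!: continuous_imp_measurable_on_sets_lebesgue continuous_intros
      integrable_Omega_continuous_bounded[where B = "B\<^sup>2"])

lemma L2_diff:
  assumes "f \<in> L2" "g \<in> L2"
  shows "(\<lambda>x. f x - g x) \<in> L2"
proof -
  note f = L2_integrable[OF assms(1)] and g = L2_integrable[OF assms(2)]
  have m: "(\<lambda>x. f x - g x) \<in> borel_measurable (lebesgue_on \<Omega>)"
    using f(3) g(3) by (rule borel_measurable_diff)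
  have "integrable (lebesgue_on \<Omega>) (\<lambda>x. 2 * (f x)\<^sup>2 + 2 * (g x)\<^sup>2)" using f g by simp
  then have "integrable (lebesgue_on \<Omega>) (\<lambda>x. (f x - g x)\<^sup>2)"
  proof (rule Bochner_Integration.integrable_bound[OF _ borel_measurable_power[OF m]])
    have "(a - b)\<^sup>2 \<le> 2 * a\<^sup>2 + 2 * b\<^sup>2" for a b :: real
      using zero_le_power2[of "a + b"] by (simp add: power2_diff power2_sum)
    then show "AE x in lebesgue_on \<Omega>. norm ((f x - g x)\<^sup>2) \<le> norm (2 * (f x)\<^sup>2 + 2 * (g x)\<^sup>2)"
      by (intro AE_I2) simp
  qed
  then show ?thesis using m by (simp add: L2_def)
qed

text \<open>The variance of |f| under a measure of total mass 1 is nonnegative.\<close>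

lemma integral_abs_le_L2_norm:
  assumes "f \<in> L2"
  shows "(\<integral>x. \<bar>f x\<bar> \<partial>lebesgue_on \<Omega>) \<le> L2_norm f"
proof -
  note f = L2_integrable[OF assms]
  define m where "m = (\<integral>x. \<bar>f x\<bar> \<partial>lebesgue_on \<Omega>)"
  have "0 \<le> (\<integral>x. (\<bar>f x\<bar> - m)\<^sup>2 \<partial>lebesgue_on \<Omega>)" by simp
  also have "(\<integral>x. (\<bar>f x\<bar> - m)\<^sup>2 \<partial>lebesgue_on \<Omega>) = (\<integral>x. (f x)\<^sup>2 - 2 * m * \<bar>f x\<bar> + m\<^sup>2 \<partial>lebesgue_on \<Omega>)"
    by (rule Bochner_Integration.integral_cong) (auto simp: power2_diff)
  finally have "m\<^sup>2 \<le> (\<integral>x. (f x)\<^sup>2 \<partial>lebesgue_on \<Omega>)"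
    using f by (simp add: measure_Omega m_def[symmetric] power2_eq_square)
  then have "m\<^sup>2 \<le> (L2_norm f)\<^sup>2" by (simp only: L2_norm_square)
  then show ?thesis unfolding m_def[symmetric]
    by (rule power2_le_imp_le) (simp add: L2_norm_def L2_inner_def)
qed

lemma test_function_primitive:
  assumes "\<phi> \<in> test_functions"
  shows "nderiv_on 1 \<Omega> \<phi> \<in> L2" "\<phi> \<in> L2"
    "\<And>x. x \<in> \<Omega> \<Longrightarrow> \<phi> x = integral {0..x} (nderiv_on 1 \<Omega> \<phi>)"
    "integral {0..1} (nderiv_on 1 \<Omega> \<phi>) = 0"
proof -
  let ?d = "nderiv_on 1 \<Omega> \<phi>"
  obtain K where K: "compact K" "K \<subseteq> \<Omega>" "\<And>x. x \<in> \<Omega> - K \<Longrightarrow> \<phi> x = 0"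
    and C: "\<And>k. Ck_on k \<Omega> \<phi>" using assms unfolding test_functions_def by blast
  have "\<phi> differentiable_on \<Omega>" and cd: "continuous_on \<Omega> ?d"
    using C[of 1] by (auto simp: Ck_on_def)
  then have d: "(\<phi> has_real_derivative ?d x) (at x)" if x: "x \<in> \<Omega>" for x
  proof -
    have "\<phi> differentiable at x within \<Omega>" using \<open>\<phi> differentiable_on \<Omega>\<close> x by (simp add: differentiable_on_def)
    then have "\<phi> differentiable at x" using x by (simp add: at_within_open[of x \<Omega>])
    then obtain D where D: "(\<phi> has_real_derivative D) (at x)" by (auto simp: real_differentiable_def)
    moreover have "?d x = D" using x D by (intro nderiv_on_1) auto
    ultimately show ?thesis by simp
  qed
  have oK: "open (- K)" using K(1) by (simp add: compact_imp_closed open_Compl)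
  have dK: "?d x = 0" if x: "x \<in> \<Omega> - K" for x
  proof (rule nderiv_on_1)
    have "((\<lambda>x. 0) has_real_derivative 0) (at x)" by simp
    then show "(\<phi> has_real_derivative 0) (at x)"
      by (rule has_field_derivative_transform_within_open[where S = "\<Omega> - K"])
        (use x K oK in \<open>auto simp: Diff_eq\<close>)
  qed (use x in auto)
  have bounded: "\<exists>B. \<forall>x\<in>\<Omega>. \<bar>g x\<bar> \<le> B" if g: "continuous_on \<Omega> g" "\<And>x. x \<in> \<Omega> - K \<Longrightarrow> g x = 0" for g :: "real \<Rightarrow> real"
  proof -
    have "compact (g ` K)" using g K by (intro compact_continuous_image) (auto intro: continuous_on_subset)
    then obtain B where B: "\<forall>y\<in>g ` K. norm y \<le> B" using compact_imp_bounded bounded_iff by meson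
    have "\<bar>g x\<bar> \<le> max B 0" if "x \<in> \<Omega>" for x
      using B g(2)[of x] that by (cases "x \<in> K") (auto simp: le_max_iff_disj)
    then show ?thesis by blast
  qed
  have c: "continuous_on \<Omega> \<phi>" using d by (meson DERIV_isCont continuous_at_imp_continuous_on)
  obtain B where B: "\<forall>x\<in>\<Omega>. \<bar>?d x\<bar> \<le> B" using bounded[OF cd dK] by blast
  then show "?d \<in> L2" by (intro L2_I[where B = B] cd) auto
  obtain B' where "\<forall>x\<in>\<Omega>. \<bar>\<phi> x\<bar> \<le> B'" using bounded[OF c K(3)] by blast
  then show "\<phi> \<in> L2" by (intro L2_I[where B = B'] c) auto
  \<comment> \<open>Test functions are unconstrained outside \<Omega>, so the fundamental theorem is
    applied to the extension by 0. It is continuous because the support is compact inside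
    \<Omega>.\<close>
  define \<psi> where "\<psi> x = (if x \<in> \<Omega> then \<phi> x else 0)" for x
  have "isCont \<psi> x" for x
  proof (cases "x \<in> \<Omega>")
    case True
    have "isCont \<phi> x" using d[OF True] by (rule DERIV_isCont)
    moreover have "\<forall>\<^sub>F y in nhds x. \<psi> y = \<phi> y"
      using True by (intro eventually_nhds_in_open[THEN eventually_mono, of \<Omega>]) (auto simp: \<psi>_def)
    ultimately show ?thesis using isCont_cong by blast
  next
    case False
    then have "x \<in> - K" using K by auto
    then have "\<forall>\<^sub>F y in nhds x. \<psi> y = 0"
      using oK K(3) by (intro eventually_nhds_in_open[THEN eventually_mono, of "- K"]) (auto simp: \<psi>_def)
    then show ?thesis using isCont_cong[of \<psi> "\<lambda>_. 0" x] by simp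
  qed
  then have c\<psi>: "continuous_on A \<psi>" for A by (simp add: continuous_at_imp_continuous_on)
  have "(?d has_integral (\<psi> y - \<psi> 0)) {0..y}" if "0 \<le> y" "y \<le> 1" for y
  proof (rule fundamental_theorem_of_calculus_interior[OF \<open>0 \<le> y\<close> c\<psi>])
    fix x assume x: "x \<in> {0<..<y}"
    then have "x \<in> \<Omega>" using that by auto
    then have "(\<psi> has_real_derivative ?d x) (at x)"
      by (intro has_field_derivative_transform_within_open[OF d, where S = \<Omega>]) (auto simp: \<psi>_def)
    then show "(\<psi> has_vector_derivative ?d x) (at x)"
      by (simp add: has_real_derivative_iff_has_vector_derivative)
  qed
  note hi = this
  show "\<phi> x = integral {0..x} ?d" if "x \<in> \<Omega>" for x
    using integral_unique[OF hi[of x]] that by (simp add: \<psi>_def)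
  show "integral {0..1} ?d = 0"
    using integral_unique[OF hi[of 1]] by (simp add: \<psi>_def)
qed

lemma L2_inner_cong: "(\<And>x. x \<in> \<Omega> \<Longrightarrow> u x * v x = u' x * v' x) \<Longrightarrow> L2_inner u v = L2_inner u' v'"
  unfolding L2_inner_def by (rule Bochner_Integration.integral_cong) auto

lemma nderiv_on_bump:
  assumes "bump \<phi> \<phi>'" "x \<in> \<Omega>"
  shows "nderiv_on (Suc k) \<Omega> \<phi> x = nderiv_on k \<Omega> \<phi>' x"
  using nderiv_on_cong[of \<Omega> "nderiv_on 1 \<Omega> \<phi>" \<phi>' x k] bump_props(4)[OF assms(1)] assms(2)
    nderiv_on_add[of k 1 \<Omega> \<phi>] by simp

text \<open>The derivative of order k+1 of \<phi> is the one of order k of \<phi>'. Testing the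
  identity of order k with \<phi>' and that of order k+1 with \<phi> therefore shows that
  \<open>g\<close> is the first weak derivative of \<open>f\<close>.\<close>

lemma weak_deriv_shift:
  assumes f: "has_weak_deriv k u f" and g: "has_weak_deriv (Suc k) u g" and b: "bump \<phi> \<phi>'"
  shows "L2_inner f \<phi>' = - L2_inner g \<phi>"
proof -
  have "L2_inner u (nderiv_on (Suc k) \<Omega> \<phi>) = L2_inner u (nderiv_on k \<Omega> \<phi>')"
    by (rule L2_inner_cong) (simp add: nderiv_on_bump[OF b])
  moreover have "L2_inner u (nderiv_on k \<Omega> \<phi>') = (-1) ^ k * L2_inner f \<phi>'"
    using f bump_props(3)[OF b] by (simp add: has_weak_deriv_def)
  moreover have "L2_inner u (nderiv_on (Suc k) \<Omega> \<phi>) = (-1) ^ Suc k * L2_inner g \<phi>"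
    using g bump_props(2)[OF b] unfolding has_weak_deriv_def by blast
  ultimately have "(-1) ^ k * (L2_inner f \<phi>' + L2_inner g \<phi>) = 0" by (simp add: distrib_left)
  then show ?thesis by simp
qed

text \<open>The third weak derivative turns f, and then the first weak derivative turns into a
  primitive of f; both gain continuous representatives by \<open>weak_primitive\<close>. Boundary
  values come from the approximating test functions: they are primitives of their derivatives, so
  convergence of the derivatives in \<open>L2\<close> makes them converge uniformly to
  \<open>U\<close>, while their \<open>L2\<close> limit is the given solution.\<close>

lemma weak_solution_regular:
  assumes sol: "dirichlet_solution f u\<^sub>0" and reg: "u\<^sub>0 \<in> Sobolev_H 4"
  obtains U U' F where
    "AE x in lebesgue_on \<Omega>. u\<^sub>0 x = U x" "AE x in lebesgue_on \<Omega>. f x = F x"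
    "continuous_on {0..1} U" "continuous_on {0..1} U'" "continuous_on {0..1} F"
    "\<And>x. x \<in> \<Omega> \<Longrightarrow> (U has_real_derivative U' x) (at x)"
    "\<And>x. x \<in> \<Omega> \<Longrightarrow> (U' has_real_derivative - F x) (at x)"
    "U 0 = 0" "U 1 = 0"
proof -
  let ?L = "lebesgue_on \<Omega>"
  have w2: "has_weak_deriv 2 u\<^sub>0 (\<lambda>x. - f x)" and H10: "u\<^sub>0 \<in> Sobolev_H10"
    using sol by (auto simp: dirichlet_solution_def)
  obtain g\<^sub>3 where w3: "has_weak_deriv 3 u\<^sub>0 g\<^sub>3"
    using reg by (auto simp: Sobolev_H_def dest!: spec[of _ 3])
  obtain g \<phi> where w1: "has_weak_deriv 1 u\<^sub>0 g" and \<phi>: "\<And>n::nat. \<phi> n \<in> test_functions"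
    and lim: "(\<lambda>n. L2_norm (\<lambda>x. \<phi> n x - u\<^sub>0 x)) \<longlonglongrightarrow> 0"
    and lim': "(\<lambda>n. L2_norm (\<lambda>x. nderiv_on 1 \<Omega> (\<phi> n) x - g x)) \<longlonglongrightarrow> 0"
    using H10 unfolding Sobolev_H10_def by blast
  have L2: "u\<^sub>0 \<in> L2" "g \<in> L2" "(\<lambda>x. - f x) \<in> L2" "g\<^sub>3 \<in> L2"
    using w1 w2 w3 by (auto simp: has_weak_deriv_def)
  have if': "integrable ?L f" using L2_integrable(1)[OF L2(3)] by simp
  obtain c\<^sub>1 where c1: "AE x in ?L. f x = c\<^sub>1 - integral {0..x} g\<^sub>3"
  proof (rule weak_primitive[OF if' L2_integrable(1)[OF L2(4)]])
    \<comment> \<open>The second weak derivative is -f, so the third one is -f'; this is the sign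
      convention of \<open>weak_primitive\<close>.\<close>
    fix \<psi> \<psi>' assume b: "bump \<psi> \<psi>'"
    have "has_weak_deriv (Suc 2) u\<^sub>0 g\<^sub>3" using w3 by (simp add: eval_nat_numeral)
    from weak_deriv_shift[OF w2 this b]
    show "(\<integral>x. f x * \<psi>' x \<partial>?L) = (\<integral>x. g\<^sub>3 x * \<psi> x \<partial>?L)" by (simp add: L2_inner_def)
  qed
  define F where "F x = c\<^sub>1 - integral {0..x} g\<^sub>3" for x
  have fF: "AE x in ?L. f x = F x" using c1 by (simp add: F_def)
  have cF: "continuous_on {0..1} F" unfolding F_def
    by (intro continuous_intros continuous_primitive L2_integrable L2)
  obtain c\<^sub>2 where c2: "AE x in ?L. g x = c\<^sub>2 - integral {0..x} f"
  proof (rule weak_primitive[OF L2_integrable(1)[OF L2(2)] if'])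
    fix \<psi> \<psi>' assume b: "bump \<psi> \<psi>'"
    have "has_weak_deriv (Suc 1) u\<^sub>0 (\<lambda>x. - f x)" using w2 by (simp add: eval_nat_numeral)
    from weak_deriv_shift[OF w1 this b]
    show "(\<integral>x. g x * \<psi>' x \<partial>?L) = (\<integral>x. f x * \<psi> x \<partial>?L)" by (simp add: L2_inner_def)
  qed
  have int_AE: "integral {0..x} a = integral {0..x} b"
    if "AE x in ?L. a x = b x" "integrable ?L a" "integrable ?L b" "x \<in> {0..1}" for a b :: "real \<Rightarrow> real" and x
  proof -
    have "integral {0..x} a = (\<integral>s. (if s \<in> {0..x} then a s else 0) \<partial>?L)"
      using that by (intro integral_Omega_if[symmetric]) auto
    also have "\<dots> = (\<integral>s. (if s \<in> {0..x} then b s else 0) \<partial>?L)"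
    proof (rule integral_cong_AE)
      have "(\<lambda>s. if s \<in> {0..x} then h s else 0) \<in> borel_measurable ?L" if "integrable ?L h" for h :: "real \<Rightarrow> real"
      proof -
        have "(\<lambda>s. h s * indicator {0..x} s) \<in> borel_measurable ?L"
          by (rule borel_measurable_times[OF borel_measurable_integrable[OF that] borel_measurable_lebesgue_on]) simp
        moreover have "(\<lambda>s. if s \<in> {0..x} then h s else 0) = (\<lambda>s. h s * indicator {0..x} s)"
          by (auto simp: indicator_def)
        ultimately show ?thesis by simp
      qed
      then show "(\<lambda>s. if s \<in> {0..x} then a s else 0) \<in> borel_measurable ?L"
        "(\<lambda>s. if s \<in> {0..x} then b s else 0) \<in> borel_measurable ?L" using that by blast+
    qed (use that(1) in \<open>auto elim: eventually_mono\<close>)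
    also have "\<dots> = integral {0..x} b" using that by (intro integral_Omega_if) auto
    finally show ?thesis .
  qed
  \<comment> \<open>Using the continuous \<open>F\<close> instead of \<open>f\<close> makes the
    derivatives valid at every point. The constant in \<open>U\<close> is fixed by U(0) = 0, the
    left boundary value of the approximants extended by zero.\<close>
  define U' where "U' x = c\<^sub>2 - integral {0..x} F" for x
  define U where "U x = integral {0..x} U'" for x
  have iF: "integrable ?L F" by (rule integrable_Omega_continuous[OF cF])
  have cU': "continuous_on {0..1} U'" unfolding U'_def
    by (intro continuous_intros continuous_primitive iF)
  have iU': "integrable ?L U'" by (rule integrable_Omega_continuous[OF cU'])
  have cU: "continuous_on {0..1} U" unfolding U_def by (intro continuous_primitive iU')
  have gU': "AE x in ?L. g x = U' x"
  proof -
    have "AE x in ?L. x \<in> \<Omega>" by (rule AE_I2) simp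
    with c2 show ?thesis
    proof eventually_elim
      case (elim x)
      then show ?case using int_AE[OF fF if' iF, of x] by (simp add: U'_def)
    qed
  qed
  have prim: "((\<lambda>x. integral {0..x} h) has_real_derivative h x) (at x)"
    if "continuous_on {0..1} h" "x \<in> \<Omega>" for h x
  proof -
    have "((\<lambda>x. integral {0..x} h) has_real_derivative h x) (at x within {0..1})"
      by (rule integral_has_real_derivative) (use that in auto)
    then show ?thesis using that by (simp add: at_within_Icc_at)
  qed
  have dU: "(U has_real_derivative U' x) (at x)" if "x \<in> \<Omega>" for x
    unfolding U_def by (rule prim[OF cU' that])
  have dU': "(U' has_real_derivative - F x) (at x)" if "x \<in> \<Omega>" for x
    unfolding U'_def using prim[OF cF that] by (auto intro!: derivative_eq_intros)
  define e where "e n = L2_norm (\<lambda>x. nderiv_on 1 \<Omega> (\<phi> n) x - g x)" for n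
  \<comment> \<open>Primitives starting at 0 differ by at most the integral of the absolute
    difference of their integrands, and this is at most the \<open>L2\<close> distance; the bound is
    uniform in \<open>x\<close>.\<close>
  have close: "\<bar>integral {0..x} (nderiv_on 1 \<Omega> (\<phi> n)) - U x\<bar> \<le> e n" if x: "x \<in> {0..1}" for n x
  proof -
    let ?d = "nderiv_on 1 \<Omega> (\<phi> n)"
    note dL2 = test_function_primitive(1)[OF \<phi>[of n]]
    have dg: "(\<lambda>x. ?d x - g x) \<in> L2" by (intro L2_diff dL2 L2)
    have "U x = integral {0..x} g"
      unfolding U_def using int_AE[OF gU' L2_integrable(1)[OF L2(2)] iU' x] by simp
    moreover have "?d integrable_on {0..x}" "g integrable_on {0..x}"
      using integrable_Omega_on_unit[OF L2_integrable(1)[OF dL2]] integrable_Omega_on_unit[OF L2_integrable(1)[OF L2(2)]] x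
      by (auto intro: integrable_on_subinterval)
    ultimately have "integral {0..x} ?d - U x = integral {0..x} (\<lambda>x. ?d x - g x)"
      by (simp add: Henstock_Kurzweil_Integration.integral_diff)
    also have "\<dots> = (\<integral>s. (if s \<in> {0..x} then ?d s - g s else 0) \<partial>?L)"
      using x by (intro integral_Omega_if[symmetric] L2_integrable(1)[OF dg]) auto
    finally have eq: "integral {0..x} ?d - U x = (\<integral>s. (if s \<in> {0..x} then ?d s - g s else 0) \<partial>?L)" .
    have "\<bar>integral {0..x} ?d - U x\<bar> \<le> (\<integral>s. \<bar>?d s - g s\<bar> \<partial>?L)"
      unfolding eq
    proof (rule order_trans[OF integral_abs_bound integral_mono'])
      show "integrable ?L (\<lambda>s. \<bar>?d s - g s\<bar>)" using L2_integrable(1)[OF dg] by simp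
    qed auto
    then show ?thesis using integral_abs_le_L2_norm[OF dg] by (simp add: e_def)
  qed
  have U0: "U 0 = 0" by (simp add: U_def)
  have U1: "U 1 = 0"
  proof -
    have "\<bar>U 1\<bar> \<le> e n" for n using close[of 1 n] test_function_primitive(4)[OF \<phi>[of n]] by simp
    then have "\<bar>U 1\<bar> \<le> 0" using lim' unfolding e_def by (intro LIMSEQ_le_const) auto
    then show ?thesis by simp
  qed
  have "AE x in ?L. u\<^sub>0 x = U x"
  proof -
    have UL2: "U \<in> L2"
    proof -
      obtain B where "\<forall>x\<in>{0..1}. \<bar>U x\<bar> \<le> B" using continuous_bounded_unit[OF cU] .
      then show ?thesis by (intro L2_I[where B = B] continuous_on_subset[OF cU]) auto
    qed
    have iD: "integrable ?L (\<lambda>x. (u\<^sub>0 x - U x)\<^sup>2)" by (intro L2_integrable L2_diff L2 UL2)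
    define I where "I = (\<integral>x. (u\<^sub>0 x - U x)\<^sup>2 \<partial>?L)"
    define e' where "e' n = L2_norm (\<lambda>x. \<phi> n x - u\<^sub>0 x)" for n
    have le: "I \<le> 2 * (e' n)\<^sup>2 + 2 * (e n)\<^sup>2" for n
    proof -
      have i: "integrable ?L (\<lambda>x. (\<phi> n x - u\<^sub>0 x)\<^sup>2)"
        by (intro L2_integrable L2_diff L2 test_function_primitive(2) \<phi>)
      have "I \<le> (\<integral>x. 2 * (\<phi> n x - u\<^sub>0 x)\<^sup>2 + 2 * (e n)\<^sup>2 \<partial>?L)"
        unfolding I_def
      proof (rule integral_mono[OF iD])
        show "integrable ?L (\<lambda>x. 2 * (\<phi> n x - u\<^sub>0 x)\<^sup>2 + 2 * (e n)\<^sup>2)" using i by simp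
        fix x assume "x \<in> space ?L"
        then have x: "x \<in> \<Omega>" by simp
        then have "\<bar>\<phi> n x - U x\<bar> \<le> e n"
          using close[of x n] test_function_primitive(3)[OF \<phi>[of n] x] by simp
        then have "(\<phi> n x - U x)\<^sup>2 \<le> (e n)\<^sup>2" using power_mono[of "\<bar>\<phi> n x - U x\<bar>" "e n" 2] by simp
        moreover have "(a - c)\<^sup>2 \<le> 2 * (b - a)\<^sup>2 + 2 * (b - c)\<^sup>2" for a b c :: real
          using zero_le_power2[of "(b - a) + (b - c)"] by (simp add: power2_eq_square algebra_simps)
        note this[of "u\<^sub>0 x" "U x" "\<phi> n x"]
        ultimately show "(u\<^sub>0 x - U x)\<^sup>2 \<le> 2 * (\<phi> n x - u\<^sub>0 x)\<^sup>2 + 2 * (e n)\<^sup>2" by linarith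
      qed
      then show ?thesis using i by (simp add: measure_Omega e'_def L2_norm_square)
    qed
    have "(\<lambda>n. 2 * (e' n)\<^sup>2 + 2 * (e n)\<^sup>2) \<longlonglongrightarrow> 2 * 0\<^sup>2 + 2 * 0\<^sup>2"
      unfolding e_def e'_def by (intro tendsto_intros lim lim')
    then have "I \<le> 2 * 0\<^sup>2 + 2 * 0\<^sup>2" using le by (intro LIMSEQ_le_const) auto
    moreover have "0 \<le> I" unfolding I_def by simp
    ultimately have "I = 0" by simp
    then have "AE x in ?L. (u\<^sub>0 x - U x)\<^sup>2 = 0"
      unfolding I_def using integral_nonneg_eq_0_iff_AE[OF iD] by simp
    then show ?thesis by simp
  qed
  then show ?thesis using fF cU cU' cF dU dU' U0 U1 by (rule that)
qed

section \<open>Finite elements\<close>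

lemma fe_space_diff:
  assumes "u \<in> fe_space N" "v \<in> fe_space N"
  shows "(\<lambda>x. u x - v x) \<in> fe_space N"
  unfolding fe_space_def
proof (intro CollectI conjI ballI)
  fix i assume i: "i \<in> {1..N}"
  let ?I = "{(real i - 1) * (1 / real N)<..real i * (1 / real N)}"
  obtain a b where "\<forall>x\<in>?I. u x = a + b * x" using assms(1) i by (force simp: fe_space_def)
  moreover obtain a' b' where "\<forall>x\<in>?I. v x = a' + b' * x" using assms(2) i by (force simp: fe_space_def)
  ultimately have "\<forall>x\<in>?I. u x - v x = (a - a') + (b - b') * x" by (simp add: algebra_simps)
  then show "\<exists>a b. \<forall>x\<in>?I. u x - v x = a + b * x" by blast
qed (use assms in \<open>auto simp: fe_space_def intro: continuous_intros\<close>)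

text \<open>Cells are open on the left and closed on the right, so the ceiling of N x numbers them
  from 1. Off the nodes \<open>x\<close> is interior to its cell, which differentiation
  requires.\<close>

lemma cell_exists:
  assumes N: "1 \<le> N" and x: "x \<in> \<Omega>" "x \<notin> (\<lambda>i. real i / real N) ` {..N}"
  defines "i \<equiv> nat \<lceil>real N * x\<rceil>"
  shows "i \<in> {1..N}" "(real i - 1) / real N < x" "x < real i / real N"
proof -
  have pos: "0 < real N * x" using N x by simp
  then have c: "0 < \<lceil>real N * x\<rceil>" by (simp add: zero_less_ceiling)
  then have ri: "real i = of_int \<lceil>real N * x\<rceil>" by (simp add: i_def)
  have "real N * x \<le> real N" using x by (simp add: mult_left_le)
  then have "\<lceil>real N * x\<rceil> \<le> int N" by (simp add: ceiling_le_iff)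
  then have "i \<le> N" unfolding i_def by (simp only: nat_le_iff)
  moreover have "0 < i" using c by (simp only: i_def zero_less_nat_eq)
  ultimately show i: "i \<in> {1..N}" by simp
  have 1: "real i - 1 < real N * x" "real N * x \<le> real i" unfolding ri by linarith+
  then show "(real i - 1) / real N < x" using N by (simp add: divide_less_eq mult.commute)
  have "x \<le> real i / real N" using 1 N by (simp add: le_divide_eq mult.commute)
  moreover have "x \<noteq> real i / real N" using x(2) i by auto
  ultimately show "x < real i / real N" by simp
qed

lemma fe_space_derivative:
  assumes v: "v \<in> fe_space N" and N: "1 \<le> N"
  obtains v' L S where "finite S" "v' \<in> borel_measurable borel" "\<And>x. \<bar>v' x\<bar> \<le> L"
    "\<And>x. x \<in> \<Omega> - S \<Longrightarrow> (v has_real_derivative v' x) (at x)"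
proof -
  have "\<forall>i\<in>{1..N}. \<exists>b a. \<forall>x\<in>{(real i - 1) / real N<..real i / real N}. v x = a + b * x"
    using v by (simp add: fe_space_def) blast
  then obtain b where b: "\<forall>i\<in>{1..N}. \<exists>a. \<forall>x\<in>{(real i - 1) / real N<..real i / real N}. v x = a + b i * x"
    by (rule bchoice[THEN exE])
  \<comment> \<open>Slopes of nonexistent cells are set to 0, so \<open>v'\<close> is Borel and
    bounded on the whole line, as \<open>consistency\<close> asks. Its bound is the crude sum of all
    slopes and enters no error estimate.\<close>
  define b' where "b' i = (if i \<in> {1..N} then b i else 0)" for i
  define v' where "v' x = b' (nat \<lceil>real N * x\<rceil>)" for x :: real
  show thesis
  proof (rule that[of "(\<lambda>i. real i / real N) ` {..N}" v' "\<Sum>i\<in>{1..N}. \<bar>b i\<bar>"])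
    show "v' \<in> borel_measurable borel" unfolding v'_def by measurable
    show "\<bar>v' x\<bar> \<le> (\<Sum>i\<in>{1..N}. \<bar>b i\<bar>)" for x
      unfolding v'_def b'_def
      by (auto intro!: member_le_sum[where f = "\<lambda>i. \<bar>b i\<bar>"] sum_nonneg simp del: One_nat_def)
    fix x assume x: "x \<in> \<Omega> - (\<lambda>i. real i / real N) ` {..N}"
    define i where "i = nat \<lceil>real N * x\<rceil>"
    have i: "i \<in> {1..N}" "(real i - 1) / real N < x" "x < real i / real N"
      using cell_exists[OF N, of x] x by (auto simp: i_def)
    obtain a where a: "\<forall>x\<in>{(real i - 1) / real N<..real i / real N}. v x = a + b i * x"
      using b i(1) by blast
    have "((\<lambda>x. a + b i * x) has_real_derivative b i) (at x)" by (auto intro!: derivative_eq_intros)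
    then have "(v has_real_derivative b i) (at x)"
      by (rule has_field_derivative_transform_within_open[where S = "{(real i - 1) / real N<..<real i / real N}"])
        (use i a in auto)
    moreover have "v' x = b i" using i(1) unfolding v'_def b'_def i_def[symmetric] by simp
    ultimately show "(v has_real_derivative v' x) (at x)" by simp
  qed simp
qed

text \<open>The constant depends on \<open>v\<close> and on the mesh. It secures integrability of
  the quotients and never appears in a final bound.\<close>

lemma fe_space_lipschitz:
  assumes v: "v \<in> fe_space N" and N: "1 \<le> N"
  obtains L where "\<And>x y. x \<in> {0..1} \<Longrightarrow> y \<in> {0..1} \<Longrightarrow> \<bar>v x - v y\<bar> \<le> L * \<bar>x - y\<bar>"
proof -
  obtain v' L S where *: "finite S" "\<And>x. \<bar>v' x\<bar> \<le> L" "\<And>x. x \<in> \<Omega> - S \<Longrightarrow> (v has_real_derivative v' x) (at x)"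
    using fe_space_derivative[OF v N] by metis
  have "continuous_on {0..1} v" using v by (simp add: fe_space_def)
  moreover have "0 \<le> L" using *(2)[of 0] by linarith
  ultimately have "\<bar>v x - v y\<bar> \<le> L * \<bar>x - y\<bar>" if "x \<in> {0..1}" "y \<in> {0..1}" for x y
    using * that by (intro lipschitz_on_unit_off_finite[where S = S and f' = v']) auto
  then show ?thesis by (rule that)
qed

text \<open>On each cell the slope of the nodal interpolant is, by the mean value theorem, a value
  of \<open>U'\<close> in the same cell. The derivative of the error is thus at most
  \<open>M\<close> times the cell length off the nodes, and the Lipschitz bound follows by
  integration.\<close>

lemma fe_interpolation:
  assumes N: "1 \<le> N" and U: "continuous_on {0..1} U" "U 0 = 0" "U 1 = 0"
    and U': "continuous_on {0..1} U'" "\<And>x. x \<in> \<Omega> \<Longrightarrow> (U has_real_derivative U' x) (at x)"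
    and U'': "\<And>x. x \<in> \<Omega> \<Longrightarrow> (U' has_real_derivative U'' x) (at x)" "\<And>x. x \<in> \<Omega> \<Longrightarrow> \<bar>U'' x\<bar> \<le> M"
  obtains w where "w \<in> fe_space N"
    "\<And>x y. x \<in> {0..1} \<Longrightarrow> y \<in> {0..1} \<Longrightarrow> \<bar>(U x - w x) - (U y - w y)\<bar> \<le> M * (1 / real N) * \<bar>x - y\<bar>"
proof -
  have N0: "0 < real N" using N by simp
  have M0: "0 \<le> M" using U''(2)[of "1/2"] by simp
  define s where "s i = real N * (U (real (Suc i) / real N) - U (real i / real N))" for i
  \<comment> \<open>The interpolant is a sum of clamped ramps: summand \<open>i\<close> is 0 before
    cell \<open>i\<close>, rises with slope \<open>s i\<close> across it and stays constant
    afterwards. Continuity is then immediate, and the value at 1 telescopes to U(1) - U(0).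
    \<open>C i\<close> below collects the completed ramps and the offset of the current one.\<close>
  define w where "w x = (\<Sum>i<N. s i * max 0 (min (x - real i / real N) (1 / real N)))" for x
  define C where "C i = (\<Sum>k<N. if k < i then s k * (1 / real N) else 0) - s i * (real i / real N)" for i
  have clamp0: "max 0 (min y (1 / real N)) = 0" if "y \<le> 0" for y :: real
  proof -
    have "y \<le> 1 / real N" using divide_pos_pos[OF zero_less_one N0] that by linarith
    then show ?thesis using that by (simp only: min_absorb1 max_absorb1)
  qed
  have cell: "w x = C i + s i * x" if i: "i < N" and x: "x \<in> {real i / real N<..real (Suc i) / real N}" for i x
  proof -
    have "s k * max 0 (min (x - real k / real N) (1 / real N))
      = (if k < i then s k * (1 / real N) else 0) + (if k = i then s i * (x - real i / real N) else 0)" for k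
    proof (cases k i rule: linorder_cases)
      case less
      then have "real (Suc k) / real N \<le> real i / real N" using N0 by (intro divide_right_mono) auto
      then have "1 / real N \<le> x - real k / real N" using x by (auto simp: add_divide_distrib)
      then show ?thesis using less N0 by (simp add: min_absorb2)
    next
      case equal
      have "x - real i / real N \<le> 1 / real N" using x by (auto simp: add_divide_distrib)
      then show ?thesis using equal x by (simp add: min_absorb1)
    next
      case greater
      then have "real (Suc i) / real N \<le> real k / real N" using N0 by (intro divide_right_mono) auto
      then have "x - real k / real N \<le> 0" using x by auto
      then have "max 0 (min (x - real k / real N) (1 / real N)) = 0" by (rule clamp0)
      then show ?thesis using greater by simp
    qed
    then show ?thesis
      using i unfolding w_def C_def by (simp add: sum.distrib algebra_simps)
  qed
  have cw: "continuous_on A w" for A unfolding w_def by (intro continuous_intros)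
  have fe: "w \<in> fe_space N"
    unfolding fe_space_def
  proof (intro CollectI conjI ballI)
    show "continuous_on {0..1} w" by (rule cw)
    show "w 0 = 0" unfolding w_def by (intro sum.neutral ballI) (simp only: clamp0 diff_0 neg_le_0_iff_le of_nat_0_le_iff divide_nonneg_nonneg mult_zero_right)
    have "1 / real N \<le> 1 - real i / real N" if "i < N" for i
    proof -
      have "real (Suc i) / real N \<le> real N / real N" using that N0 by (intro divide_right_mono) auto
      then show ?thesis using N0 by (simp add: add_divide_distrib)
    qed
    then have "w 1 = (\<Sum>i<N. s i * (1 / real N))"
      unfolding w_def using N0 by (intro sum.cong) (auto simp: min_absorb2)
    also have "\<dots> = (\<Sum>i<N. U (real (Suc i) / real N) - U (real i / real N))"
      unfolding s_def using N0 by simp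
    also have "\<dots> = U (real N / real N) - U (real 0 / real N)"
      by (rule sum_lessThan_telescope[of "\<lambda>i. U (real i / real N)"])
    finally show "w 1 = 0" using U N0 by simp
    fix i assume i: "i \<in> {1..N}"
    \<comment> \<open>\<open>fe_space\<close> numbers the cells from 1, \<open>cell\<close> from
      0.\<close>
    have "w x = C (i - 1) + s (i - 1) * x" if "x \<in> {(real i - 1) * (1 / real N)<..real i * (1 / real N)}" for x
      using i that by (intro cell) (auto simp: of_nat_diff)
    then show "\<exists>a b. \<forall>x\<in>{(real i - 1) * (1 / real N)<..real i * (1 / real N)}. w x = a + b * x" by blast
  qed
  define S where "S = (\<lambda>i. real i / real N) ` {..N}"
  define w' where "w' x = s (nat \<lceil>real N * x\<rceil> - 1)" for x
  have der: "((\<lambda>x. U x - w x) has_real_derivative U' x - w' x) (at x) \<and> \<bar>U' x - w' x\<bar> \<le> M * (1 / real N)"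
    if x: "x \<in> \<Omega> - S" for x
  proof -
    define j where "j = nat \<lceil>real N * x\<rceil>"
    have j: "j \<in> {1..N}" "(real j - 1) / real N < x" "x < real j / real N"
      using cell_exists[OF N, of x] x by (auto simp: j_def S_def)
    define i where "i = j - 1"
    have i: "i < N" "real i / real N < x" "x < real (Suc i) / real N" "w' x = s i"
      using j unfolding i_def w'_def j_def[symmetric] by (auto simp: of_nat_diff)
    have "((\<lambda>x. C i + s i * x) has_real_derivative s i) (at x)" by (auto intro!: derivative_eq_intros)
    then have dw: "(w has_real_derivative s i) (at x)"
      by (rule has_field_derivative_transform_within_open[where S = "{real i / real N<..<real (Suc i) / real N}"])
        (use i cell[OF i(1)] in auto)
    have le1: "real (Suc i) / real N \<le> 1" using i(1) N0 by (simp add: divide_le_eq)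
    have ge0: "0 \<le> real i / real N" using N0 by simp
    have "\<exists>l z. real i / real N < z \<and> z < real (Suc i) / real N \<and> (U has_real_derivative l) (at z)
        \<and> U (real (Suc i) / real N) - U (real i / real N) = (real (Suc i) / real N - real i / real N) * l"
    proof (rule MVT)
      show "real i / real N < real (Suc i) / real N" using N0 by (simp add: divide_strict_right_mono)
      show "continuous_on {real i / real N..real (Suc i) / real N} U"
        by (rule continuous_on_subset[OF U(1)]) (use le1 ge0 in auto)
      fix z assume z: "real i / real N < z" "z < real (Suc i) / real N"
      then have "z \<in> \<Omega>" using le1 ge0 by (simp only: greaterThanLessThan_iff) linarith
      then show "U differentiable (at z)" using U'(2) by (auto simp: real_differentiable_def)
    qed
    then obtain l z where z: "real i / real N < z" "z < real (Suc i) / real N"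
      and l: "(U has_real_derivative l) (at z)"
      and eq: "U (real (Suc i) / real N) - U (real i / real N) = (real (Suc i) / real N - real i / real N) * l"
      by blast
    have z\<Omega>: "z \<in> \<Omega>" using z le1 ge0 by (simp only: greaterThanLessThan_iff) linarith
    have "s i = l" unfolding s_def eq using N0 by (simp add: field_simps)
    also have "l = U' z" using DERIV_unique[OF l U'(2)[OF z\<Omega>]] .
    finally have si: "s i = U' z" .
    have "\<bar>U' x - U' z\<bar> \<le> M * \<bar>x - z\<bar>"
      by (rule lipschitz_on_unit_off_finite[where S = "{}" and f' = U'']) (use U' U'' M0 x z\<Omega> in auto)
    also have "\<bar>x - z\<bar> \<le> 1 / real N"
      using i z by (auto simp: add_divide_distrib abs_le_iff)
    finally have "\<bar>U' x - w' x\<bar> \<le> M * (1 / real N)" using i si M0 by (simp add: mult_left_mono)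
    moreover have "((\<lambda>x. U x - w x) has_real_derivative U' x - w' x) (at x)"
      using x dw U'(2)[of x] i by (auto intro!: derivative_intros)
    ultimately show ?thesis by blast
  qed
  have "\<bar>(U x - w x) - (U y - w y)\<bar> \<le> M * (1 / real N) * \<bar>x - y\<bar>" if "x \<in> {0..1}" "y \<in> {0..1}" for x y
    by (rule lipschitz_on_unit_off_finite[where S = S and f' = "\<lambda>x. U' x - w' x"])
      (use that der M0 N0 U cw in \<open>auto simp: S_def intro!: continuous_intros\<close>)
  then show ?thesis using fe by (intro that)
qed

section \<open>Bounds on the horizon function\<close>

lemma Ck_on_deriv:
  assumes "Ck_on k S f" "j < k" "x \<in> interior S"
  shows "(nderiv_on j S f has_real_derivative nderiv_on (Suc j) S f x) (at x)"
proof -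
  have x: "x \<in> S" using assms(3) interior_subset by blast
  have "nderiv_on j S f differentiable at x within S"
    using assms x by (auto simp: Ck_on_def differentiable_on_def)
  then have "(nderiv_on j S f has_vector_derivative nderiv_on (Suc j) S f x) (at x within S)"
    unfolding nderiv_on_Suc using vector_derivative_works by blast
  then show ?thesis
    using at_within_interior[OF assms(3)] by (simp add: has_real_derivative_iff_has_vector_derivative)
qed

lemma Ck_on_continuous:
  assumes "Ck_on k S f" "j \<le> k"
  shows "continuous_on S (nderiv_on j S f)"
  using assms by (cases "j = k") (auto simp: Ck_on_def intro: differentiable_imp_continuous_on)

lemma bdist_eq: "bdist x = min \<bar>x\<bar> \<bar>x - 1\<bar>"
proof -
  have "frontier \<Omega> = {0} \<union> {1::real}" by (auto simp: frontier_def)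
  then have "bdist x = infdist x ({0} \<union> {1})" by (simp add: bdist_def)
  also have "\<dots> = min (infdist x {0}) (infdist x {1})" by (rule infdist_Un_min) auto
  finally show ?thesis by (simp add: dist_real_def)
qed

context localization_pair
begin

definition "q\<^sub>1 = nderiv_on 1 {0..} q"
definition "q\<^sub>2 = nderiv_on 2 {0..} q"
definition "lam\<^sub>1 = nderiv_on 1 \<Omega> lam"
definition "lam\<^sub>2 = nderiv_on 2 \<Omega> lam"

lemma q_has_deriv: "0 < r \<Longrightarrow> (q has_real_derivative q\<^sub>1 r) (at r)"
  using Ck_on_deriv[OF q_C3, of 0 r] by (simp add: q\<^sub>1_def interior_Ici[of "0 - 1"])

lemma q1_has_deriv: "0 < r \<Longrightarrow> (q\<^sub>1 has_real_derivative q\<^sub>2 r) (at r)"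
  using Ck_on_deriv[OF q_C3, of 1 r] by (simp add: q\<^sub>1_def q\<^sub>2_def interior_Ici[of "0 - 1"] eval_nat_numeral)

lemma q_cont: "continuous_on {0..} q" and q1_cont: "continuous_on {0..} q\<^sub>1" and q2_cont: "continuous_on {0..} q\<^sub>2"
  using Ck_on_continuous[OF q_C3, of 0] Ck_on_continuous[OF q_C3, of 1] Ck_on_continuous[OF q_C3, of 2]
  by (auto simp: q\<^sub>1_def q\<^sub>2_def)

lemma q1_zero: "q\<^sub>1 0 = 0" and q2_zero_pos: "0 < q\<^sub>2 0"
  using q_zero unfolding q\<^sub>1_def q\<^sub>2_def by blast+

lemma q1_range: "0 \<le> r \<Longrightarrow> q\<^sub>1 r \<in> {0..1}" and q2_range: "0 \<le> r \<Longrightarrow> q\<^sub>2 r \<in> {0..1}"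
  unfolding q\<^sub>1_def q\<^sub>2_def by (rule q_deriv1, assumption) (rule q_deriv2)

text \<open>Integrates q'' \<le> 1 from q'(0) = 0. This linear vanishing compensates the blow-up of
  the second derivative of \<open>lam\<close> at the boundary.\<close>

lemma q1_le: assumes "0 \<le> r" shows "\<bar>q\<^sub>1 r\<bar> \<le> r"
proof -
  have "\<bar>q\<^sub>1 r - q\<^sub>1 0\<bar> \<le> 1 * (r - 0)"
  proof (rule abs_diff_le_off_finite[where S = "{}" and f' = q\<^sub>2])
    show "continuous_on {0..r} q\<^sub>1" by (rule continuous_on_subset[OF q1_cont]) auto
    fix x assume "x \<in> {0<..<r} - {}"
    then have "0 < x" by simp
    then show "(q\<^sub>1 has_real_derivative q\<^sub>2 x) (at x)" "\<bar>q\<^sub>2 x\<bar> \<le> 1"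
      using q1_has_deriv[of x] q2_range[of x] by auto
  qed (use assms in auto)
  then show ?thesis using q1_zero by simp
qed

text \<open>Near 0 the inequality q'' > q''(0)/2 is integrated twice; away from 0 the positive
  minimum of \<open>q\<close> on a compact interval is compared with the largest possible
  square.\<close>

lemma q_lower: obtains c where "0 < c" "\<And>r. 0 \<le> r \<Longrightarrow> r \<le> R \<Longrightarrow> c * r\<^sup>2 \<le> q r"
proof -
  define m where "m = q\<^sub>2 0 / 2"
  have m: "0 < m" "m < q\<^sub>2 0" using q2_zero_pos by (auto simp: m_def)
  have "(q\<^sub>2 \<longlongrightarrow> q\<^sub>2 0) (at 0 within {0..})" using q2_cont by (simp add: continuous_on)
  then have "\<forall>\<^sub>F r in at 0 within {0..}. m < q\<^sub>2 r" using m(2) by (rule order_tendstoD)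
  then obtain \<rho> where \<rho>: "0 < \<rho>" "\<And>r. 0 < r \<Longrightarrow> r < \<rho> \<Longrightarrow> m < q\<^sub>2 r"
    by (auto simp: eventually_at dist_real_def)
  have q1: "m * r < q\<^sub>1 r" if r: "0 < r" "r < \<rho>" for r
  proof -
    have "(\<lambda>r. q\<^sub>1 r - m * r) 0 < (\<lambda>r. q\<^sub>1 r - m * r) r"
    proof (rule DERIV_pos_imp_increasing_open[OF r(1)])
      fix x assume x: "0 < x" "x < r"
      have "((\<lambda>r. q\<^sub>1 r - m * r) has_real_derivative q\<^sub>2 x - m) (at x)"
        using x by (auto intro!: derivative_eq_intros q1_has_deriv)
      then show "\<exists>y. ((\<lambda>r. q\<^sub>1 r - m * r) has_real_derivative y) (at x) \<and> 0 < y"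
        using \<rho>(2)[of x] x r by auto
    qed (auto intro!: continuous_intros continuous_on_subset[OF q1_cont])
    then show ?thesis using q1_zero by simp
  qed
  have qm: "m / 2 * r\<^sup>2 \<le> q r" if r: "0 < r" "r < \<rho>" for r
  proof -
    have "(\<lambda>r. q r - m / 2 * r\<^sup>2) 0 < (\<lambda>r. q r - m / 2 * r\<^sup>2) r"
    proof (rule DERIV_pos_imp_increasing_open[OF r(1)])
      fix x assume x: "0 < x" "x < r"
      have "((\<lambda>r. q r - m / 2 * r\<^sup>2) has_real_derivative q\<^sub>1 x - m * x) (at x)"
        using x by (auto intro!: derivative_eq_intros q_has_deriv)
      then show "\<exists>y. ((\<lambda>r. q r - m / 2 * r\<^sup>2) has_real_derivative y) (at x) \<and> 0 < y"
        using q1[of x] x r by auto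
    qed (auto intro!: continuous_intros continuous_on_subset[OF q_cont])
    then show ?thesis using q_zero by simp
  qed
  \<comment> \<open>Taking the maximum keeps the interval nonempty when \<open>R\<close> is smaller
    than \<rho>.\<close>
  define R' where "R' = max R \<rho>"
  obtain p where p: "p \<in> {\<rho>..R'}" "\<And>r. r \<in> {\<rho>..R'} \<Longrightarrow> q p \<le> q r"
    using continuous_attains_inf[of "{\<rho>..R'}" q] \<rho> continuous_on_subset[OF q_cont, of "{\<rho>..R'}"]
    by (auto simp: R'_def)
  have qp: "0 < q p" using p \<rho> by (intro q_pos) auto
  have R': "0 < R'" using \<rho> by (simp add: R'_def)
  show ?thesis
  proof (rule that[of "min (m / 2) (q p / R'\<^sup>2)"])
    show "0 < min (m / 2) (q p / R'\<^sup>2)" using m qp R' by simp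
    fix r assume r: "0 \<le> r" "r \<le> R"
    consider "r = 0" | "0 < r" "r < \<rho>" | "\<rho> \<le> r" using r by linarith
    then show "min (m / 2) (q p / R'\<^sup>2) * r\<^sup>2 \<le> q r"
    proof cases
      case 1 then show ?thesis using q_zero by simp
    next
      case 2
      have "min (m / 2) (q p / R'\<^sup>2) * r\<^sup>2 \<le> m / 2 * r\<^sup>2"
        by (rule mult_right_mono[OF min.cobounded1]) simp
      then show ?thesis using qm[OF 2] by linarith
    next
      case 3
      have "min (m / 2) (q p / R'\<^sup>2) * r\<^sup>2 \<le> q p / R'\<^sup>2 * R'\<^sup>2"
        using r qp by (intro mult_mono power_mono) (auto simp: R'_def m less_imp_le)
      also have "\<dots> = q p" using R' by simp
      also have "\<dots> \<le> q r" using 3 r by (intro p) (auto simp: R'_def)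
      finally show ?thesis .
    qed
  qed
qed

lemma lam_pos:
  assumes x: "x \<in> \<Omega>"
  shows "0 < lam x"
proof -
  have "0 < bdist x" using x by (auto simp: bdist_eq)
  then have "0 < inverse (\<kappa> 0) * bdist x" using kappa by (intro mult_pos_pos) auto
  also have "\<dots> \<le> lam x" using x by (intro lam_lower) auto
  finally show ?thesis .
qed

lemma lam_ends: "lam 0 = 0" "lam 1 = 0"
  using lam_lower[of 0] lam_upper[of 0] lam_lower[of 1] lam_upper[of 1] by (auto simp: bdist_eq)

lemma lam_has_deriv: "x \<in> \<Omega> \<Longrightarrow> (lam has_real_derivative lam\<^sub>1 x) (at x)"
  using Ck_on_deriv[OF lam_C2, of 0 x] by (simp add: lam\<^sub>1_def interior_open)

lemma lam1_has_deriv: "x \<in> \<Omega> \<Longrightarrow> (lam\<^sub>1 has_real_derivative lam\<^sub>2 x) (at x)"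
  using Ck_on_deriv[OF lam_C2, of 1 x] by (simp add: lam\<^sub>1_def lam\<^sub>2_def interior_open eval_nat_numeral)

lemma eta_continuous: "continuous_on {0..1} (eta q lam \<delta>)"
  unfolding eta_def
  by (intro continuous_intros continuous_on_compose2[OF q_cont lam_cont]) (use lam_nonneg in auto)

lemma eta_pos: "0 < \<delta> \<Longrightarrow> x \<in> \<Omega> \<Longrightarrow> 0 < eta q lam \<delta> x"
  by (simp add: eta_def q_pos lam_pos)

text \<open>A common bound for q(lam) and its first two derivatives on \<Omega>:
  \<open>\<kappa> 0\<close> for the value, \<open>\<kappa> 1\<close> for the first derivative, and
  the last two summands for the second one.\<close>

definition eta_scale :: real where "eta_scale = \<kappa> 0 + \<kappa> 1 + (\<kappa> 1)\<^sup>2 + \<kappa> 0 * \<kappa> 2"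

definition eta\<^sub>1 :: "real \<Rightarrow> real \<Rightarrow> real" where
  "eta\<^sub>1 \<delta> x = \<delta> * (q\<^sub>1 (lam x) * lam\<^sub>1 x)"

definition eta\<^sub>2 :: "real \<Rightarrow> real \<Rightarrow> real" where
  "eta\<^sub>2 \<delta> x = \<delta> * (q\<^sub>2 (lam x) * (lam\<^sub>1 x)\<^sup>2 + q\<^sub>1 (lam x) * lam\<^sub>2 x)"

text \<open>In the second derivative q''(lam) lam'^2 + q'(lam) lam'' the last term is at most lam
  |lam''|, and lam \<le> \<open>\<kappa> 0 * bdist\<close> cancels the factor 1/\<open>bdist\<close>
  in the bound of lam''. Since |t| \<le> 1, the resulting bound does not depend on
  \<open>t\<close>.\<close>

lemma displacement_eta:
  assumes \<delta>: "0 < \<delta>" "eta_scale * \<delta> \<le> 1 / 4" and t: "\<bar>t\<bar> \<le> 1" "t \<noteq> 0"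
  obtains c where "displacement (\<lambda>x. t * eta q lam \<delta> x) (\<lambda>x. t * eta\<^sub>1 \<delta> x) (\<lambda>x. t * eta\<^sub>2 \<delta> x) (eta_scale * \<delta>) c"
proof -
  obtain c\<^sub>0 where c0: "0 < c\<^sub>0" "\<And>r. 0 \<le> r \<Longrightarrow> r \<le> \<kappa> 0 \<Longrightarrow> c\<^sub>0 * r\<^sup>2 \<le> q r"
    using q_lower[of "\<kappa> 0"] by blast
  have d: "0 < bdist x" "bdist x \<le> 1" "x * (1 - x) \<le> bdist x" if "x \<in> \<Omega>" for x
    using that mult_left_le[of x "1 - x"] mult_left_le[of "1 - x" x]
    by (auto simp: bdist_eq mult.commute)
  have l1: "\<bar>lam\<^sub>1 x\<bar> \<le> \<kappa> 1" if "x \<in> \<Omega>" for x using lam_derivs[OF that, of 1] d[OF that] by (simp add: lam\<^sub>1_def)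
  have l0: "lam x \<le> \<kappa> 0 * bdist x" "lam x \<le> \<kappa> 0" if "x \<in> \<Omega>" for x
  proof -
    show "lam x \<le> \<kappa> 0 * bdist x" using lam_upper[of x] that by auto
    also have "\<dots> \<le> \<kappa> 0 * 1" using d[OF that] kappa by (intro mult_left_mono) auto
    finally show "lam x \<le> \<kappa> 0" by simp
  qed
  have l2: "lam x * \<bar>lam\<^sub>2 x\<bar> \<le> \<kappa> 0 * \<kappa> 2" if x: "x \<in> \<Omega>" for x
  proof -
    have "\<bar>lam\<^sub>2 x\<bar> \<le> \<kappa> 2 * inverse (bdist x)"
      using lam_derivs[OF x, of 2] by (simp add: lam\<^sub>2_def power_int_minus)
    then have "lam x * \<bar>lam\<^sub>2 x\<bar> \<le> (\<kappa> 0 * bdist x) * (\<kappa> 2 * inverse (bdist x))"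
      using l0[OF x] lam_pos[OF x] kappa d[OF x] by (intro mult_mono) auto
    moreover have "(\<kappa> 0 * bdist x) * (\<kappa> 2 * inverse (bdist x)) = \<kappa> 0 * \<kappa> 2"
      using d(1)[OF x] by (simp add: field_simps)
    ultimately show ?thesis by simp
  qed
  have q1b: "\<bar>q\<^sub>1 (lam x)\<bar> \<le> 1" "\<bar>q\<^sub>1 (lam x)\<bar> \<le> lam x" "\<bar>q\<^sub>2 (lam x)\<bar> \<le> 1" if "x \<in> \<Omega>" for x
    using q1_range[of "lam x"] q2_range[of "lam x"] q1_le[of "lam x"] lam_pos[OF that] by auto
  have scale: "\<bar>t * (\<delta> * y)\<bar> \<le> eta_scale * \<delta>" if "\<bar>y\<bar> \<le> eta_scale" for y
  proof -
    have "\<bar>t * (\<delta> * y)\<bar> = \<bar>t\<bar> * (\<delta> * \<bar>y\<bar>)" using \<delta> by (simp add: abs_mult)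
    also have "\<dots> \<le> 1 * (\<delta> * eta_scale)" using that t \<delta> by (intro mult_mono) auto
    finally show ?thesis by (simp add: mult.commute)
  qed
  have scale_ge: "\<kappa> 0 \<le> eta_scale" "\<kappa> 1 \<le> eta_scale" "(\<kappa> 1)\<^sup>2 + \<kappa> 0 * \<kappa> 2 \<le> eta_scale"
    unfolding eta_scale_def using kappa mult_nonneg_nonneg[of "\<kappa> 0" "\<kappa> 2"] by auto
  show ?thesis
  \<comment> \<open>The witness combines \<open>q r \<ge> c\<^sub>0 * r\<^sup>2\<close> with
    \<open>lam x \<ge> x * (1 - x) / \<kappa> 0\<close>, which holds because x (1 - x) is at most
    the distance to the boundary.\<close>
  proof (rule that[of "\<bar>t\<bar> * (\<delta> * (c\<^sub>0 * (inverse (\<kappa> 0))\<^sup>2))"], unfold_locales)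
    show "continuous_on {0..1} (\<lambda>x. t * eta q lam \<delta> x)"
      by (intro continuous_intros eta_continuous)
    show "t * eta q lam \<delta> 0 = 0" "t * eta q lam \<delta> 1 = 0"
      using lam_ends q_zero by (auto simp: eta_def)
    show "eta_scale * \<delta> \<le> 1 / 4" by (rule \<delta>)
    show "0 < \<bar>t\<bar> * (\<delta> * (c\<^sub>0 * (inverse (\<kappa> 0))\<^sup>2))"
      using t \<delta> c0 kappa by simp
    have "continuous_on \<Omega> lam" using lam_cont by (rule continuous_on_subset) auto
    moreover have "lam ` \<Omega> \<subseteq> {0..}"
      using lam_pos less_imp_le by blast
    ultimately have "continuous_on \<Omega> (\<lambda>x. q\<^sub>2 (lam x))" "continuous_on \<Omega> (\<lambda>x. q\<^sub>1 (lam x))"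
      using continuous_on_compose2[OF q2_cont] continuous_on_compose2[OF q1_cont] by blast+
    then show "continuous_on \<Omega> (\<lambda>x. t * eta\<^sub>2 \<delta> x)"
      unfolding eta\<^sub>2_def
      using Ck_on_continuous[OF lam_C2, of 1] Ck_on_continuous[OF lam_C2, of 2]
      by (intro continuous_intros) (auto simp: lam\<^sub>1_def lam\<^sub>2_def)
    fix x assume x: "x \<in> \<Omega>"
    note lp = lam_pos[OF x]
    have dq: "((\<lambda>x. q (lam x)) has_real_derivative q\<^sub>1 (lam x) * lam\<^sub>1 x) (at x)"
      by (rule DERIV_chain2[OF q_has_deriv[OF lp] lam_has_deriv[OF x]])
    then show "((\<lambda>x. t * eta q lam \<delta> x) has_real_derivative t * eta\<^sub>1 \<delta> x) (at x)"
      unfolding eta_def eta\<^sub>1_def by (intro DERIV_cmult)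
    have "((\<lambda>x. q\<^sub>1 (lam x)) has_real_derivative q\<^sub>2 (lam x) * lam\<^sub>1 x) (at x)"
      by (rule DERIV_chain2[OF q1_has_deriv[OF lp] lam_has_deriv[OF x]])
    from DERIV_mult[OF this lam1_has_deriv[OF x]]
    have "((\<lambda>x. q\<^sub>1 (lam x) * lam\<^sub>1 x) has_real_derivative q\<^sub>2 (lam x) * (lam\<^sub>1 x)\<^sup>2 + q\<^sub>1 (lam x) * lam\<^sub>2 x) (at x)"
      by (rule DERIV_cong) (simp add: power2_eq_square)
    then show "((\<lambda>x. t * eta\<^sub>1 \<delta> x) has_real_derivative t * eta\<^sub>2 \<delta> x) (at x)"
      unfolding eta\<^sub>1_def eta\<^sub>2_def by (intro DERIV_cmult)
    have "\<bar>q (lam x)\<bar> \<le> eta_scale"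
      using q_le[OF lp] q_nonneg[of "lam x"] lp l0[OF x] scale_ge by linarith
    then show "\<bar>t * eta q lam \<delta> x\<bar> \<le> eta_scale * \<delta>" unfolding eta_def by (rule scale)
    have "\<bar>q\<^sub>1 (lam x) * lam\<^sub>1 x\<bar> \<le> 1 * \<kappa> 1"
      unfolding abs_mult using q1b[OF x] l1[OF x] by (intro mult_mono) auto
    then show "\<bar>t * eta\<^sub>1 \<delta> x\<bar> \<le> eta_scale * \<delta>" unfolding eta\<^sub>1_def using scale_ge by (intro scale) simp
    have "\<bar>q\<^sub>2 (lam x) * (lam\<^sub>1 x)\<^sup>2\<bar> \<le> 1 * (\<kappa> 1)\<^sup>2"
      unfolding abs_mult using q1b[OF x] power_mono[OF l1[OF x], of 2] by (intro mult_mono) auto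
    moreover have "\<bar>q\<^sub>1 (lam x) * lam\<^sub>2 x\<bar> \<le> lam x * \<bar>lam\<^sub>2 x\<bar>"
      unfolding abs_mult using q1b[OF x] by (intro mult_right_mono) auto
    ultimately have "\<bar>q\<^sub>2 (lam x) * (lam\<^sub>1 x)\<^sup>2 + q\<^sub>1 (lam x) * lam\<^sub>2 x\<bar> \<le> eta_scale"
      using l2[OF x] scale_ge(3) by linarith
    then show "\<bar>t * eta\<^sub>2 \<delta> x\<bar> \<le> eta_scale * \<delta>" unfolding eta\<^sub>2_def by (rule scale)
    have "inverse (\<kappa> 0) * (x * (1 - x)) \<le> inverse (\<kappa> 0) * bdist x"
      using d[OF x] kappa by (intro mult_left_mono) auto
    then have "inverse (\<kappa> 0) * (x * (1 - x)) \<le> lam x" using lam_lower[of x] x by auto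
    then have "(inverse (\<kappa> 0) * (x * (1 - x)))\<^sup>2 \<le> (lam x)\<^sup>2"
      using x kappa by (intro power_mono) auto
    then have "c\<^sub>0 * (inverse (\<kappa> 0) * (x * (1 - x)))\<^sup>2 \<le> c\<^sub>0 * (lam x)\<^sup>2" using c0 by (intro mult_left_mono) auto
    also have "\<dots> \<le> q (lam x)" using c0 lp l0[OF x] by auto
    finally have "\<bar>t\<bar> * (\<delta> * (c\<^sub>0 * (inverse (\<kappa> 0) * (x * (1 - x)))\<^sup>2)) \<le> \<bar>t\<bar> * (\<delta> * q (lam x))"
      using \<delta> by (intro mult_left_mono) auto
    moreover have "\<bar>t * eta q lam \<delta> x\<bar> = \<bar>t\<bar> * (\<delta> * q (lam x))"
      using \<delta> q_nonneg[of "lam x"] lp by (simp add: eta_def abs_mult)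
    ultimately show "\<bar>t\<bar> * (\<delta> * (c\<^sub>0 * (inverse (\<kappa> 0))\<^sup>2)) * (x\<^sup>2 * (1 - x)\<^sup>2) \<le> \<bar>t * eta q lam \<delta> x\<bar>"
      by (simp add: power_mult_distrib mult.assoc)
  qed
qed

end

section \<open>The nonlocal form as an average of difference quotients\<close>

text \<open>The origin is removed since \<open>dquot\<close> below has the junk value \<open>0\<close> at \<open>t = 0\<close>.\<close>

definition punctured :: "real set" where
  "punctured = {-1<..<1} - {0}"

lemma punctured_sets [simp]: "punctured \<in> sets lebesgue"
  unfolding punctured_def by (rule sets_completionI_sets) simp

definition radial_measure :: "real \<Rightarrow> real measure" where
  "radial_measure \<beta> = density (lebesgue_on punctured) (\<lambda>t. ennreal ((3 - \<beta>) / 2 * \<bar>t\<bar> powr (2 - \<beta>)))"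

lemma powr_integral:
  assumes "\<beta> < (3::real)"
  shows "integrable (lebesgue_on punctured) (\<lambda>t. \<bar>t\<bar> powr (2 - \<beta>))"
    and "(\<integral>t. \<bar>t\<bar> powr (2 - \<beta>) \<partial>lebesgue_on punctured) = 2 / (3 - \<beta>)"
proof -
  let ?f = "\<lambda>t::real. \<bar>t\<bar> powr (2 - \<beta>)"
  have "((\<lambda>t. t powr (2 - \<beta>)) has_integral (1 powr (2 - \<beta> + 1) / (2 - \<beta> + 1))) {0..1}"
    by (rule has_integral_powr_from_0) (use assms in auto)
  then have "((\<lambda>t. t powr (2 - \<beta>)) has_integral (1 / (3 - \<beta>))) {0..1}" by simp
  then have r: "(?f has_integral (1 / (3 - \<beta>))) {0..1}"
    by (rule has_integral_eq[rotated]) simp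
  then have "((\<lambda>t. ?f (- t)) has_integral (1 / (3 - \<beta>))) {- 1..- 0}"
    by (subst has_integral_reflect_real)
  then have l: "(?f has_integral (1 / (3 - \<beta>))) {- 1..0}" by simp
  have "(?f has_integral (1 / (3 - \<beta>) + 1 / (3 - \<beta>))) {- 1..1}"
    by (rule has_integral_combine[OF _ _ l r]) auto
  then have "(?f has_integral (2 / (3 - \<beta>))) {- 1..1}" by simp
  then have hi: "(?f has_integral (2 / (3 - \<beta>))) punctured"
  proof (rule has_integral_spike_set_eq[THEN iffD1, rotated 2])
    show "negligible {x \<in> {- 1..1} - punctured. ?f x \<noteq> 0}"
      by (rule negligible_subset[of "{-1, 0, 1}"]) (auto simp: punctured_def)
    show "negligible {x \<in> punctured - {- 1..1}. ?f x \<noteq> 0}"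
      by (rule negligible_subset[of "{}"]) (auto simp: punctured_def)
  qed
  then have "?f absolutely_integrable_on punctured"
    by (intro nonnegative_absolutely_integrable_1) auto
  then show i: "integrable (lebesgue_on punctured) ?f"
    by (rule absolutely_integrable_imp_integrable) simp
  show "(\<integral>t. ?f t \<partial>lebesgue_on punctured) = 2 / (3 - \<beta>)"
    using lebesgue_integral_eq_integral[OF i] integral_unique[OF hi] by simp
qed

lemma powr_measurable: "(\<lambda>t::real. \<bar>t\<bar> powr a) \<in> borel_measurable (lebesgue_on A)"
  by (rule borel_measurable_lebesgue_on) measurable

lemma radial_measure_props:
  assumes "\<beta> < (3::real)"
  shows "space (radial_measure \<beta>) = punctured"
    and "emeasure (radial_measure \<beta>) punctured = 1"
    and "sets (radial_measure \<beta>) = sets (lebesgue_on punctured)"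
    and "finite_measure (radial_measure \<beta>)"
    and "measure (radial_measure \<beta>) punctured = 1"
proof -
  let ?w = "\<lambda>t::real. (3 - \<beta>) / 2 * \<bar>t\<bar> powr (2 - \<beta>)"
  show sp: "space (radial_measure \<beta>) = punctured" by (simp add: radial_measure_def)
  show "sets (radial_measure \<beta>) = sets (lebesgue_on punctured)" by (simp add: radial_measure_def)
  have "emeasure (radial_measure \<beta>) punctured = (\<integral>\<^sup>+ t. ennreal (?w t) * indicator punctured t \<partial>lebesgue_on punctured)"
    unfolding radial_measure_def
    using powr_measurable by (intro emeasure_density) (auto simp: sets_restrict_space_iff)
  also have "\<dots> = (\<integral>\<^sup>+ t. ennreal (?w t) \<partial>lebesgue_on punctured)"
    by (rule nn_integral_cong) simp
  also have "\<dots> = ennreal (\<integral>t. ?w t \<partial>lebesgue_on punctured)"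
    by (rule nn_integral_eq_integral) (use powr_integral[OF assms] assms in auto)
  also have "(\<integral>t. ?w t \<partial>lebesgue_on punctured) = 1"
    using powr_integral(2)[OF assms] assms by simp
  finally show e: "emeasure (radial_measure \<beta>) punctured = 1" by simp
  then show "finite_measure (radial_measure \<beta>)" by (intro finite_measureI) (simp add: sp)
  show "measure (radial_measure \<beta>) punctured = 1" using e by (simp add: measure_def)
qed

lemma integral_radial_measure:
  assumes "\<beta> < (3::real)" "f \<in> borel_measurable (lebesgue_on punctured)"
  shows "(\<integral>t. f t \<partial>radial_measure \<beta>) = (\<integral>t. (3 - \<beta>) / 2 * \<bar>t\<bar> powr (2 - \<beta>) * f t \<partial>lebesgue_on punctured)"
  unfolding radial_measure_def
  using assms powr_measurable by (subst integral_density) (auto intro!: AE_I2)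

text \<open>\<open>quot\<close> belongs to one fixed displacement; this version has \<open>t\<close>
  as an argument, so that it can be integrated over pairs (x, t).\<close>

definition dquot :: "(real \<Rightarrow> real) \<Rightarrow> (real \<Rightarrow> real) \<Rightarrow> real \<Rightarrow> real \<Rightarrow> real" where
  "dquot \<eta> v x t = (v (x + t * \<eta> x) - v x) / (t * \<eta> x)"

text \<open>The powers of \<open>e\<close> have exponents 1 (from dy), -(3 - \<beta>) (from the
  weight) and 2 - \<beta> (from the kernel), which add up to 0. This is why the radial measure does
  not depend on the horizon.\<close>

lemma kernel_scaling:
  assumes "0 < e" "t \<noteq> (0::real)"
  shows "e * (e powr (- (3 - \<beta>)) * ((t * e)\<^sup>2 / (\<bar>t\<bar> * e) powr \<beta>)) = \<bar>t\<bar> powr (2 - \<beta>)"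
proof -
  have "(t * e)\<^sup>2 = (\<bar>t\<bar> * e) powr 2" using assms by (simp add: power_mult_distrib)
  then have "(t * e)\<^sup>2 / (\<bar>t\<bar> * e) powr \<beta> = (\<bar>t\<bar> * e) powr (2 - \<beta>)" by (simp add: powr_diff)
  also have "\<dots> = \<bar>t\<bar> powr (2 - \<beta>) * e powr (2 - \<beta>)" using assms by (simp add: powr_mult)
  finally have "e * (e powr (- (3 - \<beta>)) * ((t * e)\<^sup>2 / (\<bar>t\<bar> * e) powr \<beta>))
      = \<bar>t\<bar> powr (2 - \<beta>) * (e powr 1 * e powr (- (3 - \<beta>)) * e powr (2 - \<beta>))"
    using assms by simp
  also have "e powr 1 * e powr (- (3 - \<beta>)) * e powr (2 - \<beta>) = 1"
    using assms unfolding powr_add[symmetric] by simp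
  finally show ?thesis by simp
qed

lemma inner_integral_rescaled:
  fixes u v :: "real \<Rightarrow> real"
  assumes \<beta>: "\<beta> < 3" and x: "x \<in> \<Omega>" and e: "0 < \<eta> x" "{x - \<eta> x<..<x + \<eta> x} \<subseteq> \<Omega>"
    and u: "\<And>x y. x \<in> {0..1} \<Longrightarrow> y \<in> {0..1} \<Longrightarrow> \<bar>u x - u y\<bar> \<le> Lu * \<bar>x - y\<bar>" "continuous_on {0..1} u"
    and v: "\<And>x y. x \<in> {0..1} \<Longrightarrow> y \<in> {0..1} \<Longrightarrow> \<bar>v x - v y\<bar> \<le> Lv * \<bar>x - y\<bar>" "continuous_on {0..1} v"
  shows "(\<integral>y. (3 - \<beta>) / 2 * \<eta> x powr (- (3 - \<beta>)) * indicator {y. \<bar>y - x\<bar> < \<eta> x} y *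
             ((u x - u y) * (v x - v y) / \<bar>x - y\<bar> powr \<beta>) \<partial>lebesgue_on \<Omega>)
     = (\<integral>t. dquot \<eta> u x t * dquot \<eta> v x t \<partial>radial_measure \<beta>)"
proof -
  let ?e = "\<eta> x"
  define f where "f y = (3 - \<beta>) / 2 * ?e powr (- (3 - \<beta>)) * ((u x - u y) * (v x - v y) / \<bar>x - y\<bar> powr \<beta>)" for y
  define g where "g t = x + t * ?e" for t
  \<comment> \<open>Removing y = x matches the removal of t = 0. The integrand is 0 at that point,
    so the integral is unchanged.\<close>
  define A where "A = {x - ?e<..<x + ?e} - {x}"
  have gt: "g t \<in> {x - ?e<..<x + ?e}" if "t \<in> {-1<..<1}" for t
  proof -
    have "t * ?e < 1 * ?e" "(-1) * ?e < t * ?e" using that e by (intro mult_strict_right_mono; auto)+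
    then show ?thesis by (simp add: g_def)
  qed
  have gA: "g ` punctured = A"
  proof
    show "g ` punctured \<subseteq> A"
    proof
      fix y assume "y \<in> g ` punctured"
      then obtain t where t: "t \<in> punctured" "y = g t" by blast
      then have "t \<in> {-1<..<1}" "t \<noteq> 0" by (auto simp: punctured_def)
      moreover have "g t \<noteq> x" using e \<open>t \<noteq> 0\<close> by (simp add: g_def)
      ultimately show "y \<in> A" unfolding A_def t(2) using gt by blast
    qed
    show "A \<subseteq> g ` punctured"
    proof
      fix y assume y: "y \<in> A"
      have "(y - x) / ?e < 1" "- 1 < (y - x) / ?e" "(y - x) / ?e \<noteq> 0"
        using y e(1) by (auto simp: A_def pos_divide_less_eq pos_less_divide_eq)
      then have "(y - x) / ?e \<in> punctured" by (simp add: punctured_def)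
      moreover have "g ((y - x) / ?e) = y" using e(1) by (simp add: g_def)
      ultimately show "y \<in> g ` punctured" by (metis imageI)
    qed
  qed
  have inj: "inj_on g punctured" using e by (auto simp: g_def inj_on_def)
  have dg: "(g has_field_derivative ?e) (at t within punctured)" for t
    unfolding g_def by (auto intro!: derivative_eq_intros)
  have gU: "x + t * ?e \<in> {0..1}" if "t \<in> punctured" for t
  proof -
    have "t \<in> {-1<..<1}" using that by (simp add: punctured_def)
    then have "g t \<in> \<Omega>" using gt e(2) by blast
    then show ?thesis by (simp add: g_def)
  qed
  have cQ: "continuous_on punctured (dquot \<eta> w x)" if w: "continuous_on {0..1} w" for w
  proof -
    have "continuous_on punctured (\<lambda>t. w (x + t * ?e))"
    proof (rule continuous_on_compose2[OF w])
      show "continuous_on punctured (\<lambda>t. x + t * ?e)" by (intro continuous_intros)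
      show "(\<lambda>t. x + t * ?e) ` punctured \<subseteq> {0..1}" using gU by blast
    qed
    moreover have "t * ?e \<noteq> 0" if "t \<in> punctured" for t using e that by (simp add: punctured_def)
    ultimately show ?thesis unfolding dquot_def
      by (intro continuous_on_divide continuous_on_diff continuous_on_const continuous_on_mult continuous_on_id) auto
  qed
  have mQ: "(\<lambda>t. dquot \<eta> u x t * dquot \<eta> v x t) \<in> borel_measurable (lebesgue_on punctured)"
    by (intro continuous_imp_measurable_on_sets_lebesgue continuous_intros cQ u v) simp
  have Qle: "\<bar>dquot \<eta> w x t\<bar> \<le> L"
    if w: "\<And>x y. x \<in> {0..1} \<Longrightarrow> y \<in> {0..1} \<Longrightarrow> \<bar>w x - w y\<bar> \<le> L * \<bar>x - y\<bar>" and t: "t \<in> punctured" for w L t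
  proof -
    have "\<bar>w (x + t * ?e) - w x\<bar> \<le> L * \<bar>x + t * ?e - x\<bar>"
      using gU[OF t] x by (intro w) auto
    then have "\<bar>w (x + t * ?e) - w x\<bar> \<le> L * \<bar>t * ?e\<bar>" by simp
    moreover have "0 < \<bar>t * ?e\<bar>" using e t by (simp add: punctured_def)
    ultimately show ?thesis unfolding dquot_def abs_divide by (simp only: pos_divide_le_eq)
  qed
  have Lv0: "0 \<le> Lv" using v(1)[of 0 1] by simp
  define h where "h t = (3 - \<beta>) / 2 * \<bar>t\<bar> powr (2 - \<beta>) * (dquot \<eta> u x t * dquot \<eta> v x t)" for t
  have h: "\<bar>?e\<bar> * f (g t) = h t" if t: "t \<in> punctured" for t
  proof -
    have t0: "t \<noteq> 0" using t by (simp add: punctured_def)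
    have "(u x - u (g t)) * (v x - v (g t)) = (t * ?e)\<^sup>2 * (dquot \<eta> u x t * dquot \<eta> v x t)"
      using t0 e by (simp add: dquot_def g_def power2_eq_square field_simps)
    moreover have "\<bar>x - g t\<bar> = \<bar>t\<bar> * ?e" using e by (simp add: g_def abs_mult)
    ultimately have "\<bar>?e\<bar> * f (g t) = (3 - \<beta>) / 2 * (?e * (?e powr (- (3 - \<beta>)) * ((t * ?e)\<^sup>2 / (\<bar>t\<bar> * ?e) powr \<beta>))) * (dquot \<eta> u x t * dquot \<eta> v x t)"
      using e by (simp add: f_def)
    then show ?thesis unfolding kernel_scaling[OF e(1) t0] by (simp add: h_def)
  qed
  \<comment> \<open>Absolute integrability is evident on the t side, bounded quotients against an
    integrable power; the change of variables transports it to the y side.\<close>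
  have ih: "integrable (lebesgue_on punctured) h"
  proof (rule Bochner_Integration.integrable_bound)
    show "integrable (lebesgue_on punctured) (\<lambda>t. (3 - \<beta>) / 2 * \<bar>t\<bar> powr (2 - \<beta>) * (Lu * Lv))"
      by (intro integrable_mult_left integrable_mult_right powr_integral \<beta>)
    show "h \<in> borel_measurable (lebesgue_on punctured)"
      unfolding h_def by (intro borel_measurable_times mQ powr_measurable) simp
    show "AE t in lebesgue_on punctured. norm (h t) \<le> norm ((3 - \<beta>) / 2 * \<bar>t\<bar> powr (2 - \<beta>) * (Lu * Lv))"
    proof (rule AE_I2)
      fix t assume "t \<in> space (lebesgue_on punctured)"
      then have t: "t \<in> punctured" by simp
      have "\<bar>dquot \<eta> u x t * dquot \<eta> v x t\<bar> \<le> Lu * Lv"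
        unfolding abs_mult using Qle[OF u(1) t] Qle[OF v(1) t] by (intro mult_mono) auto
      then have "\<bar>dquot \<eta> u x t * dquot \<eta> v x t\<bar> \<le> \<bar>Lu * Lv\<bar>" by linarith
      then show "norm (h t) \<le> norm ((3 - \<beta>) / 2 * \<bar>t\<bar> powr (2 - \<beta>) * (Lu * Lv))"
        unfolding h_def real_norm_def abs_mult[of "(3 - \<beta>) / 2 * \<bar>t\<bar> powr (2 - \<beta>)"]
        by (rule mult_left_mono) simp
    qed
  qed
  then have ah: "h absolutely_integrable_on punctured"
    by (simp add: integrable_restrict_space set_integrable_def)
  have "(\<lambda>t. \<bar>?e\<bar> * f (g t)) absolutely_integrable_on punctured \<longleftrightarrow> h absolutely_integrable_on punctured"
    unfolding set_integrable_def
    by (rule Bochner_Integration.integrable_cong) (auto simp: h indicator_def)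
  moreover have "integral punctured (\<lambda>t. \<bar>?e\<bar> * f (g t)) = integral punctured h"
    by (rule Henstock_Kurzweil_Integration.integral_cong) (simp add: h)
  ultimately have fA: "f absolutely_integrable_on A" "integral A f = integral punctured h"
    using has_absolute_integral_change_of_variables_1'[OF punctured_sets dg inj, of f "integral punctured h"] ah gA
    by auto
  have As: "A \<in> sets lebesgue" by (simp add: A_def)
  have "(\<integral>y. (3 - \<beta>) / 2 * ?e powr (- (3 - \<beta>)) * indicator {y. \<bar>y - x\<bar> < ?e} y *
             ((u x - u y) * (v x - v y) / \<bar>x - y\<bar> powr \<beta>) \<partial>lebesgue_on \<Omega>)
      = (\<integral>y. indicator A y *\<^sub>R f y \<partial>lebesgue_on \<Omega>)"
    by (rule Bochner_Integration.integral_cong) (auto simp: f_def A_def indicator_def abs_less_iff)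
  also have "\<dots> = (\<integral>y. indicator \<Omega> y *\<^sub>R (indicator A y *\<^sub>R f y) \<partial>lebesgue)"
    by (rule integral_restrict_space) simp
  also have "\<dots> = (\<integral>y. indicator A y *\<^sub>R f y \<partial>lebesgue)"
    using e(2) by (intro Bochner_Integration.integral_cong) (auto simp: A_def indicator_def)
  also have "\<dots> = (\<integral>y. f y \<partial>lebesgue_on A)"
    by (rule integral_restrict_space[symmetric]) (simp add: As)
  also have "\<dots> = integral A f"
    by (rule lebesgue_integral_eq_integral[OF absolutely_integrable_imp_integrable[OF fA(1) As] As])
  also have "\<dots> = (\<integral>t. h t \<partial>lebesgue_on punctured)"
    unfolding fA(2) by (rule lebesgue_integral_eq_integral[OF ih punctured_sets, symmetric])
  also have "\<dots> = (\<integral>t. dquot \<eta> u x t * dquot \<eta> v x t \<partial>radial_measure \<beta>)"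
    unfolding h_def by (rule integral_radial_measure[OF \<beta> mQ, symmetric])
  finally show ?thesis .
qed

text \<open>Only \<epsilon> must be uniform in \<open>t\<close>. The lower constant \<open>c\<close>
  may degenerate as t tends to 0, which is harmless because no estimate depends on it.\<close>

locale horizon =
  fixes \<eta> :: "real \<Rightarrow> real" and \<beta> \<epsilon> :: real
  assumes beta: "\<beta> < 3"
    and eta_cont: "continuous_on {0..1} \<eta>"
    and eta_pos: "\<And>x. x \<in> \<Omega> \<Longrightarrow> 0 < \<eta> x"
    and disp: "\<And>t. t \<in> punctured \<Longrightarrow> \<exists>\<zeta>1 \<zeta>2 c. displacement (\<lambda>x. t * \<eta> x) \<zeta>1 \<zeta>2 \<epsilon> c"
begin

lemma quot_eq_dquot:
  assumes "displacement (\<lambda>x. t * \<eta> x) \<zeta>1 \<zeta>2 \<epsilon> c"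
  shows "displacement.quot (\<lambda>x. t * \<eta> x) v x = dquot \<eta> v x t"
  by (simp add: displacement.quot_def[OF assms] displacement.shift_def[OF assms] dquot_def)

lemma shift_in_Omega:
  assumes "x \<in> \<Omega>" "t \<in> punctured"
  shows "x + t * \<eta> x \<in> \<Omega>" "\<bar>t * \<eta> x\<bar> \<le> \<epsilon>" "t * \<eta> x \<noteq> 0"
proof -
  obtain \<zeta>1 \<zeta>2 c where d: "displacement (\<lambda>x. t * \<eta> x) \<zeta>1 \<zeta>2 \<epsilon> c" using disp[OF assms(2)] by blast
  show "x + t * \<eta> x \<in> \<Omega>"
    using displacement.shift_in[OF d, of 1 x] assms by (simp add: displacement.shift_def[OF d])
  show "\<bar>t * \<eta> x\<bar> \<le> \<epsilon>" by (rule displacement.bound0[OF d assms(1)])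
  show "t * \<eta> x \<noteq> 0" by (rule displacement.nonzero[OF d assms(1)])
qed

text \<open>Each y \<noteq> x in the interval is x + t \<eta>(x) for some \<open>t\<close> in
  \<open>punctured\<close>, and the shift maps \<Omega> to itself. Hence the domain never truncates
  the interaction interval.\<close>

lemma interval_in_Omega:
  assumes "x \<in> \<Omega>"
  shows "{x - \<eta> x<..<x + \<eta> x} \<subseteq> \<Omega>"
proof
  fix y assume y: "y \<in> {x - \<eta> x<..<x + \<eta> x}"
  note p = eta_pos[OF assms]
  show "y \<in> \<Omega>"
  proof (cases "y = x")
    case False
    then have "(y - x) / \<eta> x < 1" "- 1 < (y - x) / \<eta> x" "(y - x) / \<eta> x \<noteq> 0"
      using y p by (auto simp: pos_divide_less_eq pos_less_divide_eq)
    then have "(y - x) / \<eta> x \<in> punctured" by (simp add: punctured_def)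
    from shift_in_Omega(1)[OF assms this] show ?thesis using p by simp
  qed (use assms in simp)
qed

lemma dquot_le:
  assumes "\<And>x y. x \<in> {0..1} \<Longrightarrow> y \<in> {0..1} \<Longrightarrow> \<bar>v x - v y\<bar> \<le> L * \<bar>x - y\<bar>" "x \<in> \<Omega>" "t \<in> punctured"
  shows "\<bar>dquot \<eta> v x t\<bar> \<le> L"
proof -
  obtain \<zeta>1 \<zeta>2 c where d: "displacement (\<lambda>x. t * \<eta> x) \<zeta>1 \<zeta>2 \<epsilon> c" using disp[OF assms(3)] by blast
  from displacement.quot_bound[OF d assms(1,2)] show ?thesis by (simp add: quot_eq_dquot[OF d])
qed

abbreviation "M\<^sub>x \<equiv> lebesgue_on \<Omega>"
abbreviation "M\<^sub>t \<equiv> radial_measure \<beta>"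
abbreviation "M\<^sub>p \<equiv> M\<^sub>x \<Otimes>\<^sub>M M\<^sub>t"

sublocale R: finite_measure M\<^sub>t
  by (rule radial_measure_props(4)[OF beta])

sublocale P: pair_sigma_finite M\<^sub>x M\<^sub>t ..

sublocale PF: finite_measure M\<^sub>p
  by (intro finite_measure_pair_measure Om.finite_measure_axioms R.finite_measure_axioms)

lemma space_Mp: "p \<in> space M\<^sub>p \<longleftrightarrow> fst p \<in> \<Omega> \<and> snd p \<in> punctured"
  by (cases p) (simp add: space_pair_measure radial_measure_props(1)[OF beta])

definition dquot_pair :: "(real \<Rightarrow> real) \<Rightarrow> real \<times> real \<Rightarrow> real" where
  "dquot_pair v p = dquot \<eta> v (fst p) (snd p)"

lemma measurable_fst_Omega:
  assumes "continuous_on \<Omega> f"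
  shows "(\<lambda>p. f (fst p)) \<in> borel_measurable M\<^sub>p"
proof (rule measurable_compose[OF measurable_fst])
  show "f \<in> borel_measurable M\<^sub>x"
    by (rule continuous_imp_measurable_on_sets_lebesgue[OF assms]) (rule sets_lebesgue_Omega)
qed

lemma measurable_dquot_pair:
  assumes v: "continuous_on {0..1} v"
  shows "dquot_pair v \<in> borel_measurable M\<^sub>p"
proof -
  \<comment> \<open>Continuity of \<open>v\<close> is known on [0,1] only. Clamping the argument
    gives a Borel function on the line that can be composed with measurable maps and agrees with
    \<open>v\<close> wherever the quotient evaluates it.\<close>
  define vc where "vc x = v (max 0 (min 1 x))" for x
  have "continuous_on UNIV vc" unfolding vc_def
    by (rule continuous_on_compose2[OF v]) (auto intro!: continuous_intros)
  then have vc: "vc \<in> borel_measurable borel" by (rule borel_measurable_continuous_onI)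
  have 1: "fst \<in> borel_measurable M\<^sub>p"
    using measurable_fst_Omega[of "\<lambda>x. x"] by (simp add: continuous_on_id)
  have "(\<lambda>t. t) \<in> borel_measurable M\<^sub>t"
    unfolding radial_measure_def measurable_density_eq1 by (rule borel_measurable_lebesgue_on) simp
  from measurable_compose[OF measurable_snd this]
  have 2: "snd \<in> borel_measurable M\<^sub>p" .
  have 3: "(\<lambda>p. \<eta> (fst p)) \<in> borel_measurable M\<^sub>p"
    by (intro measurable_fst_Omega continuous_on_subset[OF eta_cont]) auto
  have "(\<lambda>p. (vc (fst p + snd p * \<eta> (fst p)) - vc (fst p)) / (snd p * \<eta> (fst p))) \<in> borel_measurable M\<^sub>p"
    by (intro borel_measurable_divide borel_measurable_diff borel_measurable_times
        measurable_compose[OF _ vc] borel_measurable_add 1 2 3)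
  moreover have "dquot_pair v p = (vc (fst p + snd p * \<eta> (fst p)) - vc (fst p)) / (snd p * \<eta> (fst p))"
    if "p \<in> space M\<^sub>p" for p
  proof -
    have "fst p \<in> \<Omega>" "fst p + snd p * \<eta> (fst p) \<in> \<Omega>"
      using that shift_in_Omega(1) by (auto simp: space_Mp simp del: greaterThanLessThan_iff)
    then show ?thesis by (simp add: dquot_pair_def dquot_def vc_def)
  qed
  ultimately show ?thesis by (subst measurable_cong)
qed

lemma integrable_prod:
  assumes "f \<in> borel_measurable M\<^sub>p" "g \<in> borel_measurable M\<^sub>p"
    "\<And>p. p \<in> space M\<^sub>p \<Longrightarrow> \<bar>f p\<bar> \<le> A" "\<And>p. p \<in> space M\<^sub>p \<Longrightarrow> \<bar>g p\<bar> \<le> (B::real)"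
  shows "integrable M\<^sub>p (\<lambda>p. f p * g p)"
proof (rule PF.integrable_const_bound[where B = "A * B"])
  show "AE p in M\<^sub>p. norm (f p * g p) \<le> A * B"
  proof (rule AE_I2)
    fix p assume p: "p \<in> space M\<^sub>p"
    show "norm (f p * g p) \<le> A * B"
      unfolding real_norm_def abs_mult
      using assms(3,4)[OF p] by (intro mult_mono) auto
  qed
qed (intro borel_measurable_times assms)

lemma dquot_pair_le:
  assumes "\<And>x y. x \<in> {0..1} \<Longrightarrow> y \<in> {0..1} \<Longrightarrow> \<bar>v x - v y\<bar> \<le> L * \<bar>x - y\<bar>" "p \<in> space M\<^sub>p"
  shows "\<bar>dquot_pair v p\<bar> \<le> L"
  unfolding dquot_pair_def by (rule dquot_le[OF assms(1)]) (use assms(2) space_Mp in blast)+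

lemma form_eq_product:
  assumes u: "\<And>x y. x \<in> {0..1} \<Longrightarrow> y \<in> {0..1} \<Longrightarrow> \<bar>u x - u y\<bar> \<le> Lu * \<bar>x - y\<bar>" "continuous_on {0..1} u"
    and v: "\<And>x y. x \<in> {0..1} \<Longrightarrow> y \<in> {0..1} \<Longrightarrow> \<bar>v x - v y\<bar> \<le> Lv * \<bar>x - y\<bar>" "continuous_on {0..1} v"
  shows "(\<integral>x. (\<integral>y. (3 - \<beta>) / 2 * \<eta> x powr (- (3 - \<beta>)) * indicator {y. \<bar>y - x\<bar> < \<eta> x} y *
             ((u x - u y) * (v x - v y) / \<bar>x - y\<bar> powr \<beta>) \<partial>M\<^sub>x) \<partial>M\<^sub>x)
     = (\<integral>p. dquot_pair u p * dquot_pair v p \<partial>M\<^sub>p)"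
proof -
  have "integrable M\<^sub>p (\<lambda>p. dquot_pair u p * dquot_pair v p)"
    by (rule integrable_prod[OF measurable_dquot_pair[OF u(2)] measurable_dquot_pair[OF v(2)] dquot_pair_le[OF u(1)] dquot_pair_le[OF v(1)]])
  then have i: "integrable M\<^sub>p (\<lambda>(x, t). dquot \<eta> u x t * dquot \<eta> v x t)"
    by (simp add: dquot_pair_def case_prod_beta')
  have "(\<integral>x. (\<integral>y. (3 - \<beta>) / 2 * \<eta> x powr (- (3 - \<beta>)) * indicator {y. \<bar>y - x\<bar> < \<eta> x} y *
             ((u x - u y) * (v x - v y) / \<bar>x - y\<bar> powr \<beta>) \<partial>M\<^sub>x) \<partial>M\<^sub>x)
     = (\<integral>x. (\<integral>t. dquot \<eta> u x t * dquot \<eta> v x t \<partial>M\<^sub>t) \<partial>M\<^sub>x)"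
    by (rule Bochner_Integration.integral_cong[OF refl], rule inner_integral_rescaled[OF beta _ eta_pos interval_in_Omega u v])
      simp_all
  also have "\<dots> = (\<integral>p. dquot_pair u p * dquot_pair v p \<partial>M\<^sub>p)"
    using P.integral_fst[OF i] by (simp add: dquot_pair_def case_prod_beta')
  finally show ?thesis .
qed

text \<open>With w = u - I for the interpolant I, the energy X of w splits into the consistency
  error of the exact derivative, the difference between that derivative and the quotient of U, and
  the quotient of the interpolation error. Each is bounded by a square plus a fraction of X that is
  absorbed, the first one with the help of the Poincare inequality.\<close>

lemma galerkin_estimate:
  assumes N: "1 \<le> N" and u: "u \<in> fe_space N"
    and gal: "\<And>w. w \<in> fe_space N \<Longrightarrow> (\<integral>p. dquot_pair u p * dquot_pair w p \<partial>M\<^sub>p) = (\<integral>x. F x * w x \<partial>M\<^sub>x)"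
    and U: "continuous_on {0..1} U" "U 0 = 0" "U 1 = 0"
    and U': "continuous_on {0..1} U'" "\<And>x. x \<in> \<Omega> \<Longrightarrow> (U has_real_derivative U' x) (at x)"
    and F: "continuous_on {0..1} F" "\<And>x. x \<in> \<Omega> \<Longrightarrow> (U' has_real_derivative - F x) (at x)"
    and M: "\<And>x. x \<in> \<Omega> \<Longrightarrow> \<bar>U' x\<bar> \<le> M" "\<And>x. x \<in> \<Omega> \<Longrightarrow> \<bar>F x\<bar> \<le> M"
    and osc: "\<And>x y. x \<in> \<Omega> \<Longrightarrow> y \<in> \<Omega> \<Longrightarrow> \<bar>x - y\<bar> \<le> \<epsilon> \<Longrightarrow> \<bar>F x - F y\<bar> \<le> \<omega>"
  shows "(\<integral>x. (u x - U x)\<^sup>2 \<partial>M\<^sub>x) \<le>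
    84 * (84 * (2 * \<omega> + 7 * M * \<epsilon>)\<^sup>2 + 4 * (M * \<epsilon>)\<^sup>2 + 4 * (M * (1 / real N))\<^sup>2) + 2 * (M * (1 / real N))\<^sup>2"
proof -
  define l where "l = M * (1 / real N)"
  define \<kappa> where "\<kappa> = 2 * \<omega> + 7 * M * \<epsilon>"
  have M0: "0 \<le> M" using M(1)[of "1/2"] by simp
  have "\<bar>- F x\<bar> \<le> M" if "x \<in> \<Omega>" for x using M(2)[OF that] by simp
  from fe_interpolation[OF N U U' F(2) this]
  obtain I where I: "I \<in> fe_space N"
    and Il: "\<And>x y. x \<in> {0..1} \<Longrightarrow> y \<in> {0..1} \<Longrightarrow> \<bar>(U x - I x) - (U y - I y)\<bar> \<le> l * \<bar>x - y\<bar>"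
    unfolding l_def by blast
  define w where "w x = u x - I x" for x
  define D where "D x = U x - I x" for x
  have w: "w \<in> fe_space N" unfolding w_def by (rule fe_space_diff[OF u I])
  have cont: "continuous_on {0..1} v \<and> v 0 = 0 \<and> v 1 = 0" if "v \<in> fe_space N" for v
    using that by (simp add: fe_space_def)
  obtain Lw where Lw: "\<And>x y. x \<in> {0..1} \<Longrightarrow> y \<in> {0..1} \<Longrightarrow> \<bar>w x - w y\<bar> \<le> Lw * \<bar>x - y\<bar>"
    using fe_space_lipschitz[OF w N] by blast
  obtain Lu where Lu: "\<And>x y. x \<in> {0..1} \<Longrightarrow> y \<in> {0..1} \<Longrightarrow> \<bar>u x - u y\<bar> \<le> Lu * \<bar>x - y\<bar>"
    using fe_space_lipschitz[OF u N] by blast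
  have LU: "\<bar>U x - U y\<bar> \<le> M * \<bar>x - y\<bar>" if "x \<in> {0..1}" "y \<in> {0..1}" for x y
    by (rule lipschitz_on_unit_off_finite[where S = "{}" and f' = U']) (use that U U' M M0 in auto)
  have LD: "\<bar>D x - D y\<bar> \<le> l * \<bar>x - y\<bar>" if "x \<in> {0..1}" "y \<in> {0..1}" for x y
    using Il[OF that] by (simp add: D_def)
  have cw: "continuous_on {0..1} w" and cu: "continuous_on {0..1} u" and cI: "continuous_on {0..1} I"
    using cont w u I by blast+
  have cD: "continuous_on {0..1} D" unfolding D_def by (intro continuous_intros U cI)
  define G where "G p = U' (fst p)" for p :: "real \<times> real"
  have cU'\<Omega>: "continuous_on \<Omega> U'" by (rule continuous_on_subset[OF U'(1)]) auto
  have mG: "G \<in> borel_measurable M\<^sub>p" unfolding G_def by (rule measurable_fst_Omega[OF cU'\<Omega>])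
  have bG: "\<bar>G p\<bar> \<le> M" if "p \<in> space M\<^sub>p" for p
    unfolding G_def by (rule M(1)) (use that space_Mp in blast)
  have iww: "integrable M\<^sub>p (\<lambda>p. dquot_pair w p * dquot_pair w p)"
    by (rule integrable_prod[OF measurable_dquot_pair[OF cw] measurable_dquot_pair[OF cw] dquot_pair_le[OF Lw] dquot_pair_le[OF Lw]])
  have iuw: "integrable M\<^sub>p (\<lambda>p. dquot_pair u p * dquot_pair w p)"
    by (rule integrable_prod[OF measurable_dquot_pair[OF cu] measurable_dquot_pair[OF cw] dquot_pair_le[OF Lu] dquot_pair_le[OF Lw]])
  have iUw: "integrable M\<^sub>p (\<lambda>p. dquot_pair U p * dquot_pair w p)"
    by (rule integrable_prod[OF measurable_dquot_pair[OF U(1)] measurable_dquot_pair[OF cw] dquot_pair_le[OF LU] dquot_pair_le[OF Lw]])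
  have iDw: "integrable M\<^sub>p (\<lambda>p. dquot_pair D p * dquot_pair w p)"
    by (rule integrable_prod[OF measurable_dquot_pair[OF cD] measurable_dquot_pair[OF cw] dquot_pair_le[OF LD] dquot_pair_le[OF Lw]])
  have iGw: "integrable M\<^sub>p (\<lambda>p. G p * dquot_pair w p)"
    by (rule integrable_prod[OF mG measurable_dquot_pair[OF cw] bG dquot_pair_le[OF Lw]])
  define X where "X = (\<integral>p. dquot_pair w p * dquot_pair w p \<partial>M\<^sub>p)"
  define W where "W = (\<integral>x. (w x)\<^sup>2 \<partial>M\<^sub>x)"
  define Fw where "Fw = (\<integral>x. F x * w x \<partial>M\<^sub>x)"
  have mass: "(\<integral>t. c \<partial>M\<^sub>t) = c" for c :: real
    by (simp add: radial_measure_props[OF beta])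
  have meast: "measure M\<^sub>t (space M\<^sub>t) = 1"
    using mass[of 1] by simp
  have massp: "(\<integral>p. c \<partial>M\<^sub>p) = c" for c :: real
  proof -
    have "(\<integral>x. (\<integral>t. c \<partial>M\<^sub>t) \<partial>M\<^sub>x) = (\<integral>p. (case p of (x, t) \<Rightarrow> c) \<partial>M\<^sub>p)"
      by (rule P.integral_fst) (simp add: case_prod_beta')
    then have "(\<integral>p. c \<partial>M\<^sub>p) = (\<integral>x. (\<integral>t. c \<partial>M\<^sub>t) \<partial>M\<^sub>x)"
      by (simp only: case_prod_beta')
    also have "\<dots> = c" unfolding mass by (simp add: measure_Omega)
    finally show ?thesis .
  qed
  have measp: "measure M\<^sub>p (space M\<^sub>p) = 1"
    using massp[of 1] by simp
  have lin: "dquot_pair w p = dquot_pair u p - dquot_pair I p" "dquot_pair D p = dquot_pair U p - dquot_pair I p" for p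
    by (simp_all add: dquot_pair_def dquot_def w_def D_def diff_divide_distrib[symmetric] algebra_simps)
  \<comment> \<open>\<open>G\<close>, the exact derivative at x, is inserted so that
    \<open>consistency\<close> can be applied: the quotient of U itself would depend on
    \<open>t\<close>.\<close>
  have split: "dquot_pair w p * dquot_pair w p = dquot_pair u p * dquot_pair w p - G p * dquot_pair w p - (dquot_pair U p * dquot_pair w p - G p * dquot_pair w p) + dquot_pair D p * dquot_pair w p" for p
    unfolding lin by (simp add: algebra_simps)
  have X_eq: "X = Fw - (\<integral>p. G p * dquot_pair w p \<partial>M\<^sub>p)
      - (\<integral>p. dquot_pair U p * dquot_pair w p - G p * dquot_pair w p \<partial>M\<^sub>p) + (\<integral>p. dquot_pair D p * dquot_pair w p \<partial>M\<^sub>p)"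
    unfolding X_def Fw_def gal[OF w, symmetric] split
    using iuw iGw iUw iDw by simp
  \<comment> \<open>The fraction 1/8 is used twice below, costing X/4 in total.\<close>
  have young: "a * b \<le> 2 * c\<^sup>2 + 1/8 * (b * b)" if "\<bar>a\<bar> \<le> c" for a b c :: real
  proof -
    have "a * b \<le> 2 * a\<^sup>2 + 1/8 * (b * b)"
      using zero_le_power2[of "4 * a - b"] by (simp add: power2_eq_square algebra_simps)
    moreover have "a\<^sup>2 \<le> c\<^sup>2" using power_mono[OF that, of 2] by simp
    ultimately show ?thesis by linarith
  qed
  have T3: "(\<integral>p. dquot_pair D p * dquot_pair w p \<partial>M\<^sub>p) \<le> 2 * l\<^sup>2 + 1/8 * X"
  proof -
    have "(\<integral>p. dquot_pair D p * dquot_pair w p \<partial>M\<^sub>p) \<le> (\<integral>p. 2 * l\<^sup>2 + 1/8 * (dquot_pair w p * dquot_pair w p) \<partial>M\<^sub>p)"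
      by (rule integral_mono[OF iDw]) (use iww young[OF dquot_pair_le[OF LD]] in auto)
    then show ?thesis using iww measp by (simp add: X_def)
  qed
  have T2: "- (\<integral>p. dquot_pair U p * dquot_pair w p - G p * dquot_pair w p \<partial>M\<^sub>p) \<le> 2 * (M * \<epsilon>)\<^sup>2 + 1/8 * X"
  proof -
    \<comment> \<open>The quotient of U equals U'(z) at a point z within \<epsilon> of x, and U' has
      Lipschitz constant \<open>M\<close>.\<close>
    have close: "\<bar>G p - dquot_pair U p\<bar> \<le> M * \<epsilon>" if p: "p \<in> space M\<^sub>p" for p
    proof -
      obtain x t where xt: "p = (x, t)" by (cases p)
      have x: "x \<in> \<Omega>" and t: "t \<in> punctured" using p xt space_Mp by auto
      note s = shift_in_Omega[OF x t]
      have "x \<noteq> x + t * \<eta> x" using s(3) by simp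
      then obtain z where z: "z \<in> \<Omega>" "\<bar>z - x\<bar> \<le> \<bar>x + t * \<eta> x - x\<bar>"
        "U (x + t * \<eta> x) - U x = (x + t * \<eta> x - x) * U' z"
        by (rule mvt_between[OF x s(1) _ U'(2)])
      then have "dquot_pair U p = U' z" using s(3) by (simp add: dquot_pair_def dquot_def xt)
      moreover have "\<bar>U' x - U' z\<bar> \<le> M * \<bar>x - z\<bar>"
        by (rule lipschitz_on_unit_off_finite[where S = "{}" and f' = "\<lambda>x. - F x"]) (use U' F M M0 x z in auto)
      moreover have "M * \<bar>x - z\<bar> \<le> M * \<epsilon>" using z s(2) M0 by (intro mult_left_mono) auto
      ultimately show ?thesis by (simp add: G_def xt)
    qed
    have "(\<integral>p. G p * dquot_pair w p - dquot_pair U p * dquot_pair w p \<partial>M\<^sub>p) \<le> (\<integral>p. 2 * (M * \<epsilon>)\<^sup>2 + 1/8 * (dquot_pair w p * dquot_pair w p) \<partial>M\<^sub>p)"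
    proof (rule integral_mono)
      show "integrable M\<^sub>p (\<lambda>p. G p * dquot_pair w p - dquot_pair U p * dquot_pair w p)"
        by (rule Bochner_Integration.integrable_diff[OF iGw iUw])
      show "G p * dquot_pair w p - dquot_pair U p * dquot_pair w p \<le> 2 * (M * \<epsilon>)\<^sup>2 + 1/8 * (dquot_pair w p * dquot_pair w p)"
        if "p \<in> space M\<^sub>p" for p
        using young[OF close[OF that], of "dquot_pair w p"] by (simp only: left_diff_distrib)
    qed (use iww in auto)
    then show ?thesis using iGw iUw iww measp by (simp add: X_def)
  qed
  have iw2: "integrable M\<^sub>x (\<lambda>x. (w x)\<^sup>2)" by (intro integrable_Omega_continuous continuous_intros cw)
  have iwa: "integrable M\<^sub>x (\<lambda>x. \<bar>w x\<bar>)" by (intro integrable_Omega_continuous continuous_intros cw)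
  have T1: "Fw - (\<integral>p. G p * dquot_pair w p \<partial>M\<^sub>p) \<le> \<kappa> * (\<integral>x. \<bar>w x\<bar> \<partial>M\<^sub>x)"
  proof -
    obtain w' L S where w': "finite S" "w' \<in> borel_measurable borel" "\<And>x. \<bar>w' x\<bar> \<le> L"
      "\<And>x. x \<in> \<Omega> - S \<Longrightarrow> (w has_real_derivative w' x) (at x)"
      using fe_space_derivative[OF w N] by metis
    have iG': "integrable M\<^sub>p (\<lambda>(x, t). U' x * dquot \<eta> w x t)"
      using iGw by (simp add: G_def dquot_pair_def case_prod_beta')
    define H where "H t = (\<integral>x. U' x * dquot \<eta> w x t \<partial>M\<^sub>x)" for t
    have iH: "integrable M\<^sub>t H" unfolding H_def using P.integrable_snd[OF iG'] by simp
    have "(\<integral>p. G p * dquot_pair w p \<partial>M\<^sub>p) = (\<integral>t. H t \<partial>M\<^sub>t)"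
      unfolding H_def using P.integral_snd[OF iG'] by (simp add: G_def dquot_pair_def case_prod_beta')
    then have "Fw - (\<integral>p. G p * dquot_pair w p \<partial>M\<^sub>p) = (\<integral>t. Fw - H t \<partial>M\<^sub>t)"
      using iH meast by simp
    moreover have "(\<integral>t. Fw - H t \<partial>M\<^sub>t) \<le> (\<integral>t. \<kappa> * (\<integral>x. \<bar>w x\<bar> \<partial>M\<^sub>x) \<partial>M\<^sub>t)"
    proof (rule integral_mono)
      fix t assume "t \<in> space M\<^sub>t"
      then have t: "t \<in> punctured" by (simp add: radial_measure_props[OF beta])
      obtain \<zeta>1 \<zeta>2 c where d: "displacement (\<lambda>x. t * \<eta> x) \<zeta>1 \<zeta>2 \<epsilon> c" using disp[OF t] by blast
      have "\<bar>(\<integral>x. U' x * displacement.quot (\<lambda>x. t * \<eta> x) w x \<partial>M\<^sub>x) + (\<integral>x. - F x * w x \<partial>M\<^sub>x)\<bar>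
          \<le> \<kappa> * (\<integral>x. \<bar>w x\<bar> \<partial>M\<^sub>x)"
        unfolding \<kappa>_def
      proof (rule displacement.consistency[OF d])
        show "\<bar>- F x - - F y\<bar> \<le> \<omega>" if "x \<in> \<Omega>" "y \<in> \<Omega>" "\<bar>x - y\<bar> \<le> \<epsilon>" for x y
          using osc[OF that] by linarith
      qed (use cont[OF w] w' F M in \<open>auto intro: continuous_intros\<close>)
      then have "\<bar>H t - Fw\<bar> \<le> \<kappa> * (\<integral>x. \<bar>w x\<bar> \<partial>M\<^sub>x)"
        by (simp add: quot_eq_dquot[OF d] H_def Fw_def)
      then show "Fw - H t \<le> \<kappa> * (\<integral>x. \<bar>w x\<bar> \<partial>M\<^sub>x)" by linarith
    qed (use iH in auto)
    ultimately show ?thesis using meast by simp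
  qed
  \<comment> \<open>Since 168 = 4 * 42, the inequality W \<le> 42 X turns the last term into
    X/4.\<close>
  have young': "\<kappa> * (\<integral>x. \<bar>w x\<bar> \<partial>M\<^sub>x) \<le> 42 * \<kappa>\<^sup>2 + 1/168 * W"
  proof -
    have "(\<integral>x. \<kappa> * \<bar>w x\<bar> \<partial>M\<^sub>x) \<le> (\<integral>x. 42 * \<kappa>\<^sup>2 + 1/168 * (w x)\<^sup>2 \<partial>M\<^sub>x)"
    proof (rule integral_mono)
      show "\<kappa> * \<bar>w x\<bar> \<le> 42 * \<kappa>\<^sup>2 + 1/168 * (w x)\<^sup>2" for x
        using zero_le_power2[of "84 * \<kappa> - \<bar>w x\<bar>"]
        by (simp add: power2_diff power_mult_distrib)
    qed (use iwa iw2 in auto)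
    then show ?thesis using iwa iw2 by (simp add: W_def measure_Omega)
  qed
  have W: "W \<le> 42 * X"
  proof -
    have iw': "integrable M\<^sub>p (\<lambda>(x, t). dquot \<eta> w x t * dquot \<eta> w x t)"
      using iww by (simp add: dquot_pair_def case_prod_beta')
    define H where "H t = (\<integral>x. dquot \<eta> w x t * dquot \<eta> w x t \<partial>M\<^sub>x)" for t
    have iH: "integrable M\<^sub>t H" unfolding H_def using P.integrable_snd[OF iw'] by simp
    have XH: "X = (\<integral>t. H t \<partial>M\<^sub>t)"
      unfolding X_def H_def using P.integral_snd[OF iw'] by (simp add: dquot_pair_def case_prod_beta')
    have "(\<integral>t. W \<partial>M\<^sub>t) \<le> (\<integral>t. 42 * H t \<partial>M\<^sub>t)"
    proof (rule integral_mono)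
      fix t assume "t \<in> space M\<^sub>t"
      then have t: "t \<in> punctured" by (simp add: radial_measure_props[OF beta])
      obtain \<zeta>1 \<zeta>2 c where d: "displacement (\<lambda>x. t * \<eta> x) \<zeta>1 \<zeta>2 \<epsilon> c" using disp[OF t] by blast
      have "W \<le> 42 * (\<integral>x. (displacement.quot (\<lambda>x. t * \<eta> x) w x)\<^sup>2 \<partial>M\<^sub>x)"
        unfolding W_def by (rule displacement.poincare[OF d Lw]) (use cont[OF w] in auto)
      then show "W \<le> 42 * H t" by (simp add: quot_eq_dquot[OF d] H_def power2_eq_square)
    qed (use iH in auto)
    then show ?thesis using meast iH by (simp add: XH)
  qed
  \<comment> \<open>The absorbed terms sum to 1/8 + 1/8 + 1/4 = 1/2 of X, so the remaining constants
    42, 2 and 2 double.\<close>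
  have X: "X \<le> 84 * \<kappa>\<^sup>2 + 4 * (M * \<epsilon>)\<^sup>2 + 4 * l\<^sup>2"
    using X_eq T1 T2 T3 young' W by linarith
  have D_le: "(D x)\<^sup>2 \<le> l\<^sup>2" if "x \<in> \<Omega>" for x
  proof -
    have "\<bar>D x - D 0\<bar> \<le> l * \<bar>x - 0\<bar>" using that by (intro LD) auto
    also have "\<dots> \<le> l * 1" using that M0 N by (intro mult_left_mono) (auto simp: l_def)
    finally have "\<bar>D x\<bar> \<le> l" using U cont[OF I] by (simp add: D_def)
    from power_mono[OF this, of 2] show ?thesis by simp
  qed
  have "(\<integral>x. (u x - U x)\<^sup>2 \<partial>M\<^sub>x) \<le> (\<integral>x. 2 * (w x)\<^sup>2 + 2 * l\<^sup>2 \<partial>M\<^sub>x)"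
  proof (rule integral_mono)
    show "integrable M\<^sub>x (\<lambda>x. (u x - U x)\<^sup>2)"
      by (intro integrable_Omega_continuous continuous_intros cu U)
    fix x assume "x \<in> space M\<^sub>x"
    then have x: "x \<in> \<Omega>" by simp
    have "(a - b)\<^sup>2 \<le> 2 * a\<^sup>2 + 2 * b\<^sup>2" for a b :: real
      using zero_le_power2[of "a + b"] by (simp add: power2_diff power2_sum)
    from this[of "w x" "D x"] have "(u x - U x)\<^sup>2 \<le> 2 * (w x)\<^sup>2 + 2 * (D x)\<^sup>2"
      by (simp add: w_def D_def)
    with D_le[OF x] show "(u x - U x)\<^sup>2 \<le> 2 * (w x)\<^sup>2 + 2 * l\<^sup>2" by linarith
  qed (use iw2 in auto)
  also have "\<dots> = 2 * W + 2 * l\<^sup>2" using iw2 by (simp add: W_def measure_Omega)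
  also have "\<dots> \<le> 84 * (84 * \<kappa>\<^sup>2 + 4 * (M * \<epsilon>)\<^sup>2 + 4 * l\<^sup>2) + 2 * l\<^sup>2"
  proof -
    have "2 * W \<le> 84 * X" using W by simp
    also have "\<dots> \<le> 84 * (84 * \<kappa>\<^sup>2 + 4 * (M * \<epsilon>)\<^sup>2 + 4 * l\<^sup>2)"
      using X by (rule mult_left_mono) simp
    finally show ?thesis by (rule add_right_mono)
  qed
  finally show ?thesis unfolding \<kappa>_def l_def .
qed

end

section \<open>Convergence\<close>

lemma (in localization_pair) horizon_eta:
  assumes "\<beta> < 3" "0 < \<delta>" "eta_scale * \<delta> \<le> 1 / 4"
  shows "horizon (eta q lam \<delta>) \<beta> (eta_scale * \<delta>)"
proof
  show "\<exists>\<zeta>1 \<zeta>2 c. displacement (\<lambda>x. t * eta q lam \<delta> x) \<zeta>1 \<zeta>2 (eta_scale * \<delta>) c" if "t \<in> punctured" for t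
  proof -
    have "\<bar>t\<bar> \<le> 1" "t \<noteq> 0" using that by (auto simp: punctured_def)
    then show ?thesis using displacement_eta[OF assms(2,3)] by metis
  qed
qed (use assms eta_continuous eta_pos in auto)

text \<open>The solution and \<open>f\<close> are exchanged for their continuous representatives,
  which changes neither \<open>L2_norm\<close> nor the right-hand side of the discrete problem; the
  nonlocal form is then the product integral handled by \<open>galerkin_estimate\<close>.\<close>

lemma galerkin_error:
  assumes "\<beta> < 3" "localization_pair q lam Cq \<kappa>" and f: "f \<in> L2" and u0: "u\<^sub>0 \<in> L2"
    and \<delta>: "0 < \<delta>" "localization_pair.eta_scale \<kappa> * \<delta> \<le> 1 / 4" and N: "1 \<le> N"
    and gal: "galerkin_solution q lam \<beta> f \<delta> N u"
    and AE: "AE x in lebesgue_on \<Omega>. u\<^sub>0 x = U x" "AE x in lebesgue_on \<Omega>. f x = F x"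
    and U: "continuous_on {0..1} U" "U 0 = 0" "U 1 = 0"
    and U': "continuous_on {0..1} U'" "\<And>x. x \<in> \<Omega> \<Longrightarrow> (U has_real_derivative U' x) (at x)"
    and F: "continuous_on {0..1} F" "\<And>x. x \<in> \<Omega> \<Longrightarrow> (U' has_real_derivative - F x) (at x)"
    and M: "\<And>x. x \<in> \<Omega> \<Longrightarrow> \<bar>U' x\<bar> \<le> M" "\<And>x. x \<in> \<Omega> \<Longrightarrow> \<bar>F x\<bar> \<le> M"
    and osc: "\<And>x y. x \<in> \<Omega> \<Longrightarrow> y \<in> \<Omega> \<Longrightarrow> \<bar>x - y\<bar> \<le> localization_pair.eta_scale \<kappa> * \<delta> \<Longrightarrow> \<bar>F x - F y\<bar> \<le> \<omega>"
  shows "(L2_norm (\<lambda>x. u x - u\<^sub>0 x))\<^sup>2 \<le>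
    84 * (84 * (2 * \<omega> + 7 * M * (localization_pair.eta_scale \<kappa> * \<delta>))\<^sup>2 + 4 * (M * (localization_pair.eta_scale \<kappa> * \<delta>))\<^sup>2
      + 4 * (M * (1 / real N))\<^sup>2) + 2 * (M * (1 / real N))\<^sup>2"
proof -
  interpret localization_pair q lam Cq \<kappa> by (rule assms(2))
  interpret horizon "eta q lam \<delta>" \<beta> "eta_scale * \<delta>" by (rule horizon_eta[OF assms(1) \<delta>])
  have fe: "u \<in> fe_space N" and form: "\<And>w. w \<in> fe_space N \<Longrightarrow> nonlocal_form q lam \<beta> \<delta> u w = L2_inner f w"
    using gal by (auto simp: galerkin_solution_def)
  have cont: "continuous_on {0..1} w" if "w \<in> fe_space N" for w
    using that by (simp add: fe_space_def)
  have meas: "w \<in> borel_measurable (lebesgue_on \<Omega>)" if "continuous_on {0..1} w" for w :: "real \<Rightarrow> real"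
    by (rule borel_measurable_integrable[OF integrable_Omega_continuous[OF that]])
  obtain Lu where Lu: "\<And>x y. x \<in> {0..1} \<Longrightarrow> y \<in> {0..1} \<Longrightarrow> \<bar>u x - u y\<bar> \<le> Lu * \<bar>x - y\<bar>"
    using fe_space_lipschitz[OF fe N] by blast
  have gal': "(\<integral>p. dquot_pair u p * dquot_pair w p \<partial>M\<^sub>p) = (\<integral>x. F x * w x \<partial>M\<^sub>x)" if w: "w \<in> fe_space N" for w
  proof -
    obtain Lw where Lw: "\<And>x y. x \<in> {0..1} \<Longrightarrow> y \<in> {0..1} \<Longrightarrow> \<bar>w x - w y\<bar> \<le> Lw * \<bar>x - y\<bar>"
      using fe_space_lipschitz[OF w N] by blast
    have "nonlocal_form q lam \<beta> \<delta> u w = (\<integral>p. dquot_pair u p * dquot_pair w p \<partial>M\<^sub>p)"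
      unfolding nonlocal_form_def weight_def
      by (rule form_eq_product[OF Lu cont[OF fe] Lw cont[OF w]])
    moreover have "L2_inner f w = (\<integral>x. F x * w x \<partial>M\<^sub>x)"
      unfolding L2_inner_def
    proof (rule integral_cong_AE)
      show "(\<lambda>x. f x * w x) \<in> borel_measurable M\<^sub>x"
        by (rule borel_measurable_times[OF L2_integrable(3)[OF f] meas[OF cont[OF w]]])
      show "(\<lambda>x. F x * w x) \<in> borel_measurable M\<^sub>x"
        by (rule borel_measurable_times[OF meas[OF F(1)] meas[OF cont[OF w]]])
      show "AE x in M\<^sub>x. f x * w x = F x * w x" using AE(2) by eventually_elim simp
    qed
    ultimately show ?thesis using form[OF w] by simp
  qed
  have "(L2_norm (\<lambda>x. u x - u\<^sub>0 x))\<^sup>2 = (\<integral>x. (u x - u\<^sub>0 x)\<^sup>2 \<partial>M\<^sub>x)" by (rule L2_norm_square)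
  also have "\<dots> = (\<integral>x. (u x - U x)\<^sup>2 \<partial>M\<^sub>x)"
  proof (rule integral_cong_AE)
    show "(\<lambda>x. (u x - u\<^sub>0 x)\<^sup>2) \<in> borel_measurable M\<^sub>x"
      by (rule borel_measurable_power[OF borel_measurable_diff[OF meas[OF cont[OF fe]] L2_integrable(3)[OF u0]]])
    show "(\<lambda>x. (u x - U x)\<^sup>2) \<in> borel_measurable M\<^sub>x"
      by (rule borel_measurable_power[OF borel_measurable_diff[OF meas[OF cont[OF fe]] meas[OF U(1)]]])
    show "AE x in M\<^sub>x. (u x - u\<^sub>0 x)\<^sup>2 = (u x - U x)\<^sup>2" using AE(1) by eventually_elim simp
  qed
  finally have eq: "(L2_norm (\<lambda>x. u x - u\<^sub>0 x))\<^sup>2 = (\<integral>x. (u x - U x)\<^sup>2 \<partial>M\<^sub>x)" .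
  show ?thesis unfolding eq
    by (rule galerkin_estimate[OF N fe gal' U U' F M osc])
qed

theorem mainTheorem5:
  fixes \<beta> Cq :: real
    and \<kappa> :: "nat \<Rightarrow> real"
    and q lam f u\<^sub>0 :: "real \<Rightarrow> real"
    and u :: "real \<Rightarrow> real \<Rightarrow> real \<Rightarrow> real"
  assumes "\<beta> \<in> {0<..<3}"
    and "smooth_localization_pair q lam Cq \<kappa>"
    and "f \<in> L2"
    and "dirichlet_solution f u\<^sub>0"
    and "u\<^sub>0 \<in> Sobolev_H 4 \<inter> Sobolev_H10"
    and "\<And>\<delta> N. \<delta> \<in> {0<..<delta_star Cq \<kappa>} \<Longrightarrow> N \<ge> 1 \<Longrightarrow>
           galerkin_solution q lam \<beta> f \<delta> N (u \<delta> (1 / real N))"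
  shows "\<forall>\<delta> h. (\<forall>n. \<delta> n \<in> {0<..<delta_star Cq \<kappa>}) \<longrightarrow> (\<forall>n. h n \<in> {1 / real N |N. N \<ge> 1}) \<longrightarrow>
           \<delta> \<longlonglongrightarrow> 0 \<longrightarrow> h \<longlonglongrightarrow> 0 \<longrightarrow>
           (\<lambda>n. L2_norm (\<lambda>x. u (\<delta> n) (h n) x - u\<^sub>0 x)) \<longlonglongrightarrow> 0"
proof (intro allI impI)
  fix \<delta> h :: "nat \<Rightarrow> real"
  assume \<delta>: "\<forall>n. \<delta> n \<in> {0<..<delta_star Cq \<kappa>}" and h: "\<forall>n. h n \<in> {1 / real N |N. N \<ge> 1}"
    and \<delta>0: "\<delta> \<longlonglongrightarrow> 0" and h0: "h \<longlonglongrightarrow> 0"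
  have lp: "localization_pair q lam Cq \<kappa>" using assms(2) by (rule smooth_localization_pair.axioms)
  then interpret localization_pair q lam Cq \<kappa> .
  have u0: "u\<^sub>0 \<in> L2" using assms(5) by (simp add: Sobolev_H_def)
  have H4: "u\<^sub>0 \<in> Sobolev_H 4" using assms(5) by blast
  obtain U U' F where AE: "AE x in lebesgue_on \<Omega>. u\<^sub>0 x = U x" "AE x in lebesgue_on \<Omega>. f x = F x"
    and c: "continuous_on {0..1} U" "continuous_on {0..1} U'" "continuous_on {0..1} F"
    and d: "\<And>x. x \<in> \<Omega> \<Longrightarrow> (U has_real_derivative U' x) (at x)"
      "\<And>x. x \<in> \<Omega> \<Longrightarrow> (U' has_real_derivative - F x) (at x)"
    and e: "U 0 = 0" "U 1 = 0"
    by (rule weak_solution_regular[OF assms(4) H4]) (rule that)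
  obtain B where B: "\<forall>x\<in>{0..1}. \<bar>U' x\<bar> \<le> B" using continuous_bounded_unit[OF c(2)] .
  obtain B' where B': "\<forall>x\<in>{0..1}. \<bar>F x\<bar> \<le> B'" using continuous_bounded_unit[OF c(3)] .
  define M where "M = max B B'"
  have M: "\<bar>U' x\<bar> \<le> M" "\<bar>F x\<bar> \<le> M" if "x \<in> \<Omega>" for x
    using B B' that by (auto simp: M_def le_max_iff_disj)
  have uc: "uniformly_continuous_on {0..1} F"
    by (rule compact_uniformly_continuous[OF c(3)]) simp
  show "(\<lambda>n. L2_norm (\<lambda>x. u (\<delta> n) (h n) x - u\<^sub>0 x)) \<longlonglongrightarrow> 0"
  proof (rule LIMSEQ_I)
    fix r :: real assume r: "0 < r"
    \<comment> \<open>The oscillation is fixed in advance, so \<open>R\<close> tends to 84 * 84 * 4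
      \<omega>^2 = (168 \<omega>)^2 instead of 0; with 200 > 168 this limit is below r^2.\<close>
    define \<omega> where "\<omega> = r / 200"
    have \<omega>: "0 < \<omega>" using r by (simp add: \<omega>_def)
    obtain \<rho> where \<rho>: "0 < \<rho>" "\<And>x y. x \<in> {0..1} \<Longrightarrow> y \<in> {0..1} \<Longrightarrow> dist y x < \<rho> \<Longrightarrow> dist (F y) (F x) < \<omega>"
      using uc \<omega> unfolding uniformly_continuous_on_def by metis
    define R where "R n = 84 * (84 * (2 * \<omega> + 7 * M * (eta_scale * \<delta> n))\<^sup>2 + 4 * (M * (eta_scale * \<delta> n))\<^sup>2
      + 4 * (M * h n)\<^sup>2) + 2 * (M * h n)\<^sup>2" for n
    have "R \<longlonglongrightarrow> 84 * (84 * (2 * \<omega> + 7 * M * (eta_scale * 0))\<^sup>2 + 4 * (M * (eta_scale * 0))\<^sup>2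
      + 4 * (M * 0)\<^sup>2) + 2 * (M * 0)\<^sup>2"
      unfolding R_def by (intro tendsto_intros \<delta>0 h0)
    then have "R \<longlonglongrightarrow> 84 * (84 * (2 * \<omega>)\<^sup>2)" by simp
    moreover have "84 * (84 * (2 * \<omega>)\<^sup>2) < r\<^sup>2"
      using r by (simp add: \<omega>_def power2_eq_square)
    ultimately have ev1: "\<forall>\<^sub>F n in sequentially. R n < r\<^sup>2" by (rule order_tendstoD)
    have "(\<lambda>n. eta_scale * \<delta> n) \<longlonglongrightarrow> eta_scale * 0" by (intro tendsto_intros \<delta>0)
    \<comment> \<open>The bound 1/4 makes the rescaled horizons admissible displacements, and \<rho>
      brings the oscillation of \<open>F\<close> over one displacement below \<omega>.\<close>
    then have "\<forall>\<^sub>F n in sequentially. eta_scale * \<delta> n < min (1 / 4) \<rho>"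
      using \<rho>(1) by (intro order_tendstoD(2)[of _ "eta_scale * 0"]) auto
    with ev1 have "\<forall>\<^sub>F n in sequentially. norm (L2_norm (\<lambda>x. u (\<delta> n) (h n) x - u\<^sub>0 x) - 0) < r"
    proof eventually_elim
      case (elim n)
      obtain N where N: "1 \<le> N" "h n = 1 / real N" using h by blast
      have gal: "galerkin_solution q lam \<beta> f (\<delta> n) N (u (\<delta> n) (h n))"
        using assms(6)[of "\<delta> n" N] \<delta> N by simp
      have "(L2_norm (\<lambda>x. u (\<delta> n) (h n) x - u\<^sub>0 x))\<^sup>2 \<le> R n"
        unfolding R_def N(2)
      proof (rule galerkin_error[OF _ lp assms(3) u0 _ _ N(1) gal[unfolded N(2)] AE c(1) e c(2) d(1) c(3) d(2) M])
        show "\<bar>F x - F y\<bar> \<le> \<omega>" if "x \<in> \<Omega>" "y \<in> \<Omega>" "\<bar>x - y\<bar> \<le> eta_scale * \<delta> n" for x y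
        proof -
          have "dist x y < \<rho>" using that elim(2) by (simp add: dist_real_def)
          then have "dist (F x) (F y) < \<omega>" using that by (intro \<rho>(2)) auto
          then show ?thesis by (simp add: dist_real_def)
        qed
      qed (use assms(1) \<delta> elim(2) in auto)
      also have "\<dots> < r\<^sup>2" by (rule elim(1))
      finally have "\<bar>L2_norm (\<lambda>x. u (\<delta> n) (h n) x - u\<^sub>0 x)\<bar>\<^sup>2 < r\<^sup>2"
        by (simp only: power2_abs)
      then have "\<bar>L2_norm (\<lambda>x. u (\<delta> n) (h n) x - u\<^sub>0 x)\<bar> < r"
        by (rule power2_less_imp_less) (use r in simp)
      then show ?case by simp
    qed
    then show "\<exists>no. \<forall>n\<ge>no. norm (L2_norm (\<lambda>x. u (\<delta> n) (h n) x - u\<^sub>0 x) - 0) < r"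
      by (simp only: eventually_sequentially)
  qed
qed

end
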